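(* Let $p$ be an odd prime and let $\alpha$ be a quadratic non-residue modulo $p$. Consider the groups given by the presentations \begin{align*} E_1&=\langle x,y,z,n \mid x^{p^2}=y^p=z^p=n^p=1,\ [y,z]=x^pn^{-1},\ [x,z]=n,\ [x,y]=[x,n]=[y,n]=[z,n]=1\rangle,\\ E_2&=\langle x,y,z,n \mid x^{p^2}=y^p=z^{p^2}=n^p=1,\ x^p=z^pn,\ [x,y]=x^p,\ [x,z]=y,\ [y,z]=[x,n]=[y,n]=[z,n]=1\rangle,\\ E_3&=\langle x,y,z,n \mid x^{p^2}=y^p=z^{p^2}=n^p=1,\ z^p=x^{\alpha p}n,\ [x,z]=yn,\ [x,y]=x^p,\ [y,z]=[x,n]=[y,n]=[z,n]=1\rangle, \end{align*} and \begin{align*} G_1&=\langle x,y,z \mid x^{p^2}=y^p=z^p=1,\ [x,y]=1,\ [x,z]=1,\ [y,z]=x^p\rangle,\\ G_2&=\langle x,y,z \mid x^{p^2}=y^p=z^{p^2}=1,\ z^p=x^p,\ [x,y]=x^p,\ [x,z]=y,\ [y,z]=1\rangle,\\ G_3&=\langle x,y,z \mid x^{p^2}=y^p=z^{p^2}=1,\ z^p=x^{\alpha p},\ [x,y]=x^p,\ [x,z]=y,\ [y,z]=1\rangle. \end{align*} Then, for each $i\in\{1,2,3\}$, the group $E_i$ has order $p^5$ and minimal degree $\mu(E_i)=2p^2$, and $E_i$ is exceptional with a distinguished quotient isomorphic to $G_i$; that is, there is a normal subgroup $N_i$ of $E_i$ with $E_i/N_i\cong G_i$ and $\mu(E_i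)<\mu(E_i/N_i)$.
   Context: All groups are finite. The minimal degree $\mu(G)$ of a group $G$ is the least non-negative integer $n$ such that $G$ embeds in the symmetric group $\mathrm{Sym}(n)$. A group $G$ is called exceptional if it has a normal subgroup $N$ such that $\mu(G)<\mu(G/N)$; in this case $N$ is called a distinguished subgroup and $G/N$ a distinguished quotient of $G$. Commutators are $[a,b]=a^{-1}b^{-1}ab$. *)

theory Defs
  imports "HOL-Algebra.Sym_Groups" "HOL-Number_Theory.Residues"
begin

section \<open>Minimal degree and exceptional groups\<close>

text \<open>For a finite group the set below is nonempty by Cayley's theorem, so \<open>LEAST\<close> is a true
  minimum; for other arguments the value is unspecified.\<close>

definition min_degree :: "('a, 'b) monoid_scheme \<Rightarrow> nat" where
  "min_degree G = (LEAST n. \<exists>f. f \<in> mon G (sym_group n))"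

definition distinguished_subgroup :: "'a set \<Rightarrow> ('a, 'b) monoid_scheme \<Rightarrow> bool" where
  "distinguished_subgroup N G \<longleftrightarrow>
     finite (carrier G) \<and> N \<lhd> G \<and> min_degree G < min_degree (G Mod N)"

definition exceptional :: "('a, 'b) monoid_scheme \<Rightarrow> bool" where
  "exceptional G \<longleftrightarrow> (\<exists>N. distinguished_subgroup N G)"


section \<open>Groups given by generators and relations\<close>

subsection \<open>The free group on the elements of a type\<close>

text \<open>A word is a list of signed letters; \<open>(a, True)\<close> stands for the generator \<open>a\<close> and
  \<open>(a, False)\<close> for its inverse. Two words are equal in the free group iff they are connected by
  insertions and deletions of factors \<open>a a\<^sup>-\<^sup>1\<close> and \<open>a\<^sup>-\<^sup>1 a\<close>.\<close>

type_synonym 'a word = "('a \<times> bool) list"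

definition free_cancel :: "('a word \<times> 'a word) set" where
  "free_cancel = {(u @ [(a, b), (a, \<not> b)] @ v, u @ v) | u v a b. True}"

definition free_eq :: "('a word \<times> 'a word) set" where
  "free_eq = (free_cancel \<union> free_cancel\<inverse>)\<^sup>*"

definition free_group :: "'a word set monoid" where
  "free_group =
     \<lparr>carrier = UNIV // free_eq,
      monoid.mult = (\<lambda>U V. \<Union>u\<in>U. \<Union>v\<in>V. free_eq `` {u @ v}),
      one = free_eq `` {[]}\<rparr>"

definition free_gen :: "'a \<Rightarrow> 'a word set" where
  "free_gen a = free_eq `` {[(a, True)]}"

subsection \<open>Presentations\<close>

definition normal_closure :: "('a, 'b) monoid_scheme \<Rightarrow> 'a set \<Rightarrow> 'a set" where
  "normal_closure G R = \<Inter>{N. N \<lhd> G \<and> R \<subseteq> N}"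

text \<open>A pair \<open>(u, v)\<close> is read as the relation \<open>u = v\<close>, i.e. as the relator \<open>u v\<^sup>-\<^sup>1\<close>.\<close>

definition presented_group :: "('a word set \<times> 'a word set) set \<Rightarrow> 'a word set set monoid" where
  "presented_group R =
     free_group Mod
       normal_closure free_group {u \<otimes>\<^bsub>free_group\<^esub> inv\<^bsub>free_group\<^esub> v | u v. (u, v) \<in> R}"

definition comm :: "('a, 'b) monoid_scheme \<Rightarrow> 'a \<Rightarrow> 'a \<Rightarrow> 'a" where
  "comm G a b = inv\<^bsub>G\<^esub> a \<otimes>\<^bsub>G\<^esub> inv\<^bsub>G\<^esub> b \<otimes>\<^bsub>G\<^esub> a \<otimes>\<^bsub>G\<^esub> b"


section \<open>The groups\<close>

text \<open>The relations are written for arbitrary elements of an arbitrary group, so that the same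
  sets can be evaluated at the generators of the free group and at elements of other groups.\<close>

definition E1_rels :: "nat \<Rightarrow> ('a, 'b) monoid_scheme \<Rightarrow> 'a \<Rightarrow> 'a \<Rightarrow> 'a \<Rightarrow> 'a \<Rightarrow> ('a \<times> 'a) set" where
  "E1_rels p G x y z n =
     {(x [^]\<^bsub>G\<^esub> p\<^sup>2, \<one>\<^bsub>G\<^esub>), (y [^]\<^bsub>G\<^esub> p, \<one>\<^bsub>G\<^esub>), (z [^]\<^bsub>G\<^esub> p, \<one>\<^bsub>G\<^esub>), (n [^]\<^bsub>G\<^esub> p, \<one>\<^bsub>G\<^esub>),
      (comm G y z, x [^]\<^bsub>G\<^esub> p \<otimes>\<^bsub>G\<^esub> inv\<^bsub>G\<^esub> n), (comm G x z, n),
      (comm G x y, \<one>\<^bsub>G\<^esub>), (comm G x n, \<one>\<^bsub>G\<^esub>), (comm G y n, \<one>\<^bsub>G\<^esub>), (comm G z n, \<one>\<^bsub>G\<^esub>)}"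

definition E2_rels :: "nat \<Rightarrow> ('a, 'b) monoid_scheme \<Rightarrow> 'a \<Rightarrow> 'a \<Rightarrow> 'a \<Rightarrow> 'a \<Rightarrow> ('a \<times> 'a) set" where
  "E2_rels p G x y z n =
     {(x [^]\<^bsub>G\<^esub> p\<^sup>2, \<one>\<^bsub>G\<^esub>), (y [^]\<^bsub>G\<^esub> p, \<one>\<^bsub>G\<^esub>), (z [^]\<^bsub>G\<^esub> p\<^sup>2, \<one>\<^bsub>G\<^esub>), (n [^]\<^bsub>G\<^esub> p, \<one>\<^bsub>G\<^esub>),
      (x [^]\<^bsub>G\<^esub> p, z [^]\<^bsub>G\<^esub> p \<otimes>\<^bsub>G\<^esub> n), (comm G x y, x [^]\<^bsub>G\<^esub> p), (comm G x z, y),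
      (comm G y z, \<one>\<^bsub>G\<^esub>), (comm G x n, \<one>\<^bsub>G\<^esub>), (comm G y n, \<one>\<^bsub>G\<^esub>), (comm G z n, \<one>\<^bsub>G\<^esub>)}"

definition E3_rels ::
  "nat \<Rightarrow> int \<Rightarrow> ('a, 'b) monoid_scheme \<Rightarrow> 'a \<Rightarrow> 'a \<Rightarrow> 'a \<Rightarrow> 'a \<Rightarrow> ('a \<times> 'a) set" where
  "E3_rels p \<alpha> G x y z n =
     {(x [^]\<^bsub>G\<^esub> p\<^sup>2, \<one>\<^bsub>G\<^esub>), (y [^]\<^bsub>G\<^esub> p, \<one>\<^bsub>G\<^esub>), (z [^]\<^bsub>G\<^esub> p\<^sup>2, \<one>\<^bsub>G\<^esub>), (n [^]\<^bsub>G\<^esub> p, \<one>\<^bsub>G\<^esub>),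
      (z [^]\<^bsub>G\<^esub> p, x [^]\<^bsub>G\<^esub> (\<alpha> * int p) \<otimes>\<^bsub>G\<^esub> n), (comm G x z, y \<otimes>\<^bsub>G\<^esub> n), (comm G x y, x [^]\<^bsub>G\<^esub> p),
      (comm G y z, \<one>\<^bsub>G\<^esub>), (comm G x n, \<one>\<^bsub>G\<^esub>), (comm G y n, \<one>\<^bsub>G\<^esub>), (comm G z n, \<one>\<^bsub>G\<^esub>)}"

definition G1_rels :: "nat \<Rightarrow> ('a, 'b) monoid_scheme \<Rightarrow> 'a \<Rightarrow> 'a \<Rightarrow> 'a \<Rightarrow> ('a \<times> 'a) set" where
  "G1_rels p G x y z =
     {(x [^]\<^bsub>G\<^esub> p\<^sup>2, \<one>\<^bsub>G\<^esub>), (y [^]\<^bsub>G\<^esub> p, \<one>\<^bsub>G\<^esub>), (z [^]\<^bsub>G\<^esub> p, \<one>\<^bsub>G\<^esub>),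
      (comm G x y, \<one>\<^bsub>G\<^esub>), (comm G x z, \<one>\<^bsub>G\<^esub>), (comm G y z, x [^]\<^bsub>G\<^esub> p)}"

definition G2_rels :: "nat \<Rightarrow> ('a, 'b) monoid_scheme \<Rightarrow> 'a \<Rightarrow> 'a \<Rightarrow> 'a \<Rightarrow> ('a \<times> 'a) set" where
  "G2_rels p G x y z =
     {(x [^]\<^bsub>G\<^esub> p\<^sup>2, \<one>\<^bsub>G\<^esub>), (y [^]\<^bsub>G\<^esub> p, \<one>\<^bsub>G\<^esub>), (z [^]\<^bsub>G\<^esub> p\<^sup>2, \<one>\<^bsub>G\<^esub>),
      (z [^]\<^bsub>G\<^esub> p, x [^]\<^bsub>G\<^esub> p), (comm G x y, x [^]\<^bsub>G\<^esub> p), (comm G x z, y), (comm G y z, \<one>\<^bsub>G\<^esub>)}"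

definition G3_rels ::
  "nat \<Rightarrow> int \<Rightarrow> ('a, 'b) monoid_scheme \<Rightarrow> 'a \<Rightarrow> 'a \<Rightarrow> 'a \<Rightarrow> ('a \<times> 'a) set" where
  "G3_rels p \<alpha> G x y z =
     {(x [^]\<^bsub>G\<^esub> p\<^sup>2, \<one>\<^bsub>G\<^esub>), (y [^]\<^bsub>G\<^esub> p, \<one>\<^bsub>G\<^esub>), (z [^]\<^bsub>G\<^esub> p\<^sup>2, \<one>\<^bsub>G\<^esub>),
      (z [^]\<^bsub>G\<^esub> p, x [^]\<^bsub>G\<^esub> (\<alpha> * int p)), (comm G x y, x [^]\<^bsub>G\<^esub> p), (comm G x z, y),
      (comm G y z, \<one>\<^bsub>G\<^esub>)}"

datatype gens4 = X4 | Y4 | Z4 | N4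

datatype gens3 = X3 | Y3 | Z3

definition E1 :: "nat \<Rightarrow> gens4 word set set monoid" where
  "E1 p = presented_group
     (E1_rels p free_group (free_gen X4) (free_gen Y4) (free_gen Z4) (free_gen N4))"

definition E2 :: "nat \<Rightarrow> gens4 word set set monoid" where
  "E2 p = presented_group
     (E2_rels p free_group (free_gen X4) (free_gen Y4) (free_gen Z4) (free_gen N4))"

definition E3 :: "nat \<Rightarrow> int \<Rightarrow> gens4 word set set monoid" where
  "E3 p \<alpha> = presented_group
     (E3_rels p \<alpha> free_group (free_gen X4) (free_gen Y4) (free_gen Z4) (free_gen N4))"

definition G1 :: "nat \<Rightarrow> gens3 word set set monoid" where
  "G1 p = presented_group (G1_rels p free_group (free_gen X3) (free_gen Y3) (free_gen Z3))"

definition G2 :: "nat \<Rightarrow> gens3 word set set monoid" where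
  "G2 p = presented_group (G2_rels p free_group (free_gen X3) (free_gen Y3) (free_gen Z3))"

definition G3 :: "nat \<Rightarrow> int \<Rightarrow> gens3 word set set monoid" where
  "G3 p \<alpha> = presented_group (G3_rels p \<alpha> free_group (free_gen X3) (free_gen Y3) (free_gen Z3))"

end

theory Submission
  imports Defs "HOL-Algebra.Group_Action"
begin

text \<open>
  In a faithful action every nontrivial element moves some point, and a central element that fixes
  one point of an orbit fixes them all. The degrees are bounded by the orbits on which central
  elements of order \<open>p\<close> act nontrivially.

  The quotients \<open>G\<^sub>i\<close> have order \<open>p\<^sup>4\<close>, and every subgroup that avoids the central element
  \<open>w = x\<^sup>p\<close> has order at most \<open>p\<close> (\<open>avoiding_small_if_cyclic_centre\<close>,
  \<open>avoiding_small_if_maximal_class\<close>). The stabilizer of a point moved by \<open>w\<close> is such a subgroup,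
  so its orbit has at least \<open>p\<^sup>3 > 2p\<^sup>2\<close> points.

  In \<open>E\<^sub>i\<close> the element \<open>w\<close> is joined by a second central element, and the two span an elementary
  abelian central subgroup \<open>Z\<close> of order \<open>p\<^sup>2\<close>. There are now two subgroups of order \<open>p\<^sup>3\<close> that
  meet \<open>Z\<close> in different subgroups of order \<open>p\<close>; the actions on their cosets together are faithful
  and have degree \<open>p\<^sup>2 + p\<^sup>2\<close>. No smaller degree is possible: \<open>Z\<close> is generated by a commutator
  and a \<open>p\<close>-th power, hence lies in every subgroup of index at most \<open>p\<close>, so that every orbit on
  which \<open>Z\<close> acts nontrivially has at least \<open>p\<^sup>2\<close> points. Either there are two such orbits, or
  \<open>Z\<close> acts faithfully on one, and then that orbit has at least \<open>p\<^sup>3\<close> points because \<open>Z\<close> has no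
  complement (\<open>degree_ge_if_frattini_centre\<close>).

  The orders come from the same two actions. The relations let every element of \<open>E\<^sub>i\<close> be written in
  one of \<open>p\<^sup>5\<close> normal forms; explicit permutations of \<open>2p\<^sup>2\<close> points satisfy the relations, so
  they define a homomorphism on \<open>E\<^sub>i\<close>, and it takes different values on different normal forms.
  This shows at once that \<open>E\<^sub>i\<close> has order \<open>p\<^sup>5\<close> and that the representation is faithful.

  \<open>E\<^sub>2\<close> and \<open>E\<^sub>3\<close> are treated together. If \<open>y\<close> is replaced by \<open>y n\<close> in \<open>E\<^sub>3\<close>, the relations between
  \<open>x\<close>, \<open>y\<close> and \<open>z\<close> become those of \<open>E\<^sub>2\<close>, and \<open>n\<close> is the element \<open>x\<^sup>-\<^sup>\<alpha>\<^sup>p z\<^sup>p\<close>; in \<open>E\<^sub>2\<close> the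
  inverse of \<open>n\<close> is this element for \<open>\<alpha> = 1\<close>. The residue \<open>\<alpha>\<close> thus selects the subgroup of \<open>Z\<close>
  that is factored out. A non-residue is prime to \<open>p\<close>, so \<open>z\<^sup>p\<close> and \<open>x\<^sup>p\<close> generate the
  same subgroup of the quotient.
\<close>

section \<open>Free groups and presentations\<close>

lemma equiv_free_eq: "equiv UNIV free_eq"
proof (rule equivI)
  show "sym free_eq" unfolding free_eq_def
    by (rule sym_rtrancl) (auto simp: sym_def)
qed (auto simp: free_eq_def refl_rtrancl trans_rtrancl)

lemma free_cancel_context:
  "(u, v) \<in> free_cancel \<Longrightarrow> (s @ u @ t, s @ v @ t) \<in> free_cancel"
  unfolding free_cancel_def
  by clarsimp (metis append.assoc append_Cons append_Nil)

lemma free_eq_context: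
  assumes "(u, v) \<in> free_eq"
  shows "(s @ u @ t, s @ v @ t) \<in> free_eq"
  using assms unfolding free_eq_def
proof (induction rule: rtrancl_induct)
  case (step v w)
  then have "(s @ v @ t, s @ w @ t) \<in> free_cancel \<union> free_cancel\<inverse>"
    by (auto intro: free_cancel_context)
  with step.IH show ?case by (rule rtrancl_into_rtrancl)
qed simp

lemma free_eq_append:
  assumes "(u, u') \<in> free_eq" "(v, v') \<in> free_eq"
  shows "(u @ v, u' @ v') \<in> free_eq"
  using free_eq_context[OF assms(1), of "[]" v] free_eq_context[OF assms(2), of u' "[]"]
    equivE[OF equiv_free_eq] by (auto elim: transE)

abbreviation fclass :: "'a word \<Rightarrow> 'a word set" where
  "fclass w \<equiv> free_eq `` {w}"

lemma fclass_eq_iff: "fclass u = fclass v \<longleftrightarrow> (u, v) \<in> free_eq"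
  using eq_equiv_class_iff[OF equiv_free_eq] by blast

lemma free_mult: "fclass u \<otimes>\<^bsub>free_group\<^esub> fclass v = fclass (u @ v)"
proof -
  have "congruent2 free_eq free_eq (\<lambda>u v. fclass (u @ v))"
    by (auto simp: congruent2_def fclass_eq_iff free_eq_append)
  from UN_equiv_class2[OF equiv_free_eq equiv_free_eq this]
  show ?thesis by (simp add: free_group_def)
qed

lemma free_carrierE:
  assumes "U \<in> carrier free_group" obtains u where "U = fclass u"
  using assms by (auto simp: free_group_def elim: quotientE)

lemma fclass_carrier [simp]: "fclass u \<in> carrier free_group"
  by (simp add: free_group_def quotientI)

lemma free_one: "\<one>\<^bsub>free_group\<^esub> = fclass []"
  by (simp add: free_group_def)

lemma fclass_cancel: "fclass (u @ [(a, b), (a, \<not> b)] @ v) = fclass (u @ v)"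
proof -
  have "(u @ [(a, b), (a, \<not> b)] @ v, u @ v) \<in> free_cancel"
    unfolding free_cancel_def by blast
  then have "(u @ [(a, b), (a, \<not> b)] @ v, u @ v) \<in> free_eq"
    unfolding free_eq_def by blast
  then show ?thesis by (simp only: fclass_eq_iff)
qed

definition inv_word :: "'a word \<Rightarrow> 'a word" where
  "inv_word w = rev (map (\<lambda>(a, b). (a, \<not> b)) w)"

lemma inv_word_left: "fclass (inv_word u @ u) = fclass []"
proof (induction u)
  case (Cons c u)
  obtain a b where c: "c = (a, b)" by force
  have "fclass (inv_word (c # u) @ c # u) = fclass (inv_word u @ [(a, \<not> b), (a, \<not> \<not> b)] @ u)"
    by (simp add: c inv_word_def)
  also have "\<dots> = fclass (inv_word u @ u)" by (rule fclass_cancel)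
  finally show ?case using Cons.IH by simp
qed (simp add: inv_word_def)

lemma group_free_group: "group free_group"
proof (rule groupI)
  fix U :: "'a word set" assume "U \<in> carrier free_group"
  then obtain u where "U = fclass u" by (rule free_carrierE)
  then have "fclass (inv_word u) \<otimes>\<^bsub>free_group\<^esub> U = \<one>\<^bsub>free_group\<^esub>"
    by (simp add: free_mult free_one inv_word_left)
  then show "\<exists>V\<in>carrier free_group. V \<otimes>\<^bsub>free_group\<^esub> U = \<one>\<^bsub>free_group\<^esub>"
    using fclass_carrier by blast
qed (auto elim!: free_carrierE simp: free_mult free_one)

interpretation free: group free_group
  by (rule group_free_group)

lemma free_gen_carrier [simp]: "free_gen a \<in> carrier free_group"
  by (simp add: free_gen_def)

lemma inv_free_gen: "inv\<^bsub>free_group\<^esub> (free_gen a) = fclass [(a, False)]"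
proof (rule free.inv_equality)
  show "fclass [(a, False)] \<otimes>\<^bsub>free_group\<^esub> free_gen a = \<one>\<^bsub>free_group\<^esub>"
    using fclass_cancel[of "[]" a False "[]"] by (simp add: free_gen_def free_mult free_one)
qed auto

lemma free_group_generated:
  "generate free_group (range free_gen) = (carrier free_group :: 'a word set set)"
proof
  show "generate free_group (range free_gen) \<subseteq> (carrier free_group :: 'a word set set)"
    by (rule free.generate_incl) auto
  have "fclass u \<in> generate free_group (range free_gen)" for u :: "'a word"
  proof (induction u)
    case Nil
    show ?case by (metis free_one generate.one)
  next
    case (Cons c u)
    obtain a b where c: "c = (a, b)" by force
    have "fclass [(a, b)] \<in> generate free_group (range free_gen)"
      by (cases b) (auto simp flip: inv_free_gen free_gen_def intro: generate.incl generate.inv)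
    from generate.eng[OF this Cons.IH] show ?case by (simp add: c free_mult)
  qed
  then show "(carrier free_group :: 'a word set set) \<subseteq> generate free_group (range free_gen)"
    by (auto elim!: free_carrierE)
qed

definition eval_word :: "('b, 'c) monoid_scheme \<Rightarrow> ('a \<Rightarrow> 'b) \<Rightarrow> 'a word \<Rightarrow> 'b" where
  "eval_word H s w =
     foldr (\<lambda>(a, b) h. (if b then s a else inv\<^bsub>H\<^esub> (s a)) \<otimes>\<^bsub>H\<^esub> h) w \<one>\<^bsub>H\<^esub>"

lemma (in group) eval_word_simps:
  "eval_word G s [] = \<one>"
  "eval_word G s ((a, b) # w) = (if b then s a else inv (s a)) \<otimes> eval_word G s w"
  by (simp_all add: eval_word_def)

text \<open>Evaluation of words respects cancellation, so it factors through the free group; a class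
  is evaluated at an arbitrary representative.\<close>

lemma (in group) free_group_universal:
  assumes s: "\<And>a. s a \<in> carrier G"
  obtains \<phi> where "\<phi> \<in> hom free_group G" "\<And>a. \<phi> (free_gen a) = s a"
proof -
  have closed: "eval_word G s u \<in> carrier G" for u
    by (induction u) (auto simp: eval_word_simps s split: prod.splits)
  have app: "eval_word G s (u @ v) = eval_word G s u \<otimes> eval_word G s v" for u v
    by (induction u) (auto simp: eval_word_simps s closed m_assoc)
  have resp: "eval_word G s u = eval_word G s v" if "(u, v) \<in> free_eq" for u v
    using that unfolding free_eq_def
  proof (induction rule: rtrancl_induct)
    case (step v w)
    have "eval_word G s [(a, b), (a, \<not> b)] = \<one>" for a b
      by (simp add: eval_word_simps s)
    then have "(v', w') \<in> free_cancel \<Longrightarrow> eval_word G s v' = eval_word G s w'" for v' w'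
      using closed by (auto simp: free_cancel_def app simp del: append_Cons)
    with step show ?case by auto
  qed simp
  have "(u, SOME u'. u' \<in> fclass u) \<in> free_eq" for u :: "'c word"
    using someI[of "\<lambda>u'. u' \<in> fclass u" u] equiv_free_eq
    by (auto elim!: equivE dest: refl_onD)
  from resp[OF this] have val: "eval_word G s (SOME u'. (u, u') \<in> free_eq) = eval_word G s u" for u
    by simp
  show thesis
  proof
    let ?\<phi> = "\<lambda>U. eval_word G s (SOME u. u \<in> U)"
    show "?\<phi> \<in> hom free_group G"
      by (rule homI) (auto elim!: free_carrierE simp: val closed free_mult app)
    show "?\<phi> (free_gen a) = s a" for a
      by (simp add: free_gen_def val eval_word_simps s)
  qed
qed

lemma (in group) normal_closure_normal:
  assumes "R \<subseteq> carrier G" shows "normal_closure G R \<lhd> G"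
proof (rule normal_invI)
  have "carrier G \<in> {N. N \<lhd> G \<and> R \<subseteq> N}" using assms normal_self by simp
  then show "subgroup (normal_closure G R) G"
    unfolding normal_closure_def
    by (intro subgroups_Inter) (auto simp: normal_imp_subgroup)
  show "g \<otimes> h \<otimes> inv g \<in> normal_closure G R"
    if "g \<in> carrier G" "h \<in> normal_closure G R" for g h
    using that normal.inv_op_closed2 by (fastforce simp: normal_closure_def)
qed

lemma normal_closure_incl: "R \<subseteq> normal_closure G R"
  by (auto simp: normal_closure_def)

lemma normal_closure_least: "N \<lhd> G \<Longrightarrow> R \<subseteq> N \<Longrightarrow> normal_closure G R \<subseteq> N"
  by (auto simp: normal_closure_def)

definition presented_class :: "('a word set \<times> 'a word set) set \<Rightarrow> 'a word set \<Rightarrow> 'a word set set" where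
  "presented_class R U =
     normal_closure free_group {u \<otimes>\<^bsub>free_group\<^esub> inv\<^bsub>free_group\<^esub> v | u v. (u, v) \<in> R}
       #>\<^bsub>free_group\<^esub> U"

text \<open>A set of pairs is read as a set of relations between elements of one group.\<close>

definition holds :: "('a \<times> 'a) set \<Rightarrow> bool" where
  "holds R \<longleftrightarrow> (\<forall>(u, v) \<in> R. u = v)"

context
  fixes R :: "('a word set \<times> 'a word set) set"
  assumes R: "R \<subseteq> carrier free_group \<times> carrier free_group"
begin

lemma presented_kernel_normal:
  "normal_closure free_group {u \<otimes>\<^bsub>free_group\<^esub> inv\<^bsub>free_group\<^esub> v | u v. (u, v) \<in> R}
     \<lhd> free_group"
  using R by (intro free.normal_closure_normal) auto

lemma group_presented_group: "group (presented_group R)"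
  unfolding presented_group_def
  by (rule normal.factorgroup_is_group[OF presented_kernel_normal])

lemma presented_class_hom: "presented_class R \<in> hom free_group (presented_group R)"
  unfolding presented_group_def presented_class_def
  by (rule normal.r_coset_hom_Mod[OF presented_kernel_normal])

lemma presented_class_onto: "presented_class R ` carrier free_group = carrier (presented_group R)"
  unfolding presented_group_def presented_class_def carrier_FactGroup ..

lemma presented_class_group_hom: "group_hom free_group (presented_group R) (presented_class R)"
  by (simp add: group_hom_def group_hom_axioms_def group_free_group group_presented_group
      presented_class_hom)

lemma presented_gen_closed: "presented_class R (free_gen a) \<in> carrier (presented_group R)"
  by (rule group_hom.hom_closed[OF presented_class_group_hom free_gen_carrier])

lemma presented_holds:
  assumes "map_prod (presented_class R) (presented_class R) ` R = R'" shows "holds R'"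
proof -
  let ?N = "normal_closure free_group {u \<otimes>\<^bsub>free_group\<^esub> inv\<^bsub>free_group\<^esub> v | u v. (u, v) \<in> R}"
  have "presented_class R u = presented_class R v" if "(u, v) \<in> R" for u v
  proof -
    have uv: "u \<in> carrier free_group" "v \<in> carrier free_group" using that R by auto
    have "u \<otimes>\<^bsub>free_group\<^esub> inv\<^bsub>free_group\<^esub> v \<in> ?N"
      using normal_closure_incl that by fast
    then have "u \<in> ?N #>\<^bsub>free_group\<^esub> v"
      using subgroup.rcos_module[OF normal_imp_subgroup[OF presented_kernel_normal] group_free_group]
        uv by blast
    then show ?thesis
      unfolding presented_class_def
      by (rule free.repr_independence[OF _ _ normal_imp_subgroup[OF presented_kernel_normal],
            symmetric]) (use uv in auto)
  qed
  then show ?thesis unfolding assms[symmetric] holds_def by auto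
qed

lemma presented_group_generated:
  "generate (presented_group R) (range (\<lambda>a. presented_class R (free_gen a)))
     = carrier (presented_group R)"
proof -
  interpret group_hom free_group "presented_group R" "presented_class R"
    by (rule presented_class_group_hom)
  have "generate (presented_group R) (presented_class R ` range free_gen) =
        presented_class R ` generate free_group (range free_gen)"
    by (rule generate_img) auto
  then show ?thesis
    by (simp only: free_group_generated presented_class_onto image_image)
qed

text \<open>Von Dyck's theorem. The evaluated relations enter as \<open>R'\<close>, the image of the relators under
  any homomorphism with the prescribed values: the relation sets below are written for arbitrary
  groups, and their image under a homomorphism is the same set formed in the target.\<close>

lemma presented_hom:
  assumes H: "group H" and s: "\<And>a. s a \<in> carrier H"
    and image: "\<And>\<phi>. \<phi> \<in> hom free_group H \<Longrightarrow> (\<And>a. \<phi> (free_gen a) = s a) \<Longrightarrow>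
      map_prod \<phi> \<phi> ` R = R'"
    and R': "holds R'"
  shows "\<exists>f \<in> hom (presented_group R) H. \<forall>a. f (presented_class R (free_gen a)) = s a"
proof -
  obtain \<phi> where \<phi>: "\<phi> \<in> hom free_group H" "\<And>a. \<phi> (free_gen a) = s a"
    using group.free_group_universal[where s = s, OF H s] by blast
  interpret group_hom free_group H \<phi>
    by (simp add: group_hom_def group_hom_axioms_def group_free_group H \<phi>)
  have "\<phi> u = \<phi> v" if "(u, v) \<in> R" for u v
    using image[OF \<phi>] R' that unfolding holds_def by force
  then have "{u \<otimes>\<^bsub>free_group\<^esub> inv\<^bsub>free_group\<^esub> v | u v. (u, v) \<in> R} \<subseteq> kernel free_group H \<phi>"
    using R by (fastforce simp: kernel_def)
  from FactGroup_universal_kernel[OF presented_kernel_normal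
      normal_closure_least[OF normal_kernel this]]
  obtain f where "f \<in> hom (presented_group R) H"
    "\<And>U. U \<in> carrier free_group \<Longrightarrow> f (presented_class R U) = \<phi> U"
    unfolding presented_class_def presented_group_def by blast
  with \<phi>(2) show ?thesis by (intro bexI[of _ f]) auto
qed

end

section \<open>Minimal degree and faithful actions\<close>

lemma sym_group_iso_BijGroup:
  assumes "finite S" shows "sym_group (card S) \<cong> BijGroup S"
proof -
  let ?I = "{1..card S}"
  obtain \<beta> where \<beta>: "bij_betw \<beta> S ?I"
    using finite_same_card_bij[OF assms, of ?I] by auto
  define \<gamma> where "\<gamma> = inv_into S \<beta>"
  have \<gamma>: "bij_betw \<gamma> ?I S" unfolding \<gamma>_def by (rule bij_betw_inv_into[OF \<beta>])
  have \<beta>\<gamma>: "\<beta> (\<gamma> i) = i" if "i \<in> ?I" for i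
    unfolding \<gamma>_def using bij_betw_inv_into_right[OF \<beta> that] .
  have \<gamma>\<beta>: "\<gamma> (\<beta> s) = s" if "s \<in> S" for s
    unfolding \<gamma>_def using bij_betw_inv_into_left[OF \<beta> that] .
  have \<beta>_in: "\<beta> s \<in> ?I" if "s \<in> S" for s using \<beta> that by (rule bij_betw_apply)
  have \<gamma>_in: "\<gamma> i \<in> S" if "i \<in> ?I" for i using \<gamma> that by (rule bij_betw_apply)
  define T where "T = (\<lambda>p. \<lambda>s\<in>S. \<gamma> (p (\<beta> s)))"
  define U where "U = (\<lambda>q i. if i \<in> ?I then \<beta> (q (\<gamma> i)) else i)"
  have T: "T p \<in> Bij S" if "p permutes ?I" for p
  proof -
    have "bij_betw (\<gamma> \<circ> p \<circ> \<beta>) S S"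
      using \<beta> \<gamma> permutes_imp_bij[OF that] by (blast intro: bij_betw_trans)
    moreover have "bij_betw (\<gamma> \<circ> p \<circ> \<beta>) S S = bij_betw (T p) S S"
      by (rule bij_betw_cong) (simp add: T_def)
    ultimately show ?thesis by (simp add: Bij_def T_def)
  qed
  have U: "U q permutes ?I" if "q \<in> Bij S" for q
  proof (rule bij_imp_permutes)
    have "bij_betw (\<beta> \<circ> q \<circ> \<gamma>) ?I ?I"
      using \<beta> \<gamma> that by (auto simp: Bij_def intro!: bij_betw_trans)
    moreover have "bij_betw (\<beta> \<circ> q \<circ> \<gamma>) ?I ?I = bij_betw (U q) ?I ?I"
      by (rule bij_betw_cong) (simp add: U_def)
    ultimately show "bij_betw (U q) ?I ?I" by simp
  qed (auto simp: U_def)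
  have "bij_betw T (carrier (sym_group (card S))) (carrier (BijGroup S))"
  proof (rule bij_betwI[where g = U])
    show "T \<in> carrier (sym_group (card S)) \<rightarrow> carrier (BijGroup S)"
      using T by (auto simp: sym_group_carrier BijGroup_def)
    show "U \<in> carrier (BijGroup S) \<rightarrow> carrier (sym_group (card S))"
      using U by (auto simp: sym_group_carrier BijGroup_def)
    fix p assume "p \<in> carrier (sym_group (card S))"
    then have p: "p permutes ?I" by (simp add: sym_group_carrier)
    have "U (T p) i = p i" for i
      using p \<gamma>_in[of i] \<beta>\<gamma>[of "p i"] \<beta>\<gamma>[of i] permutes_in_image[OF p, of i] permutes_not_in[OF p, of i]
      by (cases "i \<in> ?I") (simp_all add: U_def T_def)
    then show "U (T p) = p" by auto
  next
    fix q assume "q \<in> carrier (BijGroup S)"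
    then have q: "q \<in> Bij S" by (simp add: BijGroup_def)
    have "T (U q) s = q s" for s
      using q \<beta>_in[of s] \<gamma>\<beta>[of "q s"] \<gamma>\<beta>[of s] Bij_imp_funcset[OF q]
        extensional_arb[OF Bij_imp_extensional[OF q], of s]
      by (cases "s \<in> S") (auto simp add: U_def T_def)
    then show "T (U q) = q" by auto
  qed
  moreover have "T (p \<circ> q) = compose S (T p) (T q)" if "q permutes ?I" for p q
  proof
    fix s
    show "T (p \<circ> q) s = compose S (T p) (T q) s"
      using \<beta>_in[of s] \<gamma>_in[of "q (\<beta> s)"] \<beta>\<gamma>[of "q (\<beta> s)"] permutes_in_image[OF that, of "\<beta> s"]
      by (cases "s \<in> S") (auto simp: T_def compose_def)
  qed
  then have "T \<in> hom (sym_group (card S)) (BijGroup S)"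
    using T by (intro homI) (auto simp: sym_group_carrier sym_group_mult BijGroup_def)
  ultimately show ?thesis by (intro is_isoI isoI)
qed

lemma mon_compose_iso: "f \<in> mon G H \<Longrightarrow> g \<in> iso H K \<Longrightarrow> g \<circ> f \<in> mon G K"
  unfolding mon_def iso_def bij_betw_def
  by (auto simp: hom_compose dest: hom_carrier intro!: comp_inj_on elim: inj_on_subset)

lemma min_degree_le:
  assumes "\<phi> \<in> mon G (BijGroup S)" "finite S"
  shows "min_degree G \<le> card S"
proof -
  obtain g where "g \<in> iso (BijGroup S) (sym_group (card S))"
    using group.iso_sym[OF sym_group_is_group sym_group_iso_BijGroup[OF assms(2)]]
    by (auto simp: is_iso_def)
  from mon_compose_iso[OF assms(1) this] show ?thesis
    unfolding min_degree_def by (intro Least_le) blast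
qed

text \<open>Cayley's theorem: it makes the minimal degree of a finite group a minimum that is attained.\<close>

lemma (in group) regular_representation:
  "(\<lambda>g. \<lambda>h\<in>carrier G. g \<otimes> h) \<in> mon G (BijGroup (carrier G))"
proof -
  have "(\<lambda>h\<in>carrier G. g \<otimes> h) \<in> Bij (carrier G)" if g: "g \<in> carrier G" for g
  proof -
    have "bij_betw (\<lambda>h. g \<otimes> h) (carrier G) (carrier G)"
      by (rule bij_betwI[where g = "\<lambda>h. inv g \<otimes> h"]) (use g in \<open>auto simp flip: m_assoc\<close>)
    then show ?thesis by (simp add: Bij_def)
  qed
  moreover have "inj_on (\<lambda>g. \<lambda>h\<in>carrier G. g \<otimes> h) (carrier G)"
    by (rule inj_onI) (metis one_closed r_one restrict_apply')
  ultimately show ?thesis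
    by (auto simp: mon_def BijGroup_def compose_def m_assoc intro!: homI)
qed

text \<open>Lower bounds need only be shown for faithful actions, where orbits and stabilizers are
  available.\<close>

lemma min_degree_ge:
  assumes G: "group G" "finite (carrier G)"
    and faithful: "\<And>(E :: nat set) \<phi>. finite E \<Longrightarrow> faithful_action G E \<phi> \<Longrightarrow> d \<le> card E"
  shows "d \<le> min_degree G"
proof -
  obtain g where "g \<in> iso (BijGroup (carrier G)) (sym_group (order G))"
    using group.iso_sym[OF sym_group_is_group sym_group_iso_BijGroup[OF G(2)]]
    by (auto simp: is_iso_def order_def)
  from mon_compose_iso[OF group.regular_representation[OF G(1)] this]
  have "\<exists>n f. f \<in> mon G (sym_group n)" by blast
  then obtain f where f: "f \<in> mon G (sym_group (min_degree G))"
    unfolding min_degree_def using LeastI_ex[of "\<lambda>n. \<exists>f. f \<in> mon G (sym_group n)"] by blast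
  obtain h where "h \<in> iso (sym_group (min_degree G)) (BijGroup {1..min_degree G})"
    using sym_group_iso_BijGroup[of "{1..min_degree G}"] by (auto simp: is_iso_def)
  from mon_compose_iso[OF f this]
  have "faithful_action G {1..min_degree G} (h \<circ> f)"
    by (simp add: faithful_action_def group_action_def group_hom_def group_hom_axioms_def
        faithful_action_axioms_def mon_def G group_BijGroup)
  from faithful[OF _ this] show ?thesis by simp
qed

section \<open>Central subgroups, complements and subgroups of index p\<close>

definition centre :: "('a, 'b) monoid_scheme \<Rightarrow> 'a set" where
  "centre G = {z \<in> carrier G. \<forall>g \<in> carrier G. z \<otimes>\<^bsub>G\<^esub> g = g \<otimes>\<^bsub>G\<^esub> z}"

lemma centreD:
  assumes "z \<in> centre G"
  shows "z \<in> carrier G" "g \<in> carrier G \<Longrightarrow> z \<otimes>\<^bsub>G\<^esub> g = g \<otimes>\<^bsub>G\<^esub> z"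
  using assms by (auto simp: centre_def)

context group
begin

lemma l_cancel_assoc [simp]:
  assumes "g \<in> carrier G" "h \<in> carrier G"
  shows "inv g \<otimes> (g \<otimes> h) = h" "g \<otimes> (inv g \<otimes> h) = h"
  using assms by (simp_all flip: m_assoc)

lemma comm_closed [simp]: "g \<in> carrier G \<Longrightarrow> h \<in> carrier G \<Longrightarrow> comm G g h \<in> carrier G"
  by (simp add: comm_def)

lemma comm_eq_iff:
  assumes "g \<in> carrier G" "h \<in> carrier G" "c \<in> carrier G"
  shows "comm G g h = c \<longleftrightarrow> g \<otimes> h = h \<otimes> g \<otimes> c"
proof -
  have "comm G g h = inv (h \<otimes> g) \<otimes> (g \<otimes> h)"
    using assms by (simp add: comm_def inv_mult_group m_assoc)
  moreover have "inv (h \<otimes> g) \<otimes> (g \<otimes> h) = c \<longleftrightarrow> g \<otimes> h = h \<otimes> g \<otimes> c"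
    using inv_solve_left'[of c "h \<otimes> g" "g \<otimes> h"] assms by simp
  ultimately show ?thesis by simp
qed

lemma comm_in_subgroup:
  assumes "subgroup H G" "g \<in> H" "h \<in> H" shows "comm G g h \<in> H"
  unfolding comm_def using assms by (simp add: subgroup.m_closed subgroup.m_inv_closed)

lemma pow_in_subgroup:
  assumes "subgroup H G" "g \<in> H" shows "g [^] (n::nat) \<in> H"
  by (induction n) (use assms in \<open>auto simp: subgroup.one_closed subgroup.m_closed\<close>)

lemma inv_commutator: "g \<in> carrier G \<Longrightarrow> h \<in> carrier G \<Longrightarrow> inv (comm G g h) = comm G h g"
  by (simp add: comm_def inv_mult_group m_assoc)

lemma comm_mult_centre_left:
  assumes "s \<in> carrier G" "h \<in> carrier G" "z \<in> centre G"
  shows "comm G (s \<otimes> z) h = comm G s h"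
proof -
  note [simp] = assms(1,2) centreD(1)[OF assms(3)]
  have "comm G (s \<otimes> z) h = inv z \<otimes> (inv s \<otimes> inv h \<otimes> s \<otimes> (z \<otimes> h))"
    by (simp add: comm_def inv_mult_group m_assoc)
  also have "z \<otimes> h = h \<otimes> z" by (rule centreD(2)[OF assms(3)]) simp
  also have "inv s \<otimes> inv h \<otimes> s \<otimes> (h \<otimes> z) = comm G s h \<otimes> z"
    by (simp add: comm_def m_assoc)
  also have "comm G s h \<otimes> z = z \<otimes> comm G s h" by (rule centreD(2)[OF assms(3), symmetric]) simp
  also have "inv z \<otimes> (z \<otimes> comm G s h) = comm G s h" by simp
  finally show ?thesis .
qed

text \<open>Commutators do not see central factors. If \<open>G = S Z\<close> with \<open>Z\<close> central, every commutator
  of \<open>G\<close> therefore lies in \<open>S\<close>.\<close>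

lemma comm_mult_centre:
  assumes "s \<in> carrier G" "s' \<in> carrier G" "z \<in> centre G" "z' \<in> centre G"
  shows "comm G (s \<otimes> z) (s' \<otimes> z') = comm G s s'"
proof -
  note [simp] = assms(1,2) centreD(1)[OF assms(3)] centreD(1)[OF assms(4)]
  have "comm G (s \<otimes> z) (s' \<otimes> z') = inv (comm G (s' \<otimes> z') s)"
    by (simp add: comm_mult_centre_left assms(3) inv_commutator)
  also have "\<dots> = comm G s s'" by (simp add: comm_mult_centre_left assms(4) inv_commutator)
  finally show ?thesis .
qed

lemma mult_inj_on_times:
  assumes "subgroup S G" "subgroup Z G" "S \<inter> Z = {\<one>}"
  shows "inj_on (\<lambda>(s, z). s \<otimes> z) (S \<times> Z)"
proof (rule inj_onI, clarify)
  fix s z s' z' assume *: "s \<in> S" "z \<in> Z" "s' \<in> S" "z' \<in> Z" "s \<otimes> z = s' \<otimes> z'"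
  note [simp] = subgroup.mem_carrier[OF assms(1)] subgroup.mem_carrier[OF assms(2)]
  have "inv s' \<otimes> (s \<otimes> z) \<otimes> inv z = inv s' \<otimes> (s' \<otimes> z') \<otimes> inv z" using * by simp
  with *(1-4) have "inv s' \<otimes> s = z' \<otimes> inv z" by (simp add: m_assoc)
  moreover have "inv s' \<otimes> s \<in> S" "z' \<otimes> inv z \<in> Z"
    using * assms by (simp_all add: subgroup.m_closed subgroup.m_inv_closed)
  ultimately have "inv s' \<otimes> s = \<one>" "z' \<otimes> inv z = \<one>" using assms(3) by auto
  then have "s' \<otimes> (inv s' \<otimes> s) = s'" "(z' \<otimes> inv z) \<otimes> z = z" using * by simp_all
  then show "s = s' \<and> z = z'" using *(1-4) by (simp add: m_assoc)
qed

lemma card_times_le_order: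
  assumes "subgroup S G" "subgroup Z G" "S \<inter> Z = {\<one>}" "finite (carrier G)"
  shows "card S * card Z \<le> order G"
proof -
  have "card (S \<times> Z) \<le> card (carrier G)"
    by (rule card_inj_on_le[OF mult_inj_on_times[OF assms(1-3)] _ assms(4)])
      (auto simp: subgroup.mem_carrier[OF assms(1)] subgroup.mem_carrier[OF assms(2)])
  then show ?thesis by (simp add: order_def card_cartesian_product)
qed

lemma complement_factorE:
  assumes "subgroup S G" "subgroup Z G" "S \<inter> Z = {\<one>}" "finite (carrier G)"
    and "order G \<le> card S * card Z" "g \<in> carrier G"
  obtains s z where "s \<in> S" "z \<in> Z" "g = s \<otimes> z"
proof -
  let ?f = "\<lambda>(s, z). s \<otimes> z"
  have "?f ` (S \<times> Z) \<subseteq> carrier G"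
    by (auto simp: subgroup.mem_carrier[OF assms(1)] subgroup.mem_carrier[OF assms(2)])
  moreover have "card (?f ` (S \<times> Z)) = card S * card Z"
    by (simp add: card_image[OF mult_inj_on_times[OF assms(1-3)]] card_cartesian_product)
  ultimately have "?f ` (S \<times> Z) = carrier G"
    using assms(4,5) by (intro card_seteq) (auto simp: order_def)
  with assms(6) show thesis using that by force
qed

lemma pow_coprime_in_subgroup:
  assumes "subgroup M G" "u \<in> carrier G" "u [^] (d::nat) \<in> M" "coprime d (order G)" "d > 0"
    "finite (carrier G)"
  shows "u \<in> M"
proof -
  (* Modulo the order of G, the exponent d is invertible. *)
  obtain a b where "d * a = order G * b + 1"
    using bezout_nat[of d "order G"] assms(4,5) by auto
  then have "(u [^] d) [^] a = (u [^] order G) [^] b \<otimes> u"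
    using assms(2) by (simp add: nat_pow_pow)
  then have "(u [^] d) [^] a = u" using assms by (simp add: pow_order_eq_1)
  with pow_in_subgroup[OF assms(1,3)] show ?thesis by metis
qed

end

locale prime_power_group = group G for G (structure) +
  fixes p k :: nat
  assumes prime_p: "prime p" and order_G: "order G = p ^ k"
begin

lemma finite_G: "finite (carrier G)"
  using order_gt_0_iff_finite order_G prime_p prime_gt_0_nat by fastforce

lemma card_subgroupE:
  assumes "subgroup H G" obtains i where "i \<le> k" "card H = p ^ i"
proof -
  have "card H dvd p ^ k" using lagrange[OF assms] order_G by (metis dvd_triv_right)
  with divides_primepow_nat[OF prime_p] that show thesis by blast
qed

context
  fixes M
  assumes M: "subgroup M G" and index: "order G \<le> p * card M"
begin

lemma pow_less_p_in_subgroup: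
  assumes "u \<in> carrier G" "u [^] d \<in> M" "0 < d" "d < p" shows "u \<in> M"
proof (rule pow_coprime_in_subgroup[OF M assms(1,2) _ assms(3) finite_G])
  have "coprime p d" using assms prime_p by (meson nat_dvd_not_less prime_imp_coprime)
  then show "coprime d (order G)" by (simp add: order_G ac_simps)
qed

text \<open>The cosets \<open>u\<^sup>i M\<close> for \<open>i < p\<close> are distinct, since \<open>u\<^sup>d \<in> M\<close> with \<open>0 < d < p\<close> would
  put \<open>u\<close> into \<open>M\<close>; by counting they cover the group.\<close>

lemma index_p_factorE:
  assumes u: "u \<in> carrier G" "u \<notin> M" and g: "g \<in> carrier G"
  obtains i m where "i < p" "m \<in> M" "g = u [^] i \<otimes> m"
proof -
  note [simp] = subgroup.mem_carrier[OF M] subgroup.m_closed[OF M] subgroup.m_inv_closed[OF M]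
  let ?f = "\<lambda>(i, m). u [^] (i::nat) \<otimes> m"
  have less: False if "i < j" "j < p" "m \<in> M" "m' \<in> M" "u [^] i \<otimes> m = u [^] j \<otimes> m'" for i j m m'
  proof -
    have "u [^] j = u [^] i \<otimes> u [^] (j - i)" using that u by (simp add: nat_pow_mult)
    then have "m = u [^] (j - i) \<otimes> m'" using that u by (simp add: m_assoc)
    then have "u [^] (j - i) = m \<otimes> inv m'" using that u by (simp add: m_assoc)
    then have "u [^] (j - i) \<in> M" using that by simp
    moreover have "0 < j - i" "j - i < p" using that by simp_all
    ultimately show False using pow_less_p_in_subgroup[OF u(1)] u by blast
  qed
  have inj: "inj_on ?f ({..<p} \<times> M)"
  proof (rule inj_onI, clarify)
    fix i m j m' assume *: "i < p" "j < p" "m \<in> M" "m' \<in> M"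
      "u [^] i \<otimes> m = u [^] j \<otimes> m'"
    then have "i = j" using less[of i j m m'] less[of j i m' m]
      by (metis linorder_neqE_nat)
    with * u show "i = j \<and> m = m'" by simp
  qed
  have "?f ` ({..<p} \<times> M) \<subseteq> carrier G" using u by auto
  moreover have "card (?f ` ({..<p} \<times> M)) = p * card M"
    by (simp add: card_image[OF inj] card_cartesian_product)
  ultimately have "?f ` ({..<p} \<times> M) = carrier G"
    using index finite_G by (intro card_seteq) (auto simp: order_def)
  with g show thesis using that by force
qed

text \<open>Subgroups of index \<open>p\<close> are normal. A conjugate \<open>u = g m g\<^sup>-\<^sup>1\<close> outside \<open>M\<close> would give
  \<open>g = u\<^sup>i m' = g m\<^sup>i g\<^sup>-\<^sup>1 m'\<close>, and cancelling \<open>g\<close> leaves \<open>g = m' m\<^sup>i \<in> M\<close>.\<close>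

lemma index_p_conj:
  assumes g: "g \<in> carrier G" and m: "m \<in> M" shows "g \<otimes> m \<otimes> inv g \<in> M"
proof (rule ccontr)
  note [simp] = subgroup.mem_carrier[OF M]
  assume notin: "g \<otimes> m \<otimes> inv g \<notin> M"
  have "g \<otimes> m \<otimes> inv g \<in> carrier G" using g m by simp
  then obtain i m' where "i < p" and m': "m' \<in> M" "g = (g \<otimes> m \<otimes> inv g) [^] i \<otimes> m'"
    by (rule index_p_factorE[OF _ notin g])
  have "(g \<otimes> m \<otimes> inv g) [^] i = g \<otimes> m [^] i \<otimes> inv g"
    using g m by (induction i) (simp_all add: m_assoc)
  with m' have eq: "g = g \<otimes> (m [^] i \<otimes> (inv g \<otimes> m'))"
    using g m by (simp add: m_assoc)
  then have "inv g \<otimes> g = inv g \<otimes> (g \<otimes> (m [^] i \<otimes> (inv g \<otimes> m')))" by simp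
  with g m m' have "\<one> = m [^] i \<otimes> (inv g \<otimes> m')" by simp
  then have "inv (m [^] i) \<otimes> \<one> = inv (m [^] i) \<otimes> (m [^] i \<otimes> (inv g \<otimes> m'))" by simp
  with g m m' have "g \<otimes> inv (m [^] i) = g \<otimes> (inv g \<otimes> m')" by simp
  with g m m' have "g \<otimes> inv (m [^] i) \<otimes> m [^] i = m' \<otimes> m [^] i" by simp
  with g m m' have "g = m' \<otimes> m [^] i" by (simp add: m_assoc)
  then have "g \<in> M" using m m' M by (simp add: subgroup.m_closed pow_in_subgroup)
  with m notin show False
    by (simp add: M subgroup.m_closed subgroup.m_inv_closed)
qed

text \<open>The quotient by \<open>M\<close> has order at most \<open>p\<close>, hence is abelian.\<close>

lemma comm_in_index_p:
  assumes a: "a \<in> carrier G" and b: "b \<in> carrier G" shows "comm G a b \<in> M"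
proof (cases "a \<in> M")
  case True
  from index_p_conj[OF _ this, of "inv b"] b have "inv b \<otimes> a \<otimes> b \<in> M" by simp
  with True have "inv a \<otimes> (inv b \<otimes> a \<otimes> b) \<in> M"
    by (simp add: M subgroup.m_closed subgroup.m_inv_closed)
  with a b show ?thesis by (simp add: comm_def m_assoc)
next
  case False
  obtain i m where "i < p" and m: "m \<in> M" "b = a [^] i \<otimes> m"
    by (rule index_p_factorE[OF a False b])
  have mc: "m \<in> carrier G" using m subgroup.mem_carrier[OF M] by blast
  have "inv (a [^] i) \<otimes> (a \<otimes> (a [^] i \<otimes> m)) = a \<otimes> m"
    using a mc by (metis l_cancel_assoc(1) m_assoc m_closed nat_pow_Suc nat_pow_Suc2 nat_pow_closed)
  then have "comm G a b = (inv a \<otimes> inv m \<otimes> a) \<otimes> m"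
    using a mc by (simp add: comm_def m(2) inv_mult_group m_assoc)
  moreover have "inv a \<otimes> inv m \<otimes> a \<in> M"
    using index_p_conj[of "inv a" "inv m"] a m by (simp add: M subgroup.m_inv_closed)
  ultimately show ?thesis using m by (simp add: M subgroup.m_closed)
qed

text \<open>The quotient by \<open>M\<close> has exponent dividing \<open>p\<close>.\<close>

lemma pow_p_in_index_p:
  assumes g: "g \<in> carrier G" shows "g [^] p \<in> M"
proof (cases "g \<in> M")
  case False
  obtain i m where m: "i < p" "m \<in> M" "g [^] p = g [^] i \<otimes> m"
    by (rule index_p_factorE[OF g False nat_pow_closed[OF g]])
  have "g [^] p = g [^] i \<otimes> g [^] (p - i)" using m(1) g by (simp add: nat_pow_mult)
  with m have "inv (g [^] i) \<otimes> (g [^] i \<otimes> g [^] (p - i)) = inv (g [^] i) \<otimes> (g [^] i \<otimes> m)"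
    by simp
  with m g subgroup.mem_carrier[OF M] have "g [^] (p - i) \<in> M" by simp
  with pow_less_p_in_subgroup[OF g this] m False have "i = 0" by fastforce
  with m g subgroup.mem_carrier[OF M] show ?thesis by simp
qed (simp add: pow_in_subgroup[OF M])

end

end

section \<open>Lower bounds for the degree of a faithful action\<close>

context faithful_action
begin

lemma group_G: "group G"
  using group_hom by (simp add: group_hom_def)

lemma moved_point:
  assumes "c \<in> carrier G" "c \<noteq> \<one>"
  obtains x where "x \<in> E" "\<phi> c x \<noteq> x"
proof (rule ccontr)
  assume "\<not> thesis"
  with that have fix_all: "\<phi> c x = x" if "x \<in> E" for x using that by blast
  interpret group G by (rule group_G)
  have "\<phi> c = (\<lambda>x\<in>E. x)"
    using fix_all Bij_imp_extensional[OF bij_prop0[OF assms(1)]]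
    by (intro extensionalityI[of _ E]) auto
  then have "\<phi> c = \<phi> \<one>" using id_eq_one by simp
  with assms faithful show False by (simp add: inj_on_eq_iff)
qed

lemma orbit_subset: "x \<in> E \<Longrightarrow> orbit G \<phi> x \<subseteq> E"
  using element_image by (auto simp: orbit_def)

lemma orbits_disjoint:
  assumes "x \<in> E" "u \<in> E" "u \<notin> orbit G \<phi> x"
  shows "orbit G \<phi> x \<inter> orbit G \<phi> u = {}"
  using assms orbit_trans orbit_sym orbit_subset by blast

text \<open>A central element permutes each orbit as an automorphism of the action, so one fixed point
  forces the whole orbit to be fixed.\<close>

lemma central_stabilizer_orbit:
  assumes "x \<in> E" "c \<in> centre G" "\<phi> c x = x" "u \<in> orbit G \<phi> x"
  shows "\<phi> c u = u"
proof -
  obtain g where g: "g \<in> carrier G" "u = \<phi> g x" using assms(4) by (auto simp: orbit_def)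
  note c = centreD[OF assms(2)]
  have "\<phi> c u = \<phi> (g \<otimes> c) x"
    using g c assms(1) composition_rule[of x c g] by simp
  also have "\<dots> = u" using g c assms(1,3) composition_rule[of x g c] by simp
  finally show ?thesis .
qed

lemma degree_ge_if_avoiding_small:
  assumes p: "prime p" and order: "order G = p ^ 4" and E: "finite E"
    and w: "w \<in> carrier G" "w \<noteq> \<one>"
    and small: "\<And>H. subgroup H G \<Longrightarrow> w \<notin> H \<Longrightarrow> card H \<le> p"
  shows "p ^ 3 \<le> card E"
proof -
  obtain x where x: "x \<in> E" "\<phi> w x \<noteq> x" using moved_point[OF w] .
  have "card (stabilizer G \<phi> x) \<le> p"
    by (rule small[OF stabilizer_subgroup[OF x(1)]]) (use x in \<open>simp add: stabilizer_def\<close>)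
  then have "p ^ 4 \<le> card (orbit G \<phi> x) * p"
    using orbit_stabilizer_theorem[OF x(1)] order by (metis mult_le_mono2)
  then have "p * p ^ 3 \<le> p * card (orbit G \<phi> x)" by (simp add: eval_nat_numeral mult.commute)
  then have "p ^ 3 \<le> card (orbit G \<phi> x)" using p prime_gt_0_nat by simp
  also have "\<dots> \<le> card E" by (rule card_mono[OF E orbit_subset[OF x(1)]])
  finally show ?thesis .
qed

text \<open>If \<open>Z\<close> meets some stabilizer \<open>S\<close> trivially, then \<open>|S| |Z| \<le> p\<^sup>5\<close>, and equality would
  make \<open>S\<close> a complement of \<open>Z\<close> containing all commutators, against \<open>[a, b] \<in> Z\<close>. Hence
  \<open>|S| \<le> p\<^sup>2\<close> and the orbit has \<open>p\<^sup>3\<close> points or more. Otherwise, starting from a point moved by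
  \<open>[a, b]\<close>, some nontrivial element of \<open>Z\<close> fixes its orbit and must move a point of another one;
  both orbits have at least \<open>p\<^sup>2\<close> points because a stabilizer of index at most \<open>p\<close> would
  contain \<open>Z\<close>.\<close>

lemma degree_ge_if_frattini_centre:
  assumes p: "prime p" "3 \<le> p" and order: "order G = p ^ 5" and E: "finite E"
    and Z: "subgroup Z G" "Z \<subseteq> centre G" "card Z = p\<^sup>2"
    and frattini: "\<And>M. subgroup M G \<Longrightarrow> card M = p ^ 4 \<Longrightarrow> Z \<subseteq> M"
    and ab: "a \<in> carrier G" "b \<in> carrier G" "comm G a b \<in> Z" "comm G a b \<noteq> \<one>"
  shows "2 * p\<^sup>2 \<le> card E"
proof -
  interpret prime_power_group G p 5
    using group_G p order by (simp add: prime_power_group_def prime_power_group_axioms_def)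
  have p1: "1 < p" using p by simp
  have stab: "subgroup (stabilizer G \<phi> x) G" if "x \<in> E" for x
    using stabilizer_subgroup[OF that] .
  have in_stab: "c \<in> stabilizer G \<phi> x \<longleftrightarrow> c \<in> carrier G \<and> \<phi> c x = x" for c x
    by (simp add: stabilizer_def)
  have orbit_card: "p ^ (5 - i) = card (orbit G \<phi> x)"
    if "x \<in> E" "card (stabilizer G \<phi> x) = p ^ i" "i \<le> 5" for x i
  proof -
    have "card (orbit G \<phi> x) * p ^ i = p ^ (5 - i) * p ^ i"
      using orbit_stabilizer_theorem[OF that(1)] that(2,3) order by (simp flip: power_add)
    then show ?thesis using p1 by simp
  qed
  have moved: "p\<^sup>2 \<le> card (orbit G \<phi> x)" if x: "x \<in> E" and c: "c \<in> Z" "\<phi> c x \<noteq> x" for x c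
  proof -
    obtain i where i: "i \<le> 5" "card (stabilizer G \<phi> x) = p ^ i"
      using card_subgroupE[OF stab[OF x]] .
    have "i \<noteq> 5"
    proof
      assume "i = 5"
      then have "stabilizer G \<phi> x = carrier G"
        using i(2) order finite_G subgroup.subset[OF stab[OF x]]
        by (intro card_seteq) (auto simp: order_def)
      then have "c \<in> stabilizer G \<phi> x" using c(1) subgroup.mem_carrier[OF Z(1)] by simp
      with c(2) in_stab show False by simp
    qed
    moreover have "c \<notin> stabilizer G \<phi> x" using c(2) by (simp add: in_stab)
    then have "i \<noteq> 4" using frattini[OF stab[OF x]] i(2) c(1) by blast
    ultimately have "2 \<le> 5 - i" using i(1) by linarith
    then show ?thesis using orbit_card[OF x i(2,1)] p1 power_increasing[of _ "5 - i" p] by simp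
  qed
  have free: "p ^ 3 \<le> card (orbit G \<phi> x)" if x: "x \<in> E" "stabilizer G \<phi> x \<inter> Z = {\<one>}" for x
  proof -
    obtain i where i: "i \<le> 5" "card (stabilizer G \<phi> x) = p ^ i"
      using card_subgroupE[OF stab[OF x(1)]] .
    have "p ^ i * p\<^sup>2 \<le> p ^ 5"
      using card_times_le_order[OF stab[OF x(1)] Z(1) x(2) finite_G] i Z(3) order by simp
    then have "p ^ (i + 2) \<le> p ^ 5" by (simp only: power_add)
    then have "i + 2 \<le> 5" by (rule power_le_imp_le_exp[OF p1])
    moreover have "i \<noteq> 3"
    proof
      assume "i = 3"
      then have le: "order G \<le> card (stabilizer G \<phi> x) * card Z"
        using i(2) Z(3) order by (simp flip: power_add)
      obtain s z where s: "s \<in> stabilizer G \<phi> x" "z \<in> Z" "a = s \<otimes> z"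
        by (rule complement_factorE[OF stab[OF x(1)] Z(1) x(2) finite_G le ab(1)])
      obtain s' z' where s': "s' \<in> stabilizer G \<phi> x" "z' \<in> Z" "b = s' \<otimes> z'"
        by (rule complement_factorE[OF stab[OF x(1)] Z(1) x(2) finite_G le ab(2)])
      have "comm G a b = comm G s s'"
        using s s' Z(2) in_stab by (auto intro!: comm_mult_centre)
      also have "\<dots> \<in> stabilizer G \<phi> x" by (rule comm_in_subgroup[OF stab[OF x(1)] s(1) s'(1)])
      finally show False using x(2) ab(3,4) by blast
    qed
    ultimately have "3 \<le> 5 - i" by linarith
    then show ?thesis using orbit_card[OF x(1) i(2,1)] p1 power_increasing[of _ "5 - i" p] by simp
  qed
  obtain x where x: "x \<in> E" "\<phi> (comm G a b) x \<noteq> x" using moved_point[OF _ ab(4)] ab by auto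
  show ?thesis
  proof (cases "stabilizer G \<phi> x \<inter> Z = {\<one>}")
    case True
    have "2 * p\<^sup>2 \<le> p * p\<^sup>2" using p by simp
    also have "\<dots> = p ^ 3" by (simp add: eval_nat_numeral)
    also have "\<dots> \<le> card (orbit G \<phi> x)" by (rule free[OF x(1) True])
    also have "\<dots> \<le> card E" by (rule card_mono[OF E orbit_subset[OF x(1)]])
    finally show ?thesis .
  next
    case False
    moreover have "\<one> \<in> stabilizer G \<phi> x \<inter> Z"
      using stab[OF x(1)] Z(1) by (simp add: subgroup.one_closed)
    ultimately obtain c where c: "c \<in> Z" "\<phi> c x = x" "c \<noteq> \<one>" "c \<in> carrier G"
      using in_stab by blast
    obtain u where u: "u \<in> E" "\<phi> c u \<noteq> u" using moved_point[OF c(4,3)] .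
    have "u \<notin> orbit G \<phi> x" using central_stabilizer_orbit[OF x(1) _ c(2)] c(1) Z(2) u(2) by blast
    then have disj: "orbit G \<phi> x \<inter> orbit G \<phi> u = {}" using orbits_disjoint x(1) u(1) by blast
    have fin: "finite (orbit G \<phi> x)" "finite (orbit G \<phi> u)"
      using orbit_subset x(1) u(1) E finite_subset by blast+
    have "2 * p\<^sup>2 \<le> card (orbit G \<phi> x) + card (orbit G \<phi> u)"
      using moved[OF x(1) ab(3) x(2)] moved[OF u(1) c(1) u(2)] by simp
    also have "\<dots> = card (orbit G \<phi> x \<union> orbit G \<phi> u)" using fin disj by (simp add: card_Un_disjoint)
    also have "\<dots> \<le> card E" using orbit_subset x(1) u(1) by (intro card_mono[OF E]) blast
    finally show ?thesis .
  qed
qed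

end

section \<open>Subgroups that avoid a central element\<close>

context group
begin

lemma commuting_power:
  assumes "g \<in> carrier G" "h \<in> carrier G" "g' \<in> carrier G" "g \<otimes> h = h \<otimes> g'"
  shows "g [^] (n::nat) \<otimes> h = h \<otimes> g' [^] n"
proof (induction n)
  case (Suc n)
  have "g [^] Suc n \<otimes> h = g [^] n \<otimes> (h \<otimes> g')" using assms by (simp add: m_assoc)
  also have "\<dots> = h \<otimes> g' [^] Suc n" using assms Suc by (simp flip: m_assoc)
  finally show ?case .
qed (use assms in simp)

lemma pow_mod:
  assumes "g \<in> carrier G" "g [^] (m::nat) = \<one>" shows "g [^] (n mod m) = g [^] n"
proof -
  have "g [^] n = (g [^] m) [^] (n div m) \<otimes> g [^] (n mod m)"
    using assms(1) by (simp add: nat_pow_pow nat_pow_mult)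
  then show ?thesis using assms by simp
qed

lemma ord_prime_powerI:
  assumes "prime p" "x \<in> carrier G" "x [^] (p ^ Suc m) = \<one>" "x [^] (p ^ m) \<noteq> \<one>"
  shows "ord x = p ^ Suc m"
proof -
  have "ord x dvd p ^ Suc m" using assms pow_eq_id by blast
  then obtain i where i: "i \<le> Suc m" "ord x = p ^ i"
    using divides_primepow_nat[OF assms(1)] by blast
  have "\<not> i \<le> m"
    using assms(2,4) i(2) pow_eq_id le_imp_power_dvd by metis
  with i show ?thesis by (metis le_SucE)
qed

lemma ord_primeI:
  assumes "prime p" "x \<in> carrier G" "x [^] p = \<one>" "x \<noteq> \<one>" shows "ord x = p"
  using ord_prime_powerI[of p x 0] assms by simp

text \<open>The subgroups of a cyclic group of prime power order form a chain, so each nontrivial one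
  contains the smallest, which is generated by \<open>x\<close> to the power \<open>p\<^sup>m\<close>.\<close>

lemma cyclic_Int_trivial:
  assumes "prime p" "x \<in> carrier G" "ord x = p ^ Suc m" "subgroup H G" "x [^] (p ^ m) \<notin> H"
  shows "H \<inter> generate G {x} = {\<one>}"
proof -
  have "h = \<one>" if h: "h \<in> H" "h \<in> generate G {x}" for h
  proof -
    have "ord x \<noteq> 0" using assms(1,3) prime_gt_0_nat[of p] by simp
    then obtain d :: nat where d: "h = x [^] d"
      using generate_pow_nat[OF assms(2)] h(2) by blast
    obtain i where i: "i \<le> Suc m" "gcd d (p ^ Suc m) = p ^ i"
      using divides_primepow_nat[OF assms(1)] by (metis gcd_dvd2)
    have "i = Suc m"
    proof (rule ccontr)
      assume "i \<noteq> Suc m"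
      with i(1) have im: "i \<le> m" by simp
      have "d \<noteq> 0"
      proof
        assume "d = 0"
        then have "p ^ Suc m = p ^ i" using i(2) by simp
        then have "Suc m = i" by (simp only: power_inject_exp[OF prime_gt_1_nat[OF assms(1)]])
        with \<open>i \<noteq> Suc m\<close> show False by simp
      qed
      then obtain a b where "d * a = p ^ Suc m * b + gcd d (p ^ Suc m)"
        using bezout_nat by blast
      then have "d * a = ord x * b + p ^ i" by (simp only: i(2) assms(3))
      then have "h [^] a = (x [^] ord x) [^] b \<otimes> x [^] (p ^ i)"
        by (simp only: d nat_pow_pow[OF assms(2)] nat_pow_mult[OF assms(2)])
      then have "h [^] a = x [^] (p ^ i)" using assms(2) by simp
      then have "(h [^] a) [^] (p ^ (m - i)) = x [^] (p ^ m)"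
        using assms(2) im by (simp add: nat_pow_pow flip: power_add)
      then show False using assms(4,5) h(1) pow_in_subgroup by metis
    qed
    then have "ord x dvd d" using i assms(3) by (metis gcd_dvd1)
    then show ?thesis using d assms(2) pow_eq_id by simp
  qed
  moreover have "\<one> \<in> H \<inter> generate G {x}"
    using assms(4) by (simp add: subgroup.one_closed generate.one)
  ultimately show ?thesis by blast
qed

lemma centralizer_subgroup:
  assumes "y \<in> carrier G" shows "subgroup {g \<in> carrier G. g \<otimes> y = y \<otimes> g} G"
proof (rule subgroupI)
  fix g assume "g \<in> {g \<in> carrier G. g \<otimes> y = y \<otimes> g}"
  then have g: "g \<in> carrier G" "g \<otimes> y = y \<otimes> g" by auto
  have "inv g \<otimes> (g \<otimes> y) \<otimes> inv g = inv g \<otimes> (y \<otimes> g) \<otimes> inv g" by (simp add: g(2))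
  then have "y \<otimes> inv g = inv g \<otimes> y" using g(1) assms by (simp add: m_assoc)
  then show "inv g \<in> {g \<in> carrier G. g \<otimes> y = y \<otimes> g}" using g by simp
next
  fix g h assume "g \<in> {g \<in> carrier G. g \<otimes> y = y \<otimes> g}" "h \<in> {g \<in> carrier G. g \<otimes> y = y \<otimes> g}"
  then have gh: "g \<in> carrier G" "h \<in> carrier G" "g \<otimes> y = y \<otimes> g" "h \<otimes> y = y \<otimes> h" by auto
  have "g \<otimes> h \<otimes> y = (g \<otimes> y) \<otimes> h" using gh(1,2,4) assms by (simp add: m_assoc)
  also have "\<dots> = y \<otimes> (g \<otimes> h)" using gh(1,2,3) assms by (simp add: m_assoc)
  finally show "g \<otimes> h \<in> {g \<in> carrier G. g \<otimes> y = y \<otimes> g}" using gh by simp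
qed (use assms in auto)

lemma centre_subgroup: "subgroup (centre G) G"
proof -
  have "centre G = (\<Inter>y\<in>carrier G. {g \<in> carrier G. g \<otimes> y = y \<otimes> g})"
    by (auto simp: centre_def)
  then show ?thesis by (simp only:) (rule subgroups_Inter, auto simp: centralizer_subgroup)
qed

lemma generate_subset_centre:
  "z \<in> centre G \<Longrightarrow> generate G {z} \<subseteq> centre G"
  using generate_subgroup_incl[OF _ centre_subgroup] by blast

lemma set_mult_central_subgroup:
  assumes "subgroup H G" "subgroup W G" "W \<subseteq> centre G"
  shows "subgroup (H <#> W) G"
proof (rule subgroupI)
  note [simp] = subgroup.mem_carrier[OF assms(1)] subgroup.mem_carrier[OF assms(2)]
  have comm: "v \<otimes> g = g \<otimes> v" if "v \<in> W" "g \<in> carrier G" for v g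
    by (rule centreD(2)[OF subsetD[OF assms(3) that(1)] that(2)])
  show "H <#> W \<subseteq> carrier G" by (auto simp: set_mult_def)
  show "H <#> W \<noteq> {}"
    using subgroup.one_closed[OF assms(1)] subgroup.one_closed[OF assms(2)]
    by (auto simp: set_mult_def)
  show "inv u \<in> H <#> W" if u: "u \<in> H <#> W" for u
  proof -
    from u obtain h v where hv: "h \<in> H" "v \<in> W" "u = h \<otimes> v" by (auto simp: set_mult_def)
    then have "inv u = inv h \<otimes> inv v"
      by (simp add: inv_mult_group comm subgroup.m_inv_closed[OF assms(2)])
    then show ?thesis
      using hv subgroup.m_inv_closed[OF assms(1)] subgroup.m_inv_closed[OF assms(2)]
      by (auto simp: set_mult_def)
  qed
  show "u \<otimes> u' \<in> H <#> W" if u: "u \<in> H <#> W" "u' \<in> H <#> W" for u u'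
  proof -
    from u obtain h v h' v' where hv: "h \<in> H" "v \<in> W" "u = h \<otimes> v" "h' \<in> H" "v' \<in> W" "u' = h' \<otimes> v'"
      by (auto simp: set_mult_def)
    have "u \<otimes> u' = h \<otimes> ((v \<otimes> h') \<otimes> v')" using hv by (simp add: m_assoc)
    also have "v \<otimes> h' = h' \<otimes> v" using hv by (simp add: comm)
    also have "h \<otimes> (h' \<otimes> v \<otimes> v') = (h \<otimes> h') \<otimes> (v \<otimes> v')" using hv by (simp add: m_assoc)
    moreover have "h \<otimes> h' \<in> H" "v \<otimes> v' \<in> W"
      using hv subgroup.m_closed[OF assms(1)] subgroup.m_closed[OF assms(2)] by simp_all
    ultimately show ?thesis unfolding set_mult_def by blast
  qed
qed

lemma centre_if_commutes_generators:
  assumes "S \<subseteq> carrier G" "generate G S = carrier G" "c \<in> carrier G"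
    and "\<And>s. s \<in> S \<Longrightarrow> s \<otimes> c = c \<otimes> s"
  shows "c \<in> centre G"
proof -
  have "generate G S \<subseteq> {g \<in> carrier G. g \<otimes> c = c \<otimes> g}"
    using assms by (intro generate_subgroup_incl centralizer_subgroup) auto
  then have "\<forall>g\<in>carrier G. g \<otimes> c = c \<otimes> g" using assms(2) by blast
  with assms(3) show ?thesis by (simp add: centre_def)
qed

lemma central_subgroup_normal:
  assumes "subgroup N G" "N \<subseteq> centre G" shows "N \<lhd> G"
proof (rule normal_invI[OF assms(1)])
  fix g z assume g: "g \<in> carrier G" and z: "z \<in> N"
  note c = centreD[OF subsetD[OF assms(2) z]]
  have "g \<otimes> z \<otimes> inv g = z \<otimes> g \<otimes> inv g" by (simp only: c(2)[OF g])
  also have "\<dots> = z" using g c(1) by (simp add: m_assoc)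
  finally show "g \<otimes> z \<otimes> inv g \<in> N" using z by simp
qed

end

lemma (in group_hom) hom_comm: "g \<in> carrier G \<Longrightarrow> g' \<in> carrier G \<Longrightarrow> h (comm G g g') = comm H (h g) (h g')"
  by (simp add: comm_def)

lemma (in normal) coset_group_hom: "group_hom G (G Mod H) (r_coset G H)"
  by (simp add: group_hom_def group_hom_axioms_def r_coset_hom_Mod factorgroup_is_group is_group)

text \<open>In the quotient by \<open>W\<close> the coset of \<open>y\<close> commutes with generators, hence is central.\<close>

lemma (in group) comm_generate_in_central:
  assumes W: "subgroup W G" "W \<subseteq> centre G" and S: "S \<subseteq> carrier G" "generate G S = carrier G"
    and y: "y \<in> carrier G" and gens: "\<And>s. s \<in> S \<Longrightarrow> comm G s y \<in> W" and g: "g \<in> carrier G"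
  shows "comm G g y \<in> W"
proof -
  interpret N: normal W G by (rule central_subgroup_normal[OF W])
  let ?c = "r_coset G W"
  interpret c: group_hom G "G Mod W" ?c by (rule N.coset_group_hom)
  have commutes: "?c s \<otimes>\<^bsub>G Mod W\<^esub> ?c y = ?c y \<otimes>\<^bsub>G Mod W\<^esub> ?c s \<longleftrightarrow> comm G s y \<in> W"
    if s: "s \<in> carrier G" for s
  proof -
    have "comm G s y \<in> W \<longleftrightarrow> comm (G Mod W) (?c s) (?c y) = \<one>\<^bsub>G Mod W\<^esub>"
      using c.hom_comm[OF s y] coset_join1[OF _ comm_closed[OF s y] W(1)]
        coset_join2[OF comm_closed[OF s y] W(1)] by auto
    then show ?thesis
      using c.H.comm_eq_iff[OF c.hom_closed[OF s] c.hom_closed[OF y] c.H.one_closed]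
        c.H.r_one[OF c.H.m_closed[OF c.hom_closed[OF y] c.hom_closed[OF s]]] by simp
  qed
  have gen: "generate (G Mod W) (?c ` S) = carrier (G Mod W)"
    using c.generate_img[OF S(1)] S(2) by (simp add: carrier_FactGroup)
  have "?c y \<in> centre (G Mod W)"
    by (rule c.H.centre_if_commutes_generators[OF _ gen c.hom_closed[OF y]])
      (use S(1) gens commutes in \<open>auto simp: subset_iff\<close>)
  from centreD(2)[OF this c.hom_closed[OF g]] show ?thesis using commutes[OF g] by simp
qed

context prime_power_group
begin

lemma card_le_p_or_ge_p2:
  assumes "subgroup H G" "\<not> card H \<le> p" shows "p\<^sup>2 \<le> card H"
proof -
  obtain i where i: "card H = p ^ i" using card_subgroupE[OF assms(1)] .
  have "1 < p" using prime_p prime_gt_1_nat by simp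
  have "\<not> i \<le> 1"
    using assms(2) i power_increasing[of i 1 p] \<open>1 < p\<close> by auto
  then show ?thesis using i power_increasing[of 2 i p] \<open>1 < p\<close> by simp
qed

text \<open>A subgroup \<open>H\<close> that avoids \<open>x\<^sup>p\<close> meets \<open>\<langle>x\<rangle>\<close> trivially. If it had order at least
  \<open>p\<^sup>2\<close>, counting would give \<open>G = H \<langle>x\<rangle>\<close>, and as \<open>x\<close> is central, the commutator
  \<open>[y, z] = x\<^sup>p\<close> would be a commutator of elements of \<open>H\<close>.\<close>

lemma avoiding_small_if_cyclic_centre:
  assumes k: "k = 4" and x: "x \<in> centre G" "ord x = p\<^sup>2"
    and yz: "y \<in> carrier G" "z \<in> carrier G" "comm G y z = x [^] p"
    and H: "subgroup H G" "x [^] p \<notin> H"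
  shows "card H \<le> p"
proof (rule ccontr)
  assume "\<not> card H \<le> p"
  then have le: "p\<^sup>2 \<le> card H" by (rule card_le_p_or_ge_p2[OF H(1)])
  have xc: "x \<in> carrier G" using x(1) by (rule centreD)
  let ?Z = "generate G {x}"
  have Z: "subgroup ?Z G" using xc by (intro generate_is_subgroup) simp
  have triv: "H \<inter> ?Z = {\<one>}"
    using cyclic_Int_trivial[of p x 1 H] prime_p xc x(2) H by (simp add: numeral_2_eq_2)
  have "order G = p\<^sup>2 * p\<^sup>2" by (simp add: order_G k flip: power_add)
  also have "\<dots> \<le> card H * card ?Z"
    using mult_le_mono1[OF le, of "p\<^sup>2"] x(2) generate_pow_card[OF xc] by simp
  finally have order: "order G \<le> card H * card ?Z" .
  obtain h v where h: "h \<in> H" "v \<in> ?Z" "y = h \<otimes> v"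
    by (rule complement_factorE[OF H(1) Z triv finite_G order yz(1)])
  obtain h' v' where h': "h' \<in> H" "v' \<in> ?Z" "z = h' \<otimes> v'"
    by (rule complement_factorE[OF H(1) Z triv finite_G order yz(2)])
  have "comm G y z = comm G h h'"
    unfolding h(3) h'(3)
    using h h' generate_subset_centre[OF x(1)] subgroup.mem_carrier[OF H(1)]
    by (intro comm_mult_centre) auto
  then show False using comm_in_subgroup[OF H(1) h(1) h'(1)] yz(3) H(2) by simp
qed

text \<open>Suppose \<open>H\<close> avoids \<open>w\<close> and has order at least \<open>p\<^sup>2\<close>. Then \<open>M = H \<langle>w\<rangle>\<close> has index at
  most \<open>p\<close>, so it contains the commutator \<open>y\<close>. Up to a central factor \<open>y\<close> lies in \<open>H\<close>, whence
  the commutators of \<open>H\<close> with \<open>y\<close> are in \<open>H \<inter> \<langle>w\<rangle> = 1\<close>: the group \<open>M\<close> centralizes \<open>y\<close>. It does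
  not contain \<open>x\<close>, which fails to commute with \<open>y\<close>, so it is the full centralizer of \<open>y\<close> and
  contains \<open>z\<close>. Then \<open>z\<^sup>p\<close> is the \<open>p\<close>-th power of an element of \<open>H\<close>, and \<open>w\<close>, being a
  power of \<open>z\<^sup>p\<close>, lies in \<open>H\<close>.\<close>

lemma avoiding_small_if_maximal_class:
  assumes k: "k = 4" and gens: "x \<in> carrier G" "y \<in> carrier G" "z \<in> carrier G"
      "generate G {x, y, z} = carrier G"
    and w: "w \<in> centre G" "ord w = p" "w \<in> generate G {z [^] p}"
    and comms: "comm G x y = w" "comm G x z = y" "comm G y z = \<one>"
    and H: "subgroup H G" "w \<notin> H"
  shows "card H \<le> p"
proof (rule ccontr)
  assume "\<not> card H \<le> p"
  then have le: "p\<^sup>2 \<le> card H" by (rule card_le_p_or_ge_p2[OF H(1)])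
  have wc: "w \<in> carrier G" using w(1) by (rule centreD)
  let ?W = "generate G {w}"
  define M where "M = H <#> ?W"
  have W: "subgroup ?W G" "?W \<subseteq> centre G"
    using wc w(1) by (auto intro: generate_is_subgroup generate_subset_centre[THEN subsetD])
  have triv: "H \<inter> ?W = {\<one>}"
    using cyclic_Int_trivial[of p w 0 H] prime_p wc w(2) H by simp
  have M: "subgroup M G" unfolding M_def by (rule set_mult_central_subgroup[OF H(1) W])
  have "M = (\<lambda>(h, v). h \<otimes> v) ` (H \<times> ?W)" by (auto simp: M_def set_mult_def)
  then have "card M = card H * p"
    using card_image[OF mult_inj_on_times[OF H(1) W(1) triv]] w(2) generate_pow_card[OF wc]
    by (simp add: card_cartesian_product)
  then have index: "order G \<le> p * card M"
    using le order_G k by (simp add: eval_nat_numeral)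
  have M_centralizes: "g \<otimes> y = y \<otimes> g" if "g \<in> M" for g
  proof -
    have "y \<in> M" using comm_in_index_p[OF M index gens(1,3)] comms(2) by simp
    then obtain h v where h: "h \<in> H" "v \<in> ?W" "y = h \<otimes> v" by (auto simp: M_def set_mult_def)
    obtain h' v' where h': "h' \<in> H" "v' \<in> ?W" "g = h' \<otimes> v'"
      using \<open>g \<in> M\<close> by (auto simp: M_def set_mult_def)
    have "comm G g y = comm G h' h"
      unfolding h(3) h'(3) using h h' W(2) subgroup.mem_carrier[OF H(1)]
      by (intro comm_mult_centre) auto
    then have "comm G g y \<in> H" using comm_in_subgroup[OF H(1) h'(1) h(1)] by simp
    moreover have gc: "g \<in> carrier G" using that subgroup.mem_carrier[OF M] by blast
    have "comm G s y \<in> ?W" if "s \<in> {x, y, z}" for s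
    proof -
      have "comm G y y = \<one>" using gens by (simp add: comm_def m_assoc)
      moreover have "comm G z y = \<one>" using inv_commutator[OF gens(2,3)] comms(3) by simp
      ultimately show ?thesis using that comms(1) by (auto intro: generate.one generate.incl)
    qed
    then have "comm G g y \<in> ?W"
      using comm_generate_in_central[OF W _ gens(4,2) _ gc] gens by auto
    ultimately have "comm G g y = \<one>" using triv by blast
    then show ?thesis using comm_eq_iff[of g y \<one>] gc gens by simp
  qed
  have x_notin: "\<not> x \<otimes> y = y \<otimes> x"
  proof
    assume "x \<otimes> y = y \<otimes> x"
    then have "w = \<one>" using comm_eq_iff[of x y \<one>] gens comms(1) by simp
    with H show False by (simp add: subgroup.one_closed)
  qed
  then have "x \<notin> M" using M_centralizes by blast
  (* Both z and m commute with y, hence so does the power of x between them; as x does not, that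
     power is trivial. *)
  obtain i m where im: "i < p" "m \<in> M" "z = x [^] i \<otimes> m"
    by (rule index_p_factorE[OF M index gens(1) \<open>x \<notin> M\<close> gens(3)])
  let ?C = "{g \<in> carrier G. g \<otimes> y = y \<otimes> g}"
  have C: "subgroup ?C G" by (rule centralizer_subgroup[OF gens(2)])
  have mc: "m \<in> carrier G" using im(2) subgroup.mem_carrier[OF M] by blast
  have "i = 0"
  proof (rule ccontr)
    assume "i \<noteq> 0"
    have "z \<in> ?C" using comms(3) comm_eq_iff[of y z \<one>] gens by simp
    moreover have "m \<in> ?C" using M_centralizes im(2) mc by blast
    ultimately have "z \<otimes> inv m \<in> ?C" using subgroup.m_closed[OF C] subgroup.m_inv_closed[OF C] by blast
    then have "x [^] i \<in> ?C" using im(3) mc gens by (simp add: m_assoc)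
    moreover have "coprime i (order G)"
      using \<open>i \<noteq> 0\<close> im(1) prime_p order_G
      by (metis coprime_commute coprime_power_right_iff dvd_imp_le gr0I linorder_not_less prime_imp_coprime)
    ultimately have "x \<in> ?C"
      using pow_coprime_in_subgroup[OF C gens(1)] \<open>i \<noteq> 0\<close> finite_G by blast
    with x_notin show False by blast
  qed
  then have "z \<in> M" using im mc by simp
  then obtain h v where h: "h \<in> H" "v \<in> ?W" "z = h \<otimes> v" by (auto simp: M_def set_mult_def)
  have hv: "h \<in> carrier G" "v \<in> carrier G" "h \<otimes> v = v \<otimes> h"
    using h subgroup.mem_carrier[OF H(1)] subgroup.mem_carrier[OF W(1)]
      centreD(2)[OF subsetD[OF W(2) h(2)], of h] by simp_all
  have "v [^] p = \<one>"
  proof -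
    have "ord w \<noteq> 0" using w(2) prime_p prime_gt_0_nat by simp
    then obtain j :: nat where "v = w [^] j" using h(2) generate_pow_nat[OF wc] by blast
    then show ?thesis using wc w(2) by (simp add: nat_pow_pow pow_eq_id)
  qed
  then have "z [^] p = h [^] p" unfolding h(3) using pow_mult_distrib[OF hv(3,1,2)] hv by simp
  then have "{z [^] p} \<subseteq> H" using pow_in_subgroup[OF H(1) h(1)] by simp
  then show False using generate_subgroup_incl[OF _ H(1)] w(3) H(2) by blast
qed

end

context group
begin

text \<open>Torsion generators make inverses into positive powers, so a normal form has to be checked
  only under left multiplication by generators.\<close>

lemma generate_left_closed:
  assumes S: "S \<subseteq> carrier G" and A: "A \<subseteq> carrier G" "\<one> \<in> A"
    and closed: "\<And>s a. s \<in> S \<Longrightarrow> a \<in> A \<Longrightarrow> s \<otimes> a \<in> A"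
    and torsion: "\<And>s. s \<in> S \<Longrightarrow> \<exists>n::nat. 0 < n \<and> s [^] n = \<one>"
  shows "generate G S \<subseteq> A"
proof
  have pow_closed: "s [^] (n::nat) \<otimes> a \<in> A" if "s \<in> S" "a \<in> A" for s n a
    using that
  proof (induction n arbitrary: a)
    case (Suc n)
    then show ?case using S A closed[OF Suc.prems] by (auto simp: m_assoc subset_iff)
  qed (use A in auto)
  have "g \<in> carrier G \<and> (\<forall>a\<in>A. g \<otimes> a \<in> A)" if "g \<in> generate G S" for g
    using that
  proof (induction g rule: generate.induct)
    case (inv s)
    obtain n :: nat where n: "0 < n" "s [^] n = \<one>" using torsion[OF inv] by blast
    then obtain m where m: "n = Suc m" using gr0_implies_Suc by blast
    have sc: "s \<in> carrier G" using S inv by blast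
    have "inv s = s [^] m" using n(2) sc m by (intro inv_equality) simp_all
    with pow_closed[OF inv] sc show ?case by simp
  next
    case (eng g h)
    then show ?case using A by (auto simp: m_assoc subset_iff)
  qed (use S A closed in auto)
  then show "g \<in> A" if "g \<in> generate G S" for g
    using that A by force
qed

lemma order_Mod_cyclic:
  assumes "subgroup N G" "N \<lhd> G" "card N = p" "0 < p" "order G = p ^ Suc k"
  shows "order (G Mod N) = p ^ k"
proof -
  have "order (G Mod N) * p = p ^ k * p"
    using lagrange[OF assms(1)] assms(3,5) by (auto simp add: order_def FactGroup_def)
  then show ?thesis using assms(4) by simp
qed

text \<open>Here \<open>Z\<close> is spanned by the commutator \<open>a\<close> and the \<open>p\<close>-th power \<open>b\<close>, both of which lie in
  every subgroup of index \<open>p\<close>; the distinguished subgroup is generated by \<open>n\<close>. The quotient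
  enters the hypothesis on small subgroups only as a homomorphic image \<open>Q\<close> of order \<open>p\<^sup>4\<close> in which
  \<open>n\<close> vanishes and \<open>w\<close> does not. The two bounds on degrees combine by
  \<open>2p\<^sup>2 < 3p\<^sup>2 \<le> p\<^sup>3\<close>.\<close>

lemma distinguished_if_commutator_and_power:
  assumes p: "prime p" "3 \<le> p" and order: "order G = p ^ 5"
    and \<phi>: "\<phi> \<in> mon G (BijGroup S)" "finite S" "card S = 2 * p\<^sup>2"
    and a: "a \<in> centre G" "a [^] p = \<one>" "a \<noteq> \<one>" "g \<in> carrier G" "h \<in> carrier G" "comm G g h = a"
    and b: "b \<in> centre G" "b [^] p = \<one>" "b \<notin> generate G {a}" "t \<in> carrier G" "b = t [^] p"
    and n: "n \<in> centre G" "n [^] p = \<one>" "n \<noteq> \<one>"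
    and w: "w \<in> carrier G" "w \<notin> generate G {n}"
    and small: "\<And>(Q :: 'a set monoid) c H. prime_power_group Q p 4 \<Longrightarrow> group_hom G Q c \<Longrightarrow>
        c ` carrier G = carrier Q \<Longrightarrow> c n = \<one>\<^bsub>Q\<^esub> \<Longrightarrow> c w \<noteq> \<one>\<^bsub>Q\<^esub> \<Longrightarrow>
        subgroup H Q \<Longrightarrow> c w \<notin> H \<Longrightarrow> card H \<le> p"
  shows "min_degree G = 2 * p\<^sup>2" "distinguished_subgroup (generate G {n}) G"
proof -
  interpret prime_power_group G p 5
    using p order by unfold_locales
  have c: "a \<in> carrier G" "b \<in> carrier G" "n \<in> carrier G" using a(1) b(1) n(1) by (auto intro: centreD)
  note ord = ord_primeI[OF p(1)]
  let ?A = "generate G {a}" and ?B = "generate G {b}" and ?N = "generate G {n}"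
  have sub: "subgroup ?A G" "subgroup ?B G" "subgroup ?N G"
    using c by (auto intro: generate_is_subgroup)
  have cen: "?A \<subseteq> centre G" "?B \<subseteq> centre G" "?N \<subseteq> centre G"
    using a(1) b(1) n(1) by (simp_all add: generate_subset_centre)
  have b1: "b \<noteq> \<one>" using b(3) generate.one by metis
  have card: "card ?A = p" "card ?B = p" "card ?N = p"
    using c ord a(2,3) b(2) b1 n(2,3) by (simp_all flip: generate_pow_card)
  have triv: "?A \<inter> ?B = {\<one>}"
    using cyclic_Int_trivial[OF p(1) c(2) _ sub(1), of 0] ord[OF c(2) b(2) b1] b(3) c(2) by simp
  define Z where "Z = ?A <#> ?B"
  have Z: "subgroup Z G" unfolding Z_def by (rule set_mult_central_subgroup[OF sub(1,2) cen(2)])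
  have Z_eq: "Z = (\<lambda>(s, z). s \<otimes> z) ` (?A \<times> ?B)" by (auto simp: Z_def set_mult_def)
  have Zcard: "card Z = p\<^sup>2"
    unfolding Z_eq using card_image[OF mult_inj_on_times[OF sub(1,2) triv]] card
    by (simp add: card_cartesian_product power2_eq_square)
  have Z_incl: "Z \<subseteq> M" if M: "subgroup M G" "a \<in> M" "b \<in> M" for M
  proof -
    have "?A \<subseteq> M" "?B \<subseteq> M" using M by (simp_all add: generate_subgroup_incl)
    then show ?thesis using subgroup.m_closed[OF M(1)] by (auto simp: Z_eq)
  qed
  have Z_centre: "Z \<subseteq> centre G" by (rule Z_incl[OF centre_subgroup a(1) b(1)])
  have aZ: "a \<in> Z"
  proof -
    have "a \<otimes> \<one> \<in> Z"
      unfolding Z_def set_mult_def using generate.incl[of a "{a}" G] generate.one[of G "{b}"] by blast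
    then show ?thesis using c by simp
  qed
  have frattini: "Z \<subseteq> M" if M: "subgroup M G" "card M = p ^ 4" for M
  proof (rule Z_incl[OF M(1)])
    have index: "order G \<le> p * card M" by (simp add: order M(2) eval_nat_numeral)
    show "a \<in> M" using comm_in_index_p[OF M(1) index a(4,5)] a(6) by simp
    show "b \<in> M" using pow_p_in_index_p[OF M(1) index b(4)] b(5) by simp
  qed
  have N: "?N \<lhd> G" by (rule central_subgroup_normal[OF sub(3) cen(3)])
  have orderN: "order (G Mod ?N) = p ^ 4"
    by (rule order_Mod_cyclic[OF sub(3) N card(3)]) (use p order in \<open>simp_all add: eval_nat_numeral\<close>)
  interpret N: normal ?N G by (rule N)
  have Q: "prime_power_group (G Mod ?N) p 4"
    using N.factorgroup_is_group p(1) orderN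
    by (simp add: prime_power_group_def prime_power_group_axioms_def)
  note hom = N.coset_group_hom
  have onto: "r_coset G ?N ` carrier G = carrier (G Mod ?N)" by (simp add: carrier_FactGroup)
  have cn: "?N #> n = \<one>\<^bsub>G Mod ?N\<^esub>" using coset_join2[OF c(3) sub(3) generate.incl] by simp
  have w_ne: "?N #> w \<noteq> \<one>\<^bsub>G Mod ?N\<^esub>"
    using w rcos_self[OF w(1) sub(3)] by auto
  have fin: "finite (carrier (G Mod ?N))"
    using orderN p by (intro card_ge_0_finite) (simp add: order_def)
  have "2 * p\<^sup>2 \<le> min_degree G"
    by (rule min_degree_ge[OF is_group finite_G])
      (rule faithful_action.degree_ge_if_frattini_centre[OF _ p order _ Z Z_centre Zcard frattini a(4,5)],
        use a(3,6) aZ in auto)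
  with min_degree_le[OF \<phi>(1,2)] \<phi>(3) show degree: "min_degree G = 2 * p\<^sup>2" by simp
  have "2 * p\<^sup>2 < 3 * p\<^sup>2" using p by simp
  also have "\<dots> \<le> p * p\<^sup>2" using p by simp
  also have "\<dots> = p ^ 3" by (simp add: eval_nat_numeral)
  also have "\<dots> \<le> min_degree (G Mod ?N)"
    by (rule min_degree_ge[OF N.factorgroup_is_group fin])
      (rule faithful_action.degree_ge_if_avoiding_small[OF _ p(1) orderN _ group_hom.hom_closed[OF hom w(1)]
          w_ne small[OF Q hom onto cn w_ne]])
  finally show "distinguished_subgroup ?N G"
    using N finite_G degree by (simp add: distinguished_subgroup_def)
qed

end

context group_hom
begin

lemma surj_if_generated:
  assumes "S \<subseteq> carrier G" "generate G S = carrier G" "generate H (h ` S) = carrier H"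
  shows "h ` carrier G = carrier H"
  using generate_img[OF assms(1)] assms(2,3) by simp

lemma centre_image:
  assumes "h ` carrier G = carrier H" "c \<in> centre G" shows "h c \<in> centre H"
proof -
  have "h c \<otimes>\<^bsub>H\<^esub> u = u \<otimes>\<^bsub>H\<^esub> h c" if u: "u \<in> carrier H" for u
  proof -
    from u assms(1) obtain g where g: "g \<in> carrier G" "u = h g" by blast
    have "h (c \<otimes> g) = h (g \<otimes> c)" using centreD(2)[OF assms(2) g(1)] by (rule arg_cong)
    with g centreD(1)[OF assms(2)] show ?thesis by simp
  qed
  then show ?thesis using centreD(1)[OF assms(2)] by (simp add: centre_def)
qed

text \<open>The map \<open>k\<close> undoes \<open>h\<close> up to \<open>N\<close> on generators, hence everywhere; so the kernel of \<open>h\<close> is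
  no larger than \<open>N\<close>.\<close>

lemma quotient_iso_if_inverse:
  assumes N: "N \<lhd> G" and S: "S \<subseteq> carrier G" "generate G S = carrier G"
    and onto: "h ` carrier G = carrier H"
    and k: "k \<in> hom H (G Mod N)" and inverse: "\<And>s. s \<in> S \<Longrightarrow> k (h s) = N #> s"
    and kills: "N \<subseteq> kernel G H h"
  shows "G Mod N \<cong> H"
proof -
  interpret N: normal N G by (rule N)
  interpret k: group_hom H "G Mod N" k
    by (simp add: group_hom_def group_hom_axioms_def k H.is_group N.factorgroup_is_group)
  interpret c: group_hom G "G Mod N" "r_coset G N"
    by (simp add: group_hom_def group_hom_axioms_def N.r_coset_hom_Mod N.factorgroup_is_group)
  have "k (h g) = N #> g" if "g \<in> generate G S" for g
    using that
  proof (induction g rule: generate.induct)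
    case one
    show ?case using c.hom_one k.hom_one by simp
  next
    case (inv s)
    then have "s \<in> carrier G" using S by blast
    then have "k (h (inv s)) = inv\<^bsub>G Mod N\<^esub> k (h s)" "N #> inv s = inv\<^bsub>G Mod N\<^esub> (N #> s)"
      using k.hom_inv c.hom_inv by simp_all
    then show ?case using inverse[OF inv] by simp
  next
    case (eng g g')
    then have "g \<in> carrier G" "g' \<in> carrier G" using S by auto
    then have "k (h (g \<otimes> g')) = k (h g) \<otimes>\<^bsub>G Mod N\<^esub> k (h g')"
      "N #> (g \<otimes> g') = (N #> g) \<otimes>\<^bsub>G Mod N\<^esub> (N #> g')"
      using k.hom_mult c.hom_mult by simp_all
    then show ?case using eng.IH by simp
  qed (use inverse in simp)
  then have kh: "k (h g) = N #> g" if "g \<in> carrier G" for g using that S(2) by simp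
  have "kernel G H h \<subseteq> N"
  proof
    fix g assume "g \<in> kernel G H h"
    then have g: "g \<in> carrier G" "h g = \<one>\<^bsub>H\<^esub>" by (auto simp: kernel_def)
    then have "N #> g = N" using kh[OF g(1)] k.hom_one by simp
    then show "g \<in> N" using G.rcos_self[OF g(1) N.subgroup_axioms] by simp
  qed
  with kills have "kernel G H h = N" by blast
  then show ?thesis using FactGroup_iso_set[OF onto] is_isoI by metis
qed

end

section \<open>Permutations given by formulas on representatives\<close>

text \<open>A finite set such as \<open>\<int>/m\<close> is represented by the fixed points of a map \<open>r\<close> that reduces
  arbitrary integers (or tuples of integers) to their residues. A map \<open>f\<close> compatible with \<open>r\<close>
  acts on residues as \<open>r \<circ> f\<close>, and identities between such permutations become congruences
  between integer formulas.\<close>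

locale reduction =
  fixes r :: "'b \<Rightarrow> 'b"
  assumes idem: "r (r t) = r t"
begin

definition points :: "'b set" where "points = {t. r t = t}"

abbreviation perms :: "('b \<Rightarrow> 'b) monoid" where "perms \<equiv> BijGroup points"

definition act :: "('b \<Rightarrow> 'b) \<Rightarrow> 'b \<Rightarrow> 'b" where "act f = (\<lambda>t\<in>points. r (f t))"

text \<open>The formulas that are well defined on residues and induce permutations there.\<close>

definition admissible :: "('b \<Rightarrow> 'b) \<Rightarrow> bool" where
  "admissible f \<longleftrightarrow> (\<forall>t. r (f (r t)) = r (f t)) \<and> act f \<in> carrier (perms)"

text \<open>One-parameter groups: formulas \<open>F i\<close> that compose additively in \<open>i\<close> up to reduction. Such
  formulas have inverses, and powers in the permutation group need no iteration.\<close>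

definition flow :: "(int \<Rightarrow> 'b \<Rightarrow> 'b) \<Rightarrow> bool" where
  "flow F \<longleftrightarrow> (\<forall>i t. r (F i (r t)) = r (F i t)) \<and>
     (\<forall>i j t. r (F i (F j t)) = r (F (i + j) t)) \<and> (\<forall>t. r (F 0 t) = r t)"

lemma r_in_points [simp]: "r t \<in> points" by (simp add: points_def idem)

lemma points_fixed: "t \<in> points \<Longrightarrow> r t = t" by (simp add: points_def)

lemma act_eqI: "(\<And>t. r (f t) = r (g t)) \<Longrightarrow> act f = act g"
  by (simp add: act_def)

lemma act_eqD:
  assumes "act f = act g" "admissible f" "admissible g"
  shows "r (f t) = r (g t)"
proof -
  have "r (f (r t)) = r (g (r t))" using fun_cong[OF assms(1), of "r t"] by (simp add: act_def)
  then show ?thesis using assms(2,3) by (simp add: admissible_def)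
qed

lemma act_one: "\<one>\<^bsub>perms\<^esub> = act id"
  by (simp add: BijGroup_def act_def points_fixed cong: restrict_cong)

lemma act_mult:
  assumes "admissible f" "admissible g"
  shows "act f \<otimes>\<^bsub>perms\<^esub> act g = act (\<lambda>t. f (g t))"
  using assms by (auto simp: admissible_def BijGroup_def compose_def act_def fun_eq_iff)

lemma admissible_comp:
  assumes "admissible f" "admissible g" shows "admissible (\<lambda>t. f (g t))"
proof -
  interpret B: group "perms" by (rule group_BijGroup)
  have "r (f (g (r t))) = r (f (g t))" for t
    using assms by (metis admissible_def)
  then show ?thesis
    using assms B.m_closed by (simp add: admissible_def flip: act_mult[OF assms])
qed

lemma flow_admissible:
  assumes "flow F" shows "admissible (F i)"
proof -
  have compat: "r (F i (r t)) = r (F i t)" and add: "r (F i (F j t)) = r (F (i + j) t)"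
    and zero: "r (F 0 t) = r t" for i j t
    using assms by (simp_all add: flow_def)
  have "bij_betw (act (F i)) points points"
  proof (rule bij_betwI[where g = "act (F (- i))"])
    show "act (F (- i)) (act (F i) t) = t" if "t \<in> points" for t
      using that by (simp add: act_def compat add zero points_fixed)
    show "act (F i) (act (F (- i)) t) = t" if "t \<in> points" for t
      using that by (simp add: act_def compat add zero points_fixed)
  qed (simp_all add: act_def)
  then show ?thesis by (simp add: admissible_def compat BijGroup_def Bij_def) (simp add: act_def)
qed

lemma flow_carrier: "flow F \<Longrightarrow> act (F i) \<in> carrier (perms)"
  using flow_admissible by (simp add: admissible_def)

lemma flow_mult:
  assumes "flow F"
  shows "act (F i) \<otimes>\<^bsub>perms\<^esub> act (F j) = act (F (i + j))"
  using assms flow_admissible[OF assms]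
  by (simp add: act_mult) (auto intro!: act_eqI simp: flow_def)

lemma flow_zero: "flow F \<Longrightarrow> act (F 0) = \<one>\<^bsub>perms\<^esub>"
  unfolding act_one by (intro act_eqI) (simp add: flow_def)

lemma flow_nat_pow:
  assumes "flow F" shows "act (F i) [^]\<^bsub>perms\<^esub> (n::nat) = act (F (i * int n))"
  by (induction n) (simp_all add: flow_zero[OF assms] flow_mult[OF assms] algebra_simps)

lemma flow_inv:
  assumes "flow F" shows "inv\<^bsub>perms\<^esub> act (F i) = act (F (- i))"
  using flow_mult[OF assms, of "- i" i] flow_zero[OF assms] flow_carrier[OF assms]
  by (intro group.inv_equality[OF group_BijGroup]) simp_all

lemma flow_int_pow:
  assumes "flow F" shows "act (F i) [^]\<^bsub>perms\<^esub> (j::int) = act (F (i * j))"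
  by (simp add: int_pow_def2 flow_nat_pow[OF assms] flow_inv[OF assms])

lemma comm_act_one:
  assumes "admissible f" "admissible g" and "\<And>t. r (f (g t)) = r (g (f t))"
  shows "comm (perms) (act f) (act g) = \<one>\<^bsub>perms\<^esub>"
proof -
  interpret B: group "perms" by (rule group_BijGroup)
  have c: "act f \<in> carrier (perms)" "act g \<in> carrier (perms)"
    using assms(1,2) by (simp_all add: admissible_def)
  have "act f \<otimes>\<^bsub>perms\<^esub> act g = act g \<otimes>\<^bsub>perms\<^esub> act f"
    unfolding act_mult[OF assms(1,2)] act_mult[OF assms(2,1)] by (rule act_eqI) (rule assms(3))
  then show ?thesis using c by (simp add: B.comm_eq_iff)
qed

lemma comm_act:
  assumes "admissible f" "admissible g" "admissible c"
    and "\<And>t. r (f (g t)) = r (g (f (c t)))"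
  shows "comm (perms) (act f) (act g) = act c"
proof -
  interpret B: group "perms" by (rule group_BijGroup)
  have "act f \<in> carrier (perms)" "act g \<in> carrier (perms)"
    "act c \<in> carrier (perms)"
    using assms(1-3) by (simp_all add: admissible_def)
  note B.comm_eq_iff[OF this]
  moreover have "act f \<otimes>\<^bsub>perms\<^esub> act g = act (\<lambda>t. g (f (c t)))"
    unfolding act_mult[OF assms(1,2)] by (rule act_eqI) (rule assms(4))
  moreover have "act g \<otimes>\<^bsub>perms\<^esub> act f \<otimes>\<^bsub>perms\<^esub> act c
      = act (\<lambda>t. g (f (c t)))"
    by (simp only: act_mult admissible_comp assms(1-3))
  ultimately show ?thesis by simp
qed

end

section \<open>The groups E2 and E3\<close>

lemma mod_eqI: "(a::int) - b = m * q \<Longrightarrow> a mod m = b mod m"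
  by (simp add: mod_eq_dvd_iff)

text \<open>Write \<open>P\<close> for \<open>p\<close> as an integer. The left summand \<open>\<int>/p\<^sup>2\<close> stands for the cosets
  \<open>x\<^sup>t \<langle>y, z\<rangle>\<close>, the right one for the cosets \<open>z\<^sup>t \<langle>x, y\<rangle>\<close>. There \<open>z\<close>
  moves \<open>t\<close> to \<open>t + p t(t-1)/2\<close>, which \<open>K_Z\<close> expresses without division, by some \<open>h\<close> with
  \<open>2h \<equiv> 1 (mod p)\<close>. \<open>K_N\<close> is the action of \<open>x\<^sup>-\<^sup>c\<^sup>p z\<^sup>p\<close>. The parameters \<open>c\<close> and \<open>d\<close> of \<open>K_Y\<close> allow for
  a central factor: for \<open>c = d = 0\<close> it is the action of \<open>y\<close> in \<open>E\<^sub>2\<close>, for \<open>c = \<alpha>\<close> and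
  \<open>d = -1\<close> the action of \<open>y\<close> in \<open>E\<^sub>3\<close>.\<close>

definition K_red :: "int \<Rightarrow> int + int \<Rightarrow> int + int" where
  "K_red P = map_sum (\<lambda>t. t mod P\<^sup>2) (\<lambda>t. t mod P\<^sup>2)"

definition K_X :: "int \<Rightarrow> int + int \<Rightarrow> int + int" where
  "K_X i = map_sum (\<lambda>t. t + i) (\<lambda>t. t)"

definition K_Y :: "int \<Rightarrow> int \<Rightarrow> int \<Rightarrow> int \<Rightarrow> int + int \<Rightarrow> int + int" where
  "K_Y P c d j = map_sum (\<lambda>t. t * (1 - P * j) + c * P * j) (\<lambda>t. t + d * P * j)"

definition K_Z :: "int \<Rightarrow> int \<Rightarrow> int \<Rightarrow> int + int \<Rightarrow> int + int" where
  "K_Z P h k = map_sum (\<lambda>t. t + P * h * k * t * (t - 1)) (\<lambda>t. t + k)"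

definition K_N :: "int \<Rightarrow> int \<Rightarrow> int \<Rightarrow> int + int \<Rightarrow> int + int" where
  "K_N P c i = map_sum (\<lambda>t. t - c * P * i) (\<lambda>t. t + P * i)"

lemma mod_reduce: obtains q where "(t::int) mod m = t - m * q"
  using minus_mult_div_eq_mod by metis

interpretation K: reduction "K_red P" for P
  by unfold_locales (simp add: K_red_def sum.map_comp comp_def)

lemma residues_iff: "0 < m \<Longrightarrow> (t::int) mod m = t \<longleftrightarrow> t \<in> {0..<m}"
  by (metis atLeastLessThan_iff mod_pos_pos_trivial pos_mod_bound pos_mod_sign)

lemma card_K_points:
  assumes "0 < p"
  shows "finite (K.points (int p))" "card (K.points (int p)) = 2 * p\<^sup>2"
proof -
  have iff: "t mod (int p)\<^sup>2 = t \<longleftrightarrow> t \<in> {0..<(int p)\<^sup>2}" for t :: int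
    using assms by (simp only: residues_iff zero_less_power of_nat_0_less_iff)
  have "K.points (int p) = {0..<(int p)\<^sup>2} <+> {0..<(int p)\<^sup>2}"
  proof (rule Set.set_eqI)
    fix t show "t \<in> K.points (int p) \<longleftrightarrow> t \<in> {0..<(int p)\<^sup>2} <+> {0..<(int p)\<^sup>2}"
      unfolding K.points_def unfolding K_red_def by (cases t) (auto simp: iff)
  qed
  then show "finite (K.points (int p))" "card (K.points (int p)) = 2 * p\<^sup>2"
    by (simp_all add: card_Plus nat_power_eq)
qed

lemma flow_K_X: "K.flow P K_X"
  unfolding K.flow_def unfolding K_red_def K_X_def
  by (auto simp: sum.map_comp comp_def mod_simps algebra_simps intro!: sum.map_cong)

lemma flow_K_N: "K.flow P (K_N P c)"
  unfolding K.flow_def unfolding K_red_def K_N_def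
  by (auto simp: sum.map_comp comp_def mod_simps algebra_simps intro!: sum.map_cong)

lemma flow_K_Y: "K.flow P (K_Y P c d)"
proof -
  have "((t mod P\<^sup>2) * (1 - P * i) + c * P * i) mod P\<^sup>2 = (t * (1 - P * i) + c * P * i) mod P\<^sup>2" for t i
    by (metis mod_add_left_eq mod_mult_left_eq)
  moreover have "((t * (1 - P * j) + c * P * j) * (1 - P * i) + c * P * i) mod P\<^sup>2
      = (t * (1 - P * (i + j)) + c * P * (i + j)) mod P\<^sup>2" for t i j
    by (rule mod_eqI[where q = "i * j * (t - c)"]) (simp add: algebra_simps power2_eq_square)
  moreover have "(t + d * P * j + d * P * i) mod P\<^sup>2 = (t + d * P * (i + j)) mod P\<^sup>2" for t i j
    by (simp add: algebra_simps)
  ultimately show ?thesis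
    unfolding K.flow_def unfolding K_red_def K_Y_def
    by (auto simp: sum.map_comp comp_def mod_simps intro!: sum.map_cong)
qed

lemma flow_K_Z: "K.flow P (K_Z P h)"
proof -
  have "((t mod P\<^sup>2) + P * h * i * (t mod P\<^sup>2) * ((t mod P\<^sup>2) - 1)) mod P\<^sup>2
      = (t + P * h * i * t * (t - 1)) mod P\<^sup>2" for t i
  proof -
    obtain q where q: "t mod P\<^sup>2 = t - P\<^sup>2 * q" by (rule mod_reduce)
    show ?thesis
      unfolding q by (rule mod_eqI[where q = "- q * (1 + P * h * i * (t + (t - P\<^sup>2 * q) - 1))"]) (simp add: algebra_simps power2_eq_square)
  qed
  moreover have "((t + P * h * j * t * (t - 1)) +
      P * h * i * (t + P * h * j * t * (t - 1)) * ((t + P * h * j * t * (t - 1)) - 1)) mod P\<^sup>2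
      = (t + P * h * (i + j) * t * (t - 1)) mod P\<^sup>2" for t i j
    by (rule mod_eqI[where q = "h * h * i * j * t * (t - 1) * (t + P * h * j * t * (t - 1) + t - 1)"]) (simp add: algebra_simps power2_eq_square)
  ultimately show ?thesis
    unfolding K.flow_def unfolding K_red_def K_Z_def
    by (auto simp: sum.map_comp comp_def mod_simps add_ac intro!: sum.map_cong)
qed

lemmas K_admissible =
  flow_K_X[THEN K.flow_admissible] flow_K_Y[THEN K.flow_admissible]
  flow_K_Z[THEN K.flow_admissible] flow_K_N[THEN K.flow_admissible]

text \<open>The pointwise identities behind the relations. Each congruence modulo \<open>P\<^sup>2\<close> is witnessed by
  the quotient of the difference of its sides.\<close>

lemma K_comm_XY: "K_red P (K_X 1 (K_Y P c d 1 t)) = K_red P (K_Y P c d 1 (K_X 1 (K_X P t)))"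
proof (cases t)
  case (Inl a)
  have "(a * (1 - P) + c * P + 1) mod P\<^sup>2 = ((a + P + 1) * (1 - P) + c * P) mod P\<^sup>2"
    by (rule mod_eqI[where q = 1]) (simp add: algebra_simps power2_eq_square)
  then show ?thesis by (simp add: Inl K_red_def K_X_def K_Y_def)
qed (simp add: K_red_def K_X_def K_Y_def add_ac)

lemma K_comm_YZ: "K_red P (K_Y P c d 1 (K_Z P h 1 t)) = K_red P (K_Z P h 1 (K_Y P c d 1 t))"
proof (cases t)
  case (Inl a)
  define s where "s = a * (1 - P) + c * P"
  have "((a + P * h * a * (a - 1)) * (1 - P) + c * P) mod P\<^sup>2 = (s + P * h * s * (s - 1)) mod P\<^sup>2"
    unfolding s_def
    by (rule mod_eqI[where q = "- h * a * (a - 1) - h * (c - a) * (a * (1 - P) + c * P + a - 1)"]) (simp add: algebra_simps power2_eq_square)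
  then show ?thesis by (simp add: Inl K_red_def K_Z_def K_Y_def s_def)
qed (simp add: K_red_def K_Z_def K_Y_def add_ac)

lemma K_comm_XZ:
  assumes "P = 2 * h - 1"
  shows "K_red P (K_X 1 (K_Z P h 1 t)) = K_red P (K_Z P h 1 (K_X 1 (K_Y P 0 0 1 t)))"
proof (cases t)
  case (Inl a)
  define s where "s = a * (1 - P) + 1"
  have "(a + P * h * a * (a - 1) + 1) mod P\<^sup>2 = (s + P * h * s * (s - 1)) mod P\<^sup>2"
    unfolding s_def assms
    by (rule mod_eqI[where q = "- a + h * (a * (2 * a + 1) - (2 * h - 1) * a * a)"]) (simp add: algebra_simps power2_eq_square)
  then show ?thesis by (simp add: Inl K_red_def K_Z_def K_Y_def K_X_def s_def)
qed (simp add: K_red_def K_Z_def K_Y_def K_X_def add_ac)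

lemma K_comm_XN: "K_red P (K_X 1 (K_N P c i t)) = K_red P (K_N P c i (K_X 1 t))"
  by (cases t) (simp_all add: K_red_def K_X_def K_N_def algebra_simps)

lemma K_comm_YN: "K_red P (K_Y P c' d 1 (K_N P c i t)) = K_red P (K_N P c i (K_Y P c' d 1 t))"
proof (cases t)
  case (Inl a)
  have "((a - c * P * i) * (1 - P) + c' * P) mod P\<^sup>2 = (a * (1 - P) + c' * P - c * P * i) mod P\<^sup>2"
    by (rule mod_eqI[where q = "c * i"]) (simp add: algebra_simps power2_eq_square)
  then show ?thesis by (simp add: Inl K_red_def K_Y_def K_N_def)
qed (simp add: K_red_def K_Y_def K_N_def algebra_simps)

lemma K_comm_ZN: "K_red P (K_Z P h 1 (K_N P c i t)) = K_red P (K_N P c i (K_Z P h 1 t))"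
proof (cases t)
  case (Inl a)
  have "((a - c * P * i) + P * h * (a - c * P * i) * ((a - c * P * i) - 1)) mod P\<^sup>2
      = (a + P * h * a * (a - 1) - c * P * i) mod P\<^sup>2"
    by (rule mod_eqI[where q = "- h * c * i * (2 * a - c * P * i - 1)"]) (simp add: algebra_simps power2_eq_square)
  then show ?thesis by (simp add: Inl K_red_def K_Z_def K_N_def)
qed (simp add: K_red_def K_Z_def K_N_def algebra_simps)

lemma K_comm_Xp_Z: "K_red P (K_X P (K_Z P h 1 t)) = K_red P (K_Z P h 1 (K_X P t))"
proof (cases t)
  case (Inl a)
  have "(a + P * h * a * (a - 1) + P) mod P\<^sup>2 = ((a + P) + P * h * (a + P) * ((a + P) - 1)) mod P\<^sup>2"
    by (rule mod_eqI[where q = "- h * (2 * a + P - 1)"]) (simp add: algebra_simps power2_eq_square)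
  then show ?thesis by (simp add: Inl K_red_def K_Z_def K_X_def)
qed (simp add: K_red_def K_Z_def K_X_def)

lemma K_Zp: "K_red P (K_Z P h P t) = K_red P (K_X (c * P) (K_N P c 1 t))"
proof (cases t)
  case (Inl a)
  have "(a + P * h * P * a * (a - 1)) mod P\<^sup>2 = a mod P\<^sup>2"
    by (rule mod_eqI[where q = "h * a * (a - 1)"]) (simp add: algebra_simps power2_eq_square)
  then show ?thesis by (simp add: Inl K_red_def K_Z_def K_X_def K_N_def)
qed (simp add: K_red_def K_Z_def K_X_def K_N_def)

lemma K_YN: "K_red P (K_Y P c (- 1) 1 (K_N P c 1 t)) = K_red P (K_Y P 0 0 1 t)"
proof (cases t)
  case (Inl a)
  have "((a - c * P) * (1 - P) + c * P) mod P\<^sup>2 = (a * (1 - P)) mod P\<^sup>2"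
    by (rule mod_eqI[where q = c]) (simp add: algebra_simps power2_eq_square)
  then show ?thesis by (simp add: Inl K_red_def K_Y_def K_N_def)
qed (simp add: K_red_def K_Y_def K_N_def)

text \<open>The relations say \<open>x z = z x y\<close> and \<open>x y = y x\<^sup>1\<^sup>+\<^sup>p\<close>, with \<open>y\<close> and \<open>z\<close> commuting. They
  move \<open>x\<close> to the right past powers of \<open>z\<close> and \<open>y\<close>, which brings every product into the form
  \<open>z\<^sup>k y\<^sup>j x\<^sup>i\<close>.\<close>

lemma (in group) K_normal_form:
  fixes p :: nat
  assumes c: "x \<in> carrier G" "y \<in> carrier G" "z \<in> carrier G"
    and gen: "generate G {x, y, z} = carrier G" and p: "0 < p"
    and tor: "x [^] p\<^sup>2 = \<one>" "y [^] p = \<one>" "z [^] p\<^sup>2 = \<one>"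
    and rel: "comm G x y = x [^] p" "comm G x z = y" "comm G y z = \<one>"
    and g: "g \<in> carrier G"
  obtains i j k :: nat where "i < p\<^sup>2" "j < p" "k < p\<^sup>2" "g = z [^] k \<otimes> (y [^] j \<otimes> x [^] i)"
proof -
  have yz: "y \<otimes> z = z \<otimes> y" using rel(3) comm_eq_iff[of y z \<one>] c by simp
  have xz: "x \<otimes> z = z \<otimes> (x \<otimes> y)" using rel(2) comm_eq_iff[of x z y] c by (simp add: m_assoc)
  have xy: "x \<otimes> y = y \<otimes> x [^] (1 + p)"
  proof -
    have "x \<otimes> y = y \<otimes> (x \<otimes> x [^] p)"
      using iffD1[OF comm_eq_iff[OF c(1,2) nat_pow_closed[OF c(1)]] rel(1)] c by (simp add: m_assoc)
    also have "x \<otimes> x [^] p = x [^] (1 + p)"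
      using nat_pow_mult[OF c(1), of 1 p] c by simp
    finally show ?thesis .
  qed
  have yzk: "y \<otimes> z [^] k = z [^] k \<otimes> y" for k :: nat
    using commuting_power[of z y z k] yz c by simp
  have xzk: "x \<otimes> z [^] k = z [^] k \<otimes> (x \<otimes> y [^] k)" for k :: nat
  proof (induction k)
    case (Suc k)
    have "x \<otimes> z [^] Suc k = z [^] k \<otimes> (x \<otimes> (y [^] k \<otimes> z))"
      using c Suc by (simp flip: m_assoc)
    also have "y [^] k \<otimes> z = z \<otimes> y [^] k" using commuting_power[of y z y k] yz c by simp
    also have "x \<otimes> (z \<otimes> y [^] k) = (x \<otimes> z) \<otimes> y [^] k" using c by (simp add: m_assoc)
    also have "\<dots> = z \<otimes> (x \<otimes> (y \<otimes> y [^] k))" using c xz by (simp add: m_assoc)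
    also have "y \<otimes> y [^] k = y [^] Suc k" using c by (simp add: nat_pow_Suc2[symmetric])
    finally show ?case using c by (simp add: m_assoc)
  qed (use c in simp)
  have xym: "x \<otimes> y [^] m = y [^] m \<otimes> x [^] ((1 + p) ^ m)" for m :: nat
  proof (induction m)
    case (Suc m)
    have "x \<otimes> y [^] Suc m = y [^] m \<otimes> (x [^] ((1 + p) ^ m) \<otimes> y)"
      using c Suc by (simp flip: m_assoc)
    also have "x [^] ((1 + p) ^ m) \<otimes> y = y \<otimes> (x [^] (1 + p)) [^] ((1 + p) ^ m)"
      by (rule commuting_power) (use c xy in auto)
    also have "(x [^] (1 + p)) [^] ((1 + p) ^ m) = x [^] ((1 + p) ^ Suc m)"
      using c by (simp only: nat_pow_pow power_Suc)
    finally show ?case using c by (simp add: m_assoc)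
  qed (use c in simp)
  let ?A = "{z [^] k \<otimes> (y [^] j \<otimes> x [^] i) | (i::nat) (j::nat) (k::nat). True}"
  have "generate G {x, y, z} \<subseteq> ?A"
  proof (rule generate_left_closed)
    have "\<one> = z [^] (0::nat) \<otimes> (y [^] (0::nat) \<otimes> x [^] (0::nat))" by simp
    then show "\<one> \<in> ?A" by blast
    show "\<exists>n::nat. 0 < n \<and> s [^] n = \<one>" if "s \<in> {x, y, z}" for s
      using that tor p by (metis insertE singletonD zero_less_power)
    fix s a assume s: "s \<in> {x, y, z}" and "a \<in> ?A"
    then obtain i j k :: nat where a: "a = z [^] k \<otimes> (y [^] j \<otimes> x [^] i)" by blast
    have "x \<otimes> a = z [^] k \<otimes> (x \<otimes> (y [^] k \<otimes> y [^] j)) \<otimes> x [^] i"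
      unfolding a using c xzk[of k] by (simp flip: m_assoc)
    also have "y [^] k \<otimes> y [^] j = y [^] (k + j)" using c by (simp add: nat_pow_mult)
    also have "x \<otimes> y [^] (k + j) = y [^] (k + j) \<otimes> x [^] ((1 + p) ^ (k + j))" by (rule xym)
    also have "z [^] k \<otimes> (y [^] (k + j) \<otimes> x [^] ((1 + p) ^ (k + j))) \<otimes> x [^] i
        = z [^] k \<otimes> (y [^] (k + j) \<otimes> x [^] ((1 + p) ^ (k + j) + i))"
      using c by (simp add: m_assoc nat_pow_mult)
    finally have x: "x \<otimes> a \<in> ?A" by blast
    have "y \<otimes> a = z [^] k \<otimes> (y \<otimes> y [^] j \<otimes> x [^] i)"
      unfolding a using c yzk[of k] by (simp flip: m_assoc)
    also have "y \<otimes> y [^] j = y [^] Suc j" using c by (simp add: nat_pow_Suc2[symmetric])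
    finally have y: "y \<otimes> a \<in> ?A" by blast
    have "z \<otimes> a = z \<otimes> z [^] k \<otimes> (y [^] j \<otimes> x [^] i)" unfolding a using c by (simp add: m_assoc)
    also have "z \<otimes> z [^] k = z [^] Suc k" using c by (simp add: nat_pow_Suc2[symmetric])
    finally have z: "z \<otimes> a \<in> ?A" by blast
    from s x y z show "s \<otimes> a \<in> ?A" by blast
  qed (use c in auto)
  with g gen obtain i j k :: nat where "g = z [^] k \<otimes> (y [^] j \<otimes> x [^] i)" by blast
  then have "g = z [^] (k mod p\<^sup>2) \<otimes> (y [^] (j mod p) \<otimes> x [^] (i mod p\<^sup>2))"
    using c tor by (simp add: pow_mod)
  with p show thesis by (intro that) simp_all
qed

lemma residues_eqI: "i < n \<Longrightarrow> j < n \<Longrightarrow> int i mod int n = int j mod int n \<Longrightarrow> i = j"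
  by (simp flip: of_nat_mod)

lemma square_residues_eqI:
  "i < n\<^sup>2 \<Longrightarrow> j < n\<^sup>2 \<Longrightarrow> int i mod (int n)\<^sup>2 = int j mod (int n)\<^sup>2 \<Longrightarrow> i = j"
  using residues_eqI[of i "n\<^sup>2" j] by simp

text \<open>A homomorphism that separates normal forms is injective and shows that the normal forms are
  distinct elements.\<close>

lemma faithful_and_order:
  assumes f: "f \<in> hom E B" and onto: "carrier E \<subseteq> nf ` T" and sub: "nf ` T \<subseteq> carrier E"
    and inj: "\<And>s t. s \<in> T \<Longrightarrow> t \<in> T \<Longrightarrow> f (nf s) = f (nf t) \<Longrightarrow> s = t"
  shows "f \<in> mon E B" "order E = card T"
proof -
  have "nf ` T = carrier E" using onto sub by blast
  moreover have "inj_on nf T" by (rule inj_onI) (metis inj)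
  ultimately show "order E = card T" using card_image by (fastforce simp: order_def)
  have "inj_on f (carrier E)"
  proof (rule inj_onI)
    fix g h assume gh: "g \<in> carrier E" "h \<in> carrier E" "f g = f h"
    then obtain s t where "s \<in> T" "g = nf s" "t \<in> T" "h = nf t" using onto by blast
    with gh inj show "g = h" by blast
  qed
  with f show "f \<in> mon E B" by (simp add: mon_def)
qed

text \<open>The affine map \<open>t \<mapsto> (t + a)(1 - P i)\<close> modulo \<open>P\<^sup>2\<close> is determined by its values at \<open>0\<close>
  and \<open>1\<close>, and it determines \<open>a\<close> modulo \<open>P\<^sup>2\<close> and \<open>i\<close> modulo \<open>P\<close>.\<close>

lemma K_rigid:
  fixes P a b i j :: int
  assumes "a * (1 - P * i) mod P\<^sup>2 = b * (1 - P * j) mod P\<^sup>2"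
    and "(1 + a) * (1 - P * i) mod P\<^sup>2 = (1 + b) * (1 - P * j) mod P\<^sup>2" and "P \<noteq> 0"
  shows "i mod P = j mod P" "a mod P\<^sup>2 = b mod P\<^sup>2"
proof -
  have "P\<^sup>2 dvd ((1 + a) * (1 - P * i) - (1 + b) * (1 - P * j))
      - (a * (1 - P * i) - b * (1 - P * j))"
    by (rule dvd_diff) (use assms(1,2) in \<open>simp_all only: mod_eq_dvd_iff\<close>)
  also have "\<dots> = P * (j - i)" by (simp add: algebra_simps)
  finally have "P dvd j - i" using assms(3) by (simp add: power2_eq_square)
  then show "i mod P = j mod P" by (metis mod_eq_dvd_iff)
  from \<open>P dvd j - i\<close> obtain q where q: "j = i + P * q" by (metis dvdE diff_eq_eq add.commute)
  have "P\<^sup>2 dvd (a * (1 - P * i) - b * (1 - P * j)) * (1 + P * i)"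
    using assms(1) by (intro dvd_mult2) (simp add: mod_eq_dvd_iff)
  also have "(a * (1 - P * i) - b * (1 - P * j)) * (1 + P * i)
      = (a - b) + P\<^sup>2 * (b * q * (1 + P * i) - (a - b) * i * i)"
    unfolding q by (simp add: algebra_simps power2_eq_square)
  finally have "P\<^sup>2 dvd a - b" by (metis dvd_add_times_triv_right_iff mult.commute)
  then show "a mod P\<^sup>2 = b mod P\<^sup>2" by (simp add: mod_eq_dvd_iff)
qed

text \<open>Two normal forms with the same action agree on the right summand, which gives \<open>k\<close>; after
  cancelling \<open>z\<^sup>k\<close>, the left summand gives \<open>i\<close> and \<open>j\<close>.\<close>

lemma K_faithful:
  fixes E (structure)
  assumes p: "prime p" and P: "P = int p"
    and E: "group E" and c: "x \<in> carrier E" "y \<in> carrier E" "z \<in> carrier E"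
    and gen: "generate E {x, y, z} = carrier E"
    and tor: "x [^] p\<^sup>2 = \<one>" "y [^] p = \<one>" "z [^] p\<^sup>2 = \<one>"
    and rel: "comm E x y = x [^] p" "comm E x z = y" "comm E y z = \<one>"
    and f: "f \<in> hom E (K.perms P)"
    and fx: "f x = K.act P (K_X 1)" and fy: "f y = K.act P (K_Y P 0 0 1)"
    and fz: "f z = K.act P (K_Z P h 1)"
  shows "f \<in> mon E (K.perms P)" "order E = p ^ 5"
proof -
  interpret E: group E by (rule E)
  interpret B: group "K.perms P" by (rule group_BijGroup)
  interpret f: group_hom E "K.perms P" f
    by unfold_locales (rule f)
  have p0: "0 < p" using p by (rule prime_gt_0_nat)
  define T where "T = {..<p\<^sup>2} \<times> {..<p} \<times> {..<p\<^sup>2}"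
  define nf where "nf = (\<lambda>(i::nat, j::nat, k::nat). z [^] k \<otimes> (y [^] j \<otimes> x [^] i))"
  have f_tail: "f (y [^] j \<otimes> x [^] i) = K.act P (\<lambda>t. K_Y P 0 0 (int j) (K_X (int i) t))" for i j :: nat
    using c by (simp add: f.hom_nat_pow fx fy K.flow_nat_pow[OF flow_K_X] K.flow_nat_pow[OF flow_K_Y]
        K.act_mult K_admissible)
  have f_z: "f (z [^] k) = K.act P (K_Z P h (int k))" for k :: nat
    using c by (simp add: f.hom_nat_pow fz K.flow_nat_pow[OF flow_K_Z])
  have f_nf: "f (z [^] k \<otimes> (y [^] j \<otimes> x [^] i))
      = K.act P (\<lambda>t. K_Z P h (int k) (K_Y P 0 0 (int j) (K_X (int i) t)))" for i j k :: nat
    using c f_tail[of j i] f_z[of k] by (simp add: K.act_mult K.admissible_comp K_admissible)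
  have adm_tail: "K.admissible P (\<lambda>t. K_Y P 0 0 j (K_X i t))" for i j
    by (rule K.admissible_comp[OF K_admissible(2,1)])
  have adm: "K.admissible P (\<lambda>t. K_Z P h k (K_Y P 0 0 j (K_X i t)))" for i j k
    by (rule K.admissible_comp[OF K_admissible(3) adm_tail])
  have inj: "s = t" if st: "s \<in> T" "t \<in> T" "f (nf s) = f (nf t)" for s t
  proof -
    obtain i j k i' j' k' where s: "s = (i, j, k)" and t: "t = (i', j', k')" by (metis prod_cases3)
    have eq: "f (z [^] k \<otimes> (y [^] j \<otimes> x [^] i)) = f (z [^] k' \<otimes> (y [^] j' \<otimes> x [^] i'))"
      using st(3) by (simp add: s t nf_def)
    have "K_red P (K_Z P h (int k) (K_Y P 0 0 (int j) (K_X (int i) (Inr 0))))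
        = K_red P (K_Z P h (int k') (K_Y P 0 0 (int j') (K_X (int i') (Inr 0))))"
      by (rule K.act_eqD[OF eq[unfolded f_nf] adm adm])
    then have "int k mod P\<^sup>2 = int k' mod P\<^sup>2" by (simp add: K_red_def K_Z_def K_Y_def K_X_def)
    then have k: "k = k'" using st square_residues_eqI by (auto simp: s t T_def P)
    have eq': "f (y [^] j \<otimes> x [^] i) = f (y [^] j' \<otimes> x [^] i')"
    proof -
      have split: "f (z [^] k \<otimes> (y [^] j \<otimes> x [^] i))
          = f (z [^] k) \<otimes>\<^bsub>K.perms P\<^esub> f (y [^] j \<otimes> x [^] i)" for i j k :: nat
        by (rule f.hom_mult) (use c in auto)
      have "f (z [^] k) \<otimes>\<^bsub>K.perms P\<^esub> f (y [^] j \<otimes> x [^] i)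
          = f (z [^] k) \<otimes>\<^bsub>K.perms P\<^esub> f (y [^] j' \<otimes> x [^] i')"
        using eq unfolding k split .
      then show ?thesis by (subst (asm) B.Units_l_cancel) (use c in auto)
    qed
    have "K_red P (K_Y P 0 0 (int j) (K_X (int i) u)) = K_red P (K_Y P 0 0 (int j') (K_X (int i') u))" for u
      by (rule K.act_eqD[OF eq'[unfolded f_tail] adm_tail adm_tail])
    from this[of "Inl 0"] this[of "Inl 1"]
    have "int i * (1 - P * int j) mod P\<^sup>2 = int i' * (1 - P * int j') mod P\<^sup>2"
      "(1 + int i) * (1 - P * int j) mod P\<^sup>2 = (1 + int i') * (1 - P * int j') mod P\<^sup>2"
      by (simp_all add: K_red_def K_Y_def K_X_def)
    then have "int j mod P = int j' mod P" "int i mod P\<^sup>2 = int i' mod P\<^sup>2"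
      using K_rigid[of "int i" P "int j" "int i'" "int j'"] p0 P by simp_all
    then have "j = j'" "i = i'"
      using st residues_eqI square_residues_eqI by (auto simp: s t T_def P)
    with k show "s = t" by (simp add: s t)
  qed
  have onto: "carrier E \<subseteq> nf ` T"
  proof
    fix g assume "g \<in> carrier E"
    then obtain i j k where "i < p\<^sup>2" "j < p" "k < p\<^sup>2" "g = z [^] k \<otimes> (y [^] j \<otimes> x [^] i)"
      by (rule E.K_normal_form[OF c gen p0 tor rel])
    then have "(i, j, k) \<in> T" "g = nf (i, j, k)" by (simp_all add: T_def nf_def)
    then show "g \<in> nf ` T" by blast
  qed
  have sub: "nf ` T \<subseteq> carrier E" using c by (auto simp: nf_def)
  show "f \<in> mon E (K.perms P)" by (rule faithful_and_order(1)[OF f onto sub inj])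
  have "order E = card T" by (rule faithful_and_order(2)[OF f onto sub inj])
  then show "order E = p ^ 5" by (simp add: T_def card_cartesian_product eval_nat_numeral)
qed

text \<open>Here \<open>Z\<close> is spanned by \<open>w = [x, y]\<close> and \<open>v = z\<^sup>p\<close>, and \<open>v = w\<^sup>\<alpha> n\<close>. Since \<open>\<alpha>\<close> is
  invertible modulo \<open>p\<close>, the images of \<open>v\<close> and \<open>w\<close> modulo \<open>n\<close> are powers of each other, as
  \<open>avoiding_small_if_maximal_class\<close> requires.\<close>

lemma K_distinguished:
  fixes E (structure) and \<alpha> :: int
  assumes p: "prime p" "odd p" and P: "P = int p" "P = 2 * h - 1" and \<alpha>: "\<not> P dvd \<alpha>"
    and E: "group E" and c: "x \<in> carrier E" "y \<in> carrier E" "z \<in> carrier E"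
    and gen: "generate E {x, y, z} = carrier E"
    and tor: "x [^] p\<^sup>2 = \<one>" "y [^] p = \<one>" "z [^] p\<^sup>2 = \<one>"
    and rel: "comm E x y = x [^] p" "comm E x z = y" "comm E y z = \<one>"
    and n: "n \<in> centre E" "z [^] p = x [^] (\<alpha> * int p) \<otimes> n"
    and f: "f \<in> hom E (K.perms P)"
    and fx: "f x = K.act P (K_X 1)" and fy: "f y = K.act P (K_Y P 0 0 1)"
    and fz: "f z = K.act P (K_Z P h 1)"
  shows "order E = p ^ 5 \<and> min_degree E = 2 * p\<^sup>2 \<and> distinguished_subgroup (generate E {n}) E"
proof -
  interpret E: group E by (rule E)
  interpret B: group "K.perms P" by (rule group_BijGroup)
  interpret f: group_hom E "K.perms P" f
    by unfold_locales (rule f)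
  note mon = K_faithful[OF p(1) P(1) E c gen tor rel f fx fy fz]
  have p1: "1 < p" using prime_gt_1_nat[OF p(1)] .
  have p3: "3 \<le> p" using p prime_ge_2_nat[OF p(1)] by (cases "p = 2") auto
  have Pmod: "P mod P\<^sup>2 = P" "P \<noteq> 0"
    using p1 P(1) power_strict_increasing[of 1 2 P] by simp_all
  define w where "w = x [^] p"
  define v where "v = z [^] p"
  have wc: "w \<in> carrier E" "v \<in> carrier E" "n \<in> carrier E"
    using c n(1) by (simp_all add: w_def v_def centreD)
  have fw: "f (w [^] i) = K.act P (K_X (P * int i))" for i :: nat
    using c by (simp add: w_def f.hom_nat_pow fx K.flow_nat_pow[OF flow_K_X] P(1))
  have fv: "f v = K.act P (K_Z P h P)"
    using c by (simp add: v_def f.hom_nat_pow fz K.flow_nat_pow[OF flow_K_Z] P(1))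
  have inj: "g = g'" if "g \<in> carrier E" "g' \<in> carrier E" "f g = f g'" for g g'
    using mon(1) that by (auto simp: mon_def inj_on_def)
  have wp: "w [^] p = \<one>" using c tor by (simp add: w_def power2_eq_square E.nat_pow_pow)
  have vp: "v [^] p = \<one>" using c tor by (simp add: v_def power2_eq_square E.nat_pow_pow)
  have w_centre: "w \<in> centre E"
  proof (rule E.centre_if_commutes_generators[OF _ gen wc(1)])
    have xw: "x \<otimes> w = w \<otimes> x" using c by (simp add: w_def E.nat_pow_comm[of x 1 p, simplified])
    have "x \<otimes> y = y \<otimes> (x \<otimes> w)"
      using iffD1[OF E.comm_eq_iff[OF c(1,2) wc(1)]] rel(1) c wc by (simp add: E.m_assoc w_def)
    then have "w \<otimes> y = y \<otimes> (x \<otimes> w) [^] p"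
      unfolding w_def using c wc by (intro E.commuting_power) (simp_all add: w_def)
    also have "(x \<otimes> w) [^] p = w"
      using E.pow_mult_distrib[OF xw c(1) wc(1)] wp wc by (simp add: w_def)
    finally have yw: "y \<otimes> w = w \<otimes> y" by simp
    (* That z commutes with w is read off from the faithful permutations. *)
    have "f (z \<otimes> w) = f (w \<otimes> z)"
      using c wc fw[of 1] K_comm_Xp_Z[of P h]
      by (simp add: fz K.act_mult K_admissible) (auto intro!: K.act_eqI)
    then have "z \<otimes> w = w \<otimes> z" using inj c wc by simp
    with xw yw show "s \<otimes> w = w \<otimes> s" if "s \<in> {x, y, z}" for s using that by auto
  qed (use c in simp)
  have v_eq: "v = w [^] \<alpha> \<otimes> n"
  proof -
    have "w [^] \<alpha> = x [^] (int p * \<alpha>)"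
      unfolding w_def int_pow_int[symmetric] by (rule E.int_pow_pow[OF c(1)])
    then show ?thesis using n(2) by (simp add: v_def mult.commute)
  qed
  have v_centre: "v \<in> centre E"
    unfolding v_eq using E.subgroup_int_pow_closed[OF E.centre_subgroup w_centre] n(1)
      subgroup.m_closed[OF E.centre_subgroup] by blast
  have w1: "w \<noteq> \<one>"
  proof
    assume "w = \<one>"
    then have "K.act P (K_X (P * int 1)) = K.act P (K_X 0)"
      using fw[of 1] wc K.flow_zero[OF flow_K_X] by simp
    then have "K_red P (K_X (P * int 1) (Inl 0)) = K_red P (K_X 0 (Inl 0))"
      by (rule K.act_eqD) (rule K_admissible)+
    then show False using Pmod by (simp add: K_red_def K_X_def)
  qed
  have v_notin: "v \<notin> generate E {w}"
  proof
    assume "v \<in> generate E {w}"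
    moreover have "finite (carrier E)" using mon(2) p1 by (intro card_ge_0_finite) (simp add: order_def)
    ultimately obtain i :: nat where "v = w [^] i"
      using E.generate_pow_on_finite_carrier wc by blast
    then have "K.act P (K_Z P h P) = K.act P (K_X (P * int i))" using fw fv by simp
    then have "K_red P (K_Z P h P (Inr 0)) = K_red P (K_X (P * int i) (Inr 0))"
      by (rule K.act_eqD) (rule K_admissible)+
    then show False using Pmod by (simp add: K_red_def K_X_def K_Z_def)
  qed
  have w_pow_in: "w [^] i \<in> generate E {w}" for i :: int
    using wc by (intro E.subgroup_int_pow_closed E.generate_is_subgroup) (auto intro: generate.incl)
  have n_notin: "n \<notin> generate E {w}"
  proof
    assume "n \<in> generate E {w}"
    from generate.eng[OF w_pow_in this, of \<alpha>] v_eq v_notin show False by simp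
  qed
  have n1: "n \<noteq> \<one>" using n_notin generate.one by metis
  have wap: "(w [^] \<alpha>) [^] p = \<one>"
  proof -
    have "(w [^] \<alpha>) [^] int p = (w [^] int p) [^] \<alpha>"
      by (simp only: E.int_pow_pow[OF wc(1)] mult.commute)
    then show ?thesis using wp wc by (simp add: int_pow_int)
  qed
  have np: "n [^] p = \<one>"
  proof -
    have "w [^] \<alpha> \<otimes> n = n \<otimes> w [^] \<alpha>" using centreD(2)[OF n(1)] wc by simp
    from E.pow_mult_distrib[OF this] have "v [^] p = (w [^] \<alpha>) [^] p \<otimes> n [^] p"
      unfolding v_eq using wc by simp
    then show ?thesis using vp wap wc by simp
  qed
  have ordw: "E.ord w = p" by (rule E.ord_primeI[OF p(1) wc(1) wp w1])
  have ordn: "E.ord n = p" by (rule E.ord_primeI[OF p(1) wc(3) np n1])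
  have w_notin: "w \<notin> generate E {n}"
  proof
    assume "w \<in> generate E {n}"
    moreover have "generate E {w} \<inter> generate E {n} = {\<one>}"
      using E.cyclic_Int_trivial[OF p(1) wc(3), of 0 "generate E {w}"] ordn n_notin wc
      by (simp add: E.generate_is_subgroup)
    ultimately show False using w1 generate.incl[of w "{w}" E] by blast
  qed
  have small: "card H \<le> p"
    if "prime_power_group Q p 4" "group_hom E Q q" and onto: "q ` carrier E = carrier Q"
      and qn: "q n = \<one>\<^bsub>Q\<^esub>" and qw1: "q w \<noteq> \<one>\<^bsub>Q\<^esub>" and H: "subgroup H Q" "q w \<notin> H"
    for Q :: "'a set monoid" and q H
  proof -
    interpret Q: prime_power_group Q p 4 by fact
    interpret q: group_hom E Q q by fact
    have qw: "q w [^]\<^bsub>Q\<^esub> p = \<one>\<^bsub>Q\<^esub>" using q.hom_nat_pow[OF wc(1), of p] wp by simp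
    have comms: "comm Q (q x) (q y) = q w" "comm Q (q x) (q z) = q y"
      "comm Q (q y) (q z) = \<one>\<^bsub>Q\<^esub>"
      using q.hom_comm[OF c(1,2)] q.hom_comm[OF c(1,3)] q.hom_comm[OF c(2,3)] rel q.hom_one
      by (simp_all add: w_def)
    have qz: "q z [^]\<^bsub>Q\<^esub> p = q w [^]\<^bsub>Q\<^esub> \<alpha>"
    proof -
      have "q z [^]\<^bsub>Q\<^esub> p = q v" using q.hom_nat_pow[OF c(3)] by (simp add: v_def)
      also have "\<dots> = q (w [^] \<alpha>) \<otimes>\<^bsub>Q\<^esub> q n" unfolding v_eq using wc by (intro q.hom_mult) simp_all
      also have "\<dots> = q w [^]\<^bsub>Q\<^esub> \<alpha>"
        using q.hom_int_pow[OF wc(1), of \<alpha>] qn q.hom_closed[of "w [^] \<alpha>"] wc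
          Q.r_one[OF q.hom_closed[of "w [^] \<alpha>"]] by simp
      finally show ?thesis .
    qed
    have ordqw: "Q.ord (q w) = p"
      by (rule Q.ord_primeI[OF p(1) q.hom_closed[OF wc(1)] qw qw1])
    have "coprime \<alpha> (int p)"
      using \<alpha> p(1) P(1) by (metis coprime_commute prime_imp_coprime prime_nat_int_transfer)
    then obtain \<gamma> where "[\<alpha> * \<gamma> = 1] (mod int p)" using cong_solve_coprime_int by blast
    then have "int p dvd 1 - \<alpha> * \<gamma>" by (metis cong_iff_dvd_diff cong_sym)
    then have "q w [^]\<^bsub>Q\<^esub> (\<alpha> * \<gamma>) = q w [^]\<^bsub>Q\<^esub> (1::int)"
      using Q.int_pow_eq[OF q.hom_closed[OF wc(1)], of "\<alpha> * \<gamma>" 1] ordqw by simp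
    then have "(q z [^]\<^bsub>Q\<^esub> p) [^]\<^bsub>Q\<^esub> \<gamma> = q w"
      using q.hom_closed[OF wc(1)] by (simp only: qz Q.int_pow_pow Q.int_pow_1)
    moreover have "(q z [^]\<^bsub>Q\<^esub> p) [^]\<^bsub>Q\<^esub> \<gamma> \<in> generate Q {q z [^]\<^bsub>Q\<^esub> p}"
      using q.hom_closed[OF c(3)]
      by (intro Q.subgroup_int_pow_closed Q.generate_is_subgroup) (auto intro: generate.incl)
    ultimately have w_in: "q w \<in> generate Q {q z [^]\<^bsub>Q\<^esub> p}" by simp
    have "generate Q (q ` {x, y, z}) = q ` generate E {x, y, z}"
      by (rule q.generate_img) (use c in simp)
    then have genQ: "generate Q {q x, q y, q z} = carrier Q" using onto gen by simp
    show "card H \<le> p"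
      by (rule Q.avoiding_small_if_maximal_class[OF refl q.hom_closed[OF c(1)] q.hom_closed[OF c(2)]
            q.hom_closed[OF c(3)] genQ q.centre_image[OF onto w_centre] ordqw w_in comms H])
  qed
  have card: "finite (K.points P)" "card (K.points P) = 2 * p\<^sup>2"
    using card_K_points[of p] p1 P(1) by simp_all
  have "comm E x y = w" "v = z [^] p" using rel by (simp_all add: w_def v_def)
  note core = E.distinguished_if_commutator_and_power[OF p(1) p3 mon(2,1) card w_centre wp w1 c(1,2) this(1)
      v_centre vp v_notin c(3) this(2) n(1) np n1 wc(1) w_notin small]
  have "min_degree E = 2 * p\<^sup>2" by (rule core(1))
  moreover have "distinguished_subgroup (generate E {n}) E" by (rule core(2))
  ultimately show ?thesis using mon(2) by simp
qed

section \<open>The group E1\<close>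

text \<open>The left summand \<open>\<int>/p\<^sup>2\<close> stands for the cosets \<open>x\<^sup>t \<langle>y, z\<rangle>\<close>, on which \<open>n\<close> acts as \<open>x\<^sup>p\<close>;
  the right summand \<open>\<int>/p \<times> \<int>/p\<close> stands for the cosets \<open>z\<^sup>k n\<^sup>l \<langle>x, y\<rangle>\<close>.\<close>

definition H_red :: "int \<Rightarrow> int + int \<times> int \<Rightarrow> int + int \<times> int" where
  "H_red P = map_sum (\<lambda>t. t mod P\<^sup>2) (\<lambda>(k, l). (k mod P, l mod P))"

definition H_X :: "int \<Rightarrow> int + int \<times> int \<Rightarrow> int + int \<times> int" where
  "H_X i = map_sum (\<lambda>t. t + i) (\<lambda>(k, l). (k, l + i * k))"

definition H_Y :: "int \<Rightarrow> int + int \<times> int \<Rightarrow> int + int \<times> int" where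
  "H_Y j = map_sum (\<lambda>t. t) (\<lambda>(k, l). (k, l - j * k))"

definition H_Z :: "int \<Rightarrow> int \<Rightarrow> int + int \<times> int \<Rightarrow> int + int \<times> int" where
  "H_Z P m = map_sum (\<lambda>t. t * (1 - P * m)) (\<lambda>(k, l). (k + m, l))"

definition H_N :: "int \<Rightarrow> int \<Rightarrow> int + int \<times> int \<Rightarrow> int + int \<times> int" where
  "H_N P i = map_sum (\<lambda>t. t + P * i) (\<lambda>(k, l). (k, l + i))"

interpretation H: reduction "H_red P" for P
proof
  show "H_red P (H_red P t) = H_red P t" for t by (cases t) (auto simp: H_red_def)
qed

lemma card_H_points:
  assumes "0 < p"
  shows "finite (H.points (int p))" "card (H.points (int p)) = 2 * p\<^sup>2"
proof -
  have iff: "t mod (int p)\<^sup>2 = t \<longleftrightarrow> t \<in> {0..<(int p)\<^sup>2}"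
    "t mod (int p) = t \<longleftrightarrow> t \<in> {0..<int p}" for t :: int
    using assms by (auto simp only: residues_iff zero_less_power of_nat_0_less_iff)
  have "H.points (int p) = {0..<(int p)\<^sup>2} <+> ({0..<int p} \<times> {0..<int p})"
  proof (rule Set.set_eqI)
    fix t show "t \<in> H.points (int p) \<longleftrightarrow> t \<in> {0..<(int p)\<^sup>2} <+> ({0..<int p} \<times> {0..<int p})"
      unfolding H.points_def unfolding H_red_def by (cases t) (auto simp: iff)
  qed
  then show "finite (H.points (int p))" "card (H.points (int p)) = 2 * p\<^sup>2"
    by (simp_all add: card_Plus card_cartesian_product nat_power_eq) (simp add: power2_eq_square)
qed

lemma H_flowI:
  assumes "\<And>i a. H_red P (F i (Inl (a mod P\<^sup>2))) = H_red P (F i (Inl a))"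
    "\<And>i k l. H_red P (F i (Inr (k mod P, l mod P))) = H_red P (F i (Inr (k, l)))"
    "\<And>i j t. H_red P (F i (F j t)) = H_red P (F (i + j) t)" "\<And>t. F 0 t = t"
  shows "H.flow P F"
  unfolding H.flow_def
proof (intro conjI allI)
  fix i t show "H_red P (F i (H_red P t)) = H_red P (F i t)"
    using assms(1)[of i] assms(2)[of i] by (cases t) (auto simp: H_red_def)
qed (simp_all add: assms(3,4))

lemma flow_H_X: "H.flow P H_X"
proof (rule H_flowI)
  fix i j t show "H_red P (H_X i (H_X j t)) = H_red P (H_X (i + j) t)"
    by (cases t) (auto simp: H_red_def H_X_def algebra_simps)
  show "H_X 0 t = t" for t by (cases t) (auto simp: H_X_def)
next
  fix i k l
  have "(l mod P + i * (k mod P)) mod P = (l + i * k) mod P" 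
    by (intro mod_add_cong mod_mult_cong) simp_all
  then show "H_red P (H_X i (Inr (k mod P, l mod P))) = H_red P (H_X i (Inr (k, l)))"
    by (simp add: H_red_def H_X_def)
qed (simp add: H_red_def H_X_def mod_simps)

lemma flow_H_Y: "H.flow P H_Y"
proof (rule H_flowI)
  fix i j t show "H_red P (H_Y i (H_Y j t)) = H_red P (H_Y (i + j) t)"
    by (cases t) (auto simp: H_red_def H_Y_def algebra_simps)
  show "H_Y 0 t = t" for t by (cases t) (auto simp: H_Y_def)
next
  fix i k l
  have "(l mod P - i * (k mod P)) mod P = (l - i * k) mod P" 
    by (intro mod_diff_cong mod_mult_cong) simp_all
  then show "H_red P (H_Y i (Inr (k mod P, l mod P))) = H_red P (H_Y i (Inr (k, l)))"
    by (simp add: H_red_def H_Y_def)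
qed (simp add: H_red_def H_Y_def)

lemma flow_H_Z: "H.flow P (H_Z P)"
proof (rule H_flowI)
  fix i j t show "H_red P (H_Z P i (H_Z P j t)) = H_red P (H_Z P (i + j) t)"
  proof (cases t)
    case (Inl a)
    have "a * (1 - P * j) * (1 - P * i) mod P\<^sup>2 = a * (1 - P * (i + j)) mod P\<^sup>2"
      by (rule mod_eqI[where q = "a * i * j"]) (simp add: algebra_simps power2_eq_square)
    then show ?thesis by (simp add: Inl H_red_def H_Z_def)
  qed (auto simp: H_red_def H_Z_def add_ac)
  show "H_Z P 0 t = t" for t by (cases t) (auto simp: H_Z_def)
next
  fix i a
  show "H_red P (H_Z P i (Inl (a mod P\<^sup>2))) = H_red P (H_Z P i (Inl a))"
    by (simp add: H_red_def H_Z_def mod_mult_left_eq)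
qed (simp add: H_red_def H_Z_def mod_simps)

lemma flow_H_N: "H.flow P (H_N P)"
proof (rule H_flowI)
  fix i j t show "H_red P (H_N P i (H_N P j t)) = H_red P (H_N P (i + j) t)"
    by (cases t) (auto simp: H_red_def H_N_def algebra_simps)
  show "H_N P 0 t = t" for t by (cases t) (auto simp: H_N_def)
qed (simp_all add: H_red_def H_N_def mod_simps)

lemmas H_admissible =
  flow_H_X[THEN H.flow_admissible] flow_H_Y[THEN H.flow_admissible]
  flow_H_Z[THEN H.flow_admissible] flow_H_N[THEN H.flow_admissible]

lemma H_comm_XZ: "H_red P (H_X 1 (H_Z P 1 t)) = H_red P (H_Z P 1 (H_X 1 (H_N P 1 t)))"
proof (cases t)
  case (Inl a)
  have "(a * (1 - P) + 1) mod P\<^sup>2 = (a + P + 1) * (1 - P) mod P\<^sup>2"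
    by (rule mod_eqI[where q = 1]) (simp add: algebra_simps power2_eq_square)
  then show ?thesis by (simp add: Inl H_red_def H_X_def H_Z_def H_N_def)
qed (auto simp: H_red_def H_X_def H_Z_def H_N_def algebra_simps)

lemma H_comm_YZ:
  "H_red P (H_Y 1 (H_Z P 1 t)) = H_red P (H_Z P 1 (H_Y 1 (H_X P (H_N P (- 1) t))))"
proof (cases t)
  case (Inr b)
  obtain k l where b: "b = (k, l)" by force
  have "(l - (k + 1)) mod P = (l - 1 + P * k - k) mod P"
    by (rule mod_eqI[where q = "- k"]) simp
  then show ?thesis by (simp add: Inr b H_red_def H_X_def H_Y_def H_Z_def H_N_def)
qed (simp add: H_red_def H_X_def H_Y_def H_Z_def H_N_def)

lemma H_comm_XY: "H_red P (H_X 1 (H_Y 1 t)) = H_red P (H_Y 1 (H_X 1 t))"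
  by (cases t) (auto simp: H_red_def H_X_def H_Y_def)

lemma H_comm_XN: "H_red P (H_X 1 (H_N P 1 t)) = H_red P (H_N P 1 (H_X 1 t))"
  by (cases t) (auto simp: H_red_def H_X_def H_N_def algebra_simps)

lemma H_comm_YN: "H_red P (H_Y 1 (H_N P 1 t)) = H_red P (H_N P 1 (H_Y 1 t))"
  by (cases t) (auto simp: H_red_def H_Y_def H_N_def algebra_simps)

lemma H_comm_ZN: "H_red P (H_Z P 1 (H_N P 1 t)) = H_red P (H_N P 1 (H_Z P 1 t))"
proof (cases t)
  case (Inl a)
  have "(a + P) * (1 - P) mod P\<^sup>2 = (a * (1 - P) + P) mod P\<^sup>2"
    by (rule mod_eqI[where q = "- 1"]) (simp add: algebra_simps power2_eq_square)
  then show ?thesis by (simp add: Inl H_red_def H_Z_def H_N_def)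
qed (auto simp: H_red_def H_Z_def H_N_def)

context group
begin

lemma central_commutator_power:
  assumes "g \<in> carrier G" "h \<in> carrier G" "d \<in> centre G" "g \<otimes> h = h \<otimes> (g \<otimes> d)"
  shows "g \<otimes> h [^] (k::nat) = h [^] k \<otimes> (g \<otimes> d [^] k)"
proof (induction k)
  case (Suc k)
  note dc = centreD(1)[OF assms(3)]
  have dk: "d [^] k \<in> centre G" by (rule pow_in_subgroup[OF centre_subgroup assms(3)])
  have "g \<otimes> h [^] Suc k = h [^] k \<otimes> (g \<otimes> (d [^] k \<otimes> h))"
    using assms(1,2) dc Suc by (simp flip: m_assoc)
  also have "d [^] k \<otimes> h = h \<otimes> d [^] k" by (rule centreD(2)[OF dk assms(2)])
  also have "g \<otimes> (h \<otimes> d [^] k) = (g \<otimes> h) \<otimes> d [^] k" using assms(1,2) dc by (simp add: m_assoc)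
  also have "\<dots> = h \<otimes> (g \<otimes> (d \<otimes> d [^] k))" using assms(1,2,4) dc by (simp add: m_assoc)
  also have "d \<otimes> d [^] k = d [^] Suc k" using dc by (simp add: nat_pow_Suc2[symmetric])
  finally show ?case using assms(1,2) dc by (simp add: m_assoc)
qed (use assms centreD(1)[OF assms(3)] in simp)

context
  fixes x y z n and p :: nat
  assumes c: "x \<in> carrier G" "y \<in> carrier G" "z \<in> carrier G" "n \<in> carrier G"
    and gen: "generate G {x, y, z, n} = carrier G" and p: "0 < p"
    and tor: "x [^] p\<^sup>2 = \<one>" "y [^] p = \<one>" "z [^] p = \<one>" "n [^] p = \<one>"
    and rel: "comm G y z = x [^] p \<otimes> inv n" "comm G x z = n" "comm G x y = \<one>"
      "comm G x n = \<one>" "comm G y n = \<one>" "comm G z n = \<one>"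
begin

lemma E1_centre: "n \<in> centre G" "x [^] p \<in> centre G"
proof -
  have comm: "x \<otimes> y = y \<otimes> x" "x \<otimes> n = n \<otimes> x" "y \<otimes> n = n \<otimes> y" "z \<otimes> n = n \<otimes> z"
    using rel(3-6) c by (simp_all add: comm_eq_iff)
  show "n \<in> centre G"
    by (rule centre_if_commutes_generators[OF _ gen c(4)]) (use c comm in auto)
  have "x \<otimes> z = z \<otimes> (x \<otimes> n)" using rel(2) c by (simp add: comm_eq_iff m_assoc)
  then have "x [^] p \<otimes> z = z \<otimes> (x \<otimes> n) [^] p" using c by (intro commuting_power) simp_all
  also have "(x \<otimes> n) [^] p = x [^] p" using pow_mult_distrib[OF comm(2) c(1,4)] tor(4) c by simp
  finally have z: "x [^] p \<otimes> z = z \<otimes> x [^] p" .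
  have y: "x [^] p \<otimes> y = y \<otimes> x [^] p" and n: "x [^] p \<otimes> n = n \<otimes> x [^] p"
    and x: "x [^] p \<otimes> x = x \<otimes> x [^] p"
    using c comm by (auto intro!: commuting_power)
  show "x [^] p \<in> centre G"
    by (rule centre_if_commutes_generators[OF _ gen]) (use c x y z n in auto)
qed

text \<open>The relations are \<open>x z = z x n\<close> and \<open>y z = z y d\<close> with \<open>n\<close> and \<open>d = x\<^sup>p n\<^sup>-\<^sup>1\<close> central,
  so every element of the abelian subgroup generated by \<open>x\<close>, \<open>y\<close> and \<open>n\<close> moves past \<open>z\<^sup>k\<close> at the
  cost of another factor from this subgroup.\<close>

lemma E1_normal_form:
  assumes g: "g \<in> carrier G"
  obtains i j k l :: nat where "i < p\<^sup>2" "j < p" "k < p" "l < p"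
    "g = z [^] k \<otimes> (y [^] j \<otimes> (n [^] l \<otimes> x [^] i))"
proof -
  let ?U = "generate G {x, y, n}"
  have U: "subgroup ?U G" using c by (intro generate_is_subgroup) simp
  have gens: "x \<in> ?U" "y \<in> ?U" "n \<in> ?U" by (auto intro: generate.incl)
  have move: "\<exists>u \<in> ?U. s \<otimes> z [^] k = z [^] k \<otimes> u" if s: "s \<in> {x, y, n}" for s and k :: nat
  proof -
    let ?d = "x [^] p \<otimes> inv n"
    have "?d \<in> centre G" "?d \<in> ?U"
      using E1_centre subgroup.m_closed[OF centre_subgroup] subgroup.m_inv_closed[OF centre_subgroup]
        gens pow_in_subgroup[OF U] subgroup.m_closed[OF U] subgroup.m_inv_closed[OF U] by simp_all
    moreover have "y \<otimes> z = z \<otimes> (y \<otimes> ?d)" "x \<otimes> z = z \<otimes> (x \<otimes> n)"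
      using rel(1,2) c by (simp_all add: comm_eq_iff m_assoc)
    moreover have "n \<otimes> z = z \<otimes> (n \<otimes> \<one>)" using rel(6) c by (simp add: comm_eq_iff)
    moreover have "\<one> \<in> centre G" "\<one> \<in> ?U"
      using subgroup.one_closed[OF centre_subgroup] subgroup.one_closed[OF U] by simp_all
    ultimately obtain d where d: "d \<in> centre G" "d \<in> ?U" "s \<otimes> z = z \<otimes> (s \<otimes> d)"
      using s E1_centre(1) gens by blast
    have "s \<otimes> z [^] k = z [^] k \<otimes> (s \<otimes> d [^] k)"
      using s c by (intro central_commutator_power d(1,3)) auto
    moreover have "s \<otimes> d [^] k \<in> ?U"
      using s gens pow_in_subgroup[OF U d(2)] subgroup.m_closed[OF U] by blast
    ultimately show ?thesis by blast
  qed
  let ?A = "{z [^] k \<otimes> u | (k::nat) u. u \<in> ?U}" and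
    ?B = "{y [^] j \<otimes> (n [^] l \<otimes> x [^] i) | (i::nat) (j::nat) (l::nat). True}"
  have torsion: "\<exists>m::nat. 0 < m \<and> s [^] m = \<one>" if "s \<in> {x, y, z, n}" for s
    using that tor p by (metis insertE singletonD zero_less_power)
  have "generate G {x, y, z, n} \<subseteq> ?A"
  proof (rule generate_left_closed[OF _ _ _ _ torsion])
    have "\<one> = z [^] (0::nat) \<otimes> \<one>" by simp
    then show "\<one> \<in> ?A" using subgroup.one_closed[OF U] by blast
    show "?A \<subseteq> carrier G" using c subgroup.mem_carrier[OF U] by auto
    fix s a assume s: "s \<in> {x, y, z, n}" and "a \<in> ?A"
    then obtain k :: nat and u where a: "a = z [^] k \<otimes> u" and u: "u \<in> ?U" by blast
    have uc: "u \<in> carrier G" using u subgroup.mem_carrier[OF U] by blast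
    show "s \<otimes> a \<in> ?A"
    proof (cases "s = z")
      case True
      have "z \<otimes> a = z \<otimes> z [^] k \<otimes> u" unfolding a using c uc by (simp add: m_assoc)
      also have "z \<otimes> z [^] k = z [^] Suc k" using c by (simp only: nat_pow_Suc2)
      finally show ?thesis using True u by blast
    next
      case False
      with s move[of s k] obtain v where v: "v \<in> ?U" "s \<otimes> z [^] k = z [^] k \<otimes> v" by auto
      have sc: "s \<in> carrier G" using s c by auto
      have "s \<otimes> a = (s \<otimes> z [^] k) \<otimes> u" unfolding a using sc c uc by (simp add: m_assoc)
      also have "\<dots> = z [^] k \<otimes> (v \<otimes> u)"
        unfolding v(2) using c uc subgroup.mem_carrier[OF U v(1)] by (simp add: m_assoc)
      finally show ?thesis using subgroup.m_closed[OF U v(1) u] by blast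
    qed
  qed (use c in simp_all)
  with g gen obtain k :: nat and u where ku: "g = z [^] k \<otimes> u" "u \<in> ?U" by blast
  have "?U \<subseteq> ?B"
  proof (rule generate_left_closed)
    have "\<one> = y [^] (0::nat) \<otimes> (n [^] (0::nat) \<otimes> x [^] (0::nat))" by simp
    then show "\<one> \<in> ?B" by blast
    fix s a assume s: "s \<in> {x, y, n}" and "a \<in> ?B"
    then obtain i j l :: nat where a: "a = y [^] j \<otimes> (n [^] l \<otimes> x [^] i)" by blast
    have xy: "x \<otimes> y [^] j = y [^] j \<otimes> x" and xn: "x \<otimes> n [^] l = n [^] l \<otimes> x"
      and ny: "n \<otimes> y [^] j = y [^] j \<otimes> n"
      using commuting_power[of y x y j] commuting_power[of n x n l] commuting_power[of y n y j]
        rel(3-5) c by (simp_all add: comm_eq_iff)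
    have "x \<otimes> a = (x \<otimes> y [^] j) \<otimes> (n [^] l \<otimes> x [^] i)" unfolding a using c by (simp add: m_assoc)
    also have "\<dots> = y [^] j \<otimes> ((x \<otimes> n [^] l) \<otimes> x [^] i)" unfolding xy using c by (simp add: m_assoc)
    also have "\<dots> = y [^] j \<otimes> (n [^] l \<otimes> (x \<otimes> x [^] i))" unfolding xn using c by (simp add: m_assoc)
    finally have x: "x \<otimes> a = y [^] j \<otimes> (n [^] l \<otimes> x [^] Suc i)" using c by (simp only: nat_pow_Suc2)
    have "n \<otimes> a = (n \<otimes> y [^] j) \<otimes> (n [^] l \<otimes> x [^] i)" unfolding a using c by (simp add: m_assoc)
    also have "\<dots> = y [^] j \<otimes> ((n \<otimes> n [^] l) \<otimes> x [^] i)" unfolding ny using c by (simp add: m_assoc)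
    finally have n: "n \<otimes> a = y [^] j \<otimes> (n [^] Suc l \<otimes> x [^] i)" using c by (simp only: nat_pow_Suc2)
    have "y \<otimes> a = (y \<otimes> y [^] j) \<otimes> (n [^] l \<otimes> x [^] i)" unfolding a using c by (simp add: m_assoc)
    then have y: "y \<otimes> a = y [^] Suc j \<otimes> (n [^] l \<otimes> x [^] i)" using c by (simp only: nat_pow_Suc2)
    from s x y n show "s \<otimes> a \<in> ?B" by blast
  qed (use c torsion in auto)
  with ku obtain i j l :: nat where "g = z [^] k \<otimes> (y [^] j \<otimes> (n [^] l \<otimes> x [^] i))" by blast
  then have "g = z [^] (k mod p) \<otimes> (y [^] (j mod p) \<otimes> (n [^] (l mod p) \<otimes> x [^] (i mod p\<^sup>2)))"
    using c tor by (simp add: pow_mod)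
  with p show thesis by (intro that) simp_all
qed

end

end

text \<open>Here \<open>Z\<close> is spanned by the commutator \<open>n = [x, z]\<close> and \<open>w = x\<^sup>p\<close>. Modulo \<open>n\<close> the element
  \<open>x\<close> becomes central of order \<open>p\<^sup>2\<close> and \<open>[y, z] = x\<^sup>p\<close>, which is the situation of
  \<open>avoiding_small_if_cyclic_centre\<close>.\<close>

lemma E1_distinguished:
  fixes E (structure)
  assumes p: "prime p" "odd p" and P: "P = int p"
    and E: "group E" and c: "x \<in> carrier E" "y \<in> carrier E" "z \<in> carrier E" "n \<in> carrier E"
    and gen: "generate E {x, y, z, n} = carrier E"
    and tor: "x [^] p\<^sup>2 = \<one>" "y [^] p = \<one>" "z [^] p = \<one>" "n [^] p = \<one>"
    and rel: "comm E y z = x [^] p \<otimes> inv n" "comm E x z = n" "comm E x y = \<one>"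
      "comm E x n = \<one>" "comm E y n = \<one>" "comm E z n = \<one>"
    and f: "f \<in> hom E (H.perms P)"
    and fx: "f x = H.act P (H_X 1)" and fy: "f y = H.act P (H_Y 1)"
    and fz: "f z = H.act P (H_Z P 1)" and fn: "f n = H.act P (H_N P 1)"
  shows "order E = p ^ 5 \<and> min_degree E = 2 * p\<^sup>2 \<and> distinguished_subgroup (generate E {n}) E"
proof -
  interpret E: group E by (rule E)
  interpret B: group "H.perms P" by (rule group_BijGroup)
  interpret f: group_hom E "H.perms P" f
    by unfold_locales (rule f)
  have p1: "1 < p" using prime_gt_1_nat[OF p(1)] .
  then have p0: "0 < p" by simp
  have p3: "3 \<le> p" using p prime_ge_2_nat[OF p(1)] by (cases "p = 2") auto
  have Pmod: "P mod P\<^sup>2 = P" "P \<noteq> 0" "1 mod P = 1"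
    using p1 P power_strict_increasing[of 1 2 P] by simp_all
  note cen = E.E1_centre[OF c gen p0 tor rel]
  define T where "T = {..<p\<^sup>2} \<times> {..<p} \<times> {..<p} \<times> {..<p}"
  define nf where "nf = (\<lambda>(i::nat, j::nat, k::nat, l::nat). z [^] k \<otimes> (y [^] j \<otimes> (n [^] l \<otimes> x [^] i)))"
  have adm2: "H.admissible P (\<lambda>t. H_N P l (H_X i t))" for i l
    by (rule H.admissible_comp[OF H_admissible(4,1)])
  have adm3: "H.admissible P (\<lambda>t. H_Y j (H_N P l (H_X i t)))" for i j l
    by (rule H.admissible_comp[OF H_admissible(2) adm2])
  have adm: "H.admissible P (\<lambda>t. H_Z P k (H_Y j (H_N P l (H_X i t))))" for i j k l
    by (rule H.admissible_comp[OF H_admissible(3) adm3])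
  have f_nf: "f (z [^] k \<otimes> (y [^] j \<otimes> (n [^] l \<otimes> x [^] i)))
      = H.act P (\<lambda>t. H_Z P (int k) (H_Y (int j) (H_N P (int l) (H_X (int i) t))))" for i j k l :: nat
    using c by (simp add: f.hom_nat_pow fx fy fz fn H.flow_nat_pow[OF flow_H_X] H.flow_nat_pow[OF flow_H_Y]
        H.flow_nat_pow[OF flow_H_Z] H.flow_nat_pow[OF flow_H_N]
        H.act_mult adm2 adm3 H_admissible)
  have inj: "s = t" if st: "s \<in> T" "t \<in> T" "f (nf s) = f (nf t)" for s t
  proof -
    obtain i j k l i' j' k' l' where s: "s = (i, j, k, l)" and t: "t = (i', j', k', l')"
      by (metis prod_cases4)
    have eq: "f (z [^] k \<otimes> (y [^] j \<otimes> (n [^] l \<otimes> x [^] i)))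
        = f (z [^] k' \<otimes> (y [^] j' \<otimes> (n [^] l' \<otimes> x [^] i')))"
      using st(3) by (simp add: s t nf_def)
    have eq': "H_red P (H_Z P (int k) (H_Y (int j) (H_N P (int l) (H_X (int i) u))))
        = H_red P (H_Z P (int k') (H_Y (int j') (H_N P (int l') (H_X (int i') u))))" for u
      by (rule H.act_eqD[OF eq[unfolded f_nf] adm adm])
    (* The value at Inr (0, 0) gives k and l, the value at Inl 0 then gives i, and finally the value
       at Inr (1, 0) gives j. *)
    from eq'[of "Inr (0, 0)"] have "int k mod P = int k' mod P" "int l mod P = int l' mod P"
      by (simp_all add: H_red_def H_X_def H_Y_def H_Z_def H_N_def)
    then have kl: "k = k'" "l = l'" using st residues_eqI by (auto simp: s t T_def P)
    from eq'[of "Inl 0"] kl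
    have "(int i + P * int l) * (1 - P * int k) mod P\<^sup>2 = (int i' + P * int l) * (1 - P * int k) mod P\<^sup>2"
      by (simp add: H_red_def H_X_def H_Y_def H_Z_def H_N_def)
    then have "P\<^sup>2 dvd ((int i + P * int l) * (1 - P * int k) - (int i' + P * int l) * (1 - P * int k))
        * (1 + P * int k)"
      by (intro dvd_mult2) (simp only: mod_eq_dvd_iff)
    also have "((int i + P * int l) * (1 - P * int k) - (int i' + P * int l) * (1 - P * int k))
        * (1 + P * int k) = (int i - int i') + P\<^sup>2 * ((int i' - int i) * int k * int k)"
      by (simp add: algebra_simps power2_eq_square)
    finally have "P\<^sup>2 dvd int i - int i'" by (metis dvd_add_times_triv_right_iff mult.commute)
    then have "int i mod P\<^sup>2 = int i' mod P\<^sup>2" by (simp add: mod_eq_dvd_iff)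
    then have i: "i = i'" using st square_residues_eqI by (auto simp: s t T_def P)
    from eq'[of "Inr (1, 0)"] kl i
    have "(int l + int i - int j) mod P = (int l + int i - int j') mod P"
      by (simp add: H_red_def H_X_def H_Y_def H_Z_def H_N_def algebra_simps)
    then have "P dvd int j' - int j" by (simp add: mod_eq_dvd_iff)
    then have "int j mod P = int j' mod P" by (metis mod_eq_dvd_iff)
    then have "j = j'" using st residues_eqI by (auto simp: s t T_def P)
    with kl i show "s = t" by (simp add: s t)
  qed
  have onto: "carrier E \<subseteq> nf ` T"
  proof
    fix g assume "g \<in> carrier E"
    then obtain i j k l where "i < p\<^sup>2" "j < p" "k < p" "l < p"
      "g = z [^] k \<otimes> (y [^] j \<otimes> (n [^] l \<otimes> x [^] i))"
      by (rule E.E1_normal_form[OF c gen p0 tor rel])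
    then have "(i, j, k, l) \<in> T" "g = nf (i, j, k, l)" by (simp_all add: T_def nf_def)
    then show "g \<in> nf ` T" by blast
  qed
  have sub: "nf ` T \<subseteq> carrier E" using c by (auto simp: nf_def)
  have mon: "f \<in> mon E (H.perms P)" by (rule faithful_and_order(1)[OF f onto sub inj])
  have "order E = card T" by (rule faithful_and_order(2)[OF f onto sub inj])
  then have order: "order E = p ^ 5" by (simp add: T_def card_cartesian_product eval_nat_numeral)
  define w where "w = x [^] p"
  have wc: "w \<in> carrier E" using c by (simp add: w_def)
  have w_centre: "w \<in> centre E" using cen(2) by (simp add: w_def)
  have wp: "w [^] p = \<one>" using c tor by (simp add: w_def power2_eq_square E.nat_pow_pow)
  have fw: "f w = H.act P (H_X P)"
    using c by (simp add: w_def f.hom_nat_pow fx H.flow_nat_pow[OF flow_H_X] P)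
  have f_n: "f (n [^] i) = H.act P (H_N P (int i))" for i :: nat
    using c by (simp add: f.hom_nat_pow fn H.flow_nat_pow[OF flow_H_N])
  have n1: "n \<noteq> \<one>"
  proof
    assume "n = \<one>"
    then have "H.act P (H_N P 1) = H.act P (H_N P 0)"
      using fn H.flow_zero[OF flow_H_N] by simp
    then have "H_red P (H_N P 1 (Inr (0, 0))) = H_red P (H_N P 0 (Inr (0, 0)))"
      by (rule H.act_eqD) (rule H_admissible)+
    then show False using Pmod by (simp add: H_red_def H_N_def)
  qed
  have w_notin: "w \<notin> generate E {n}"
  proof
    assume "w \<in> generate E {n}"
    moreover have "finite (carrier E)" using order p1 by (intro card_ge_0_finite) (simp add: order_def)
    ultimately obtain i :: nat where "w = n [^] i"
      using E.generate_pow_on_finite_carrier c(4) by blast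
    then have "H.act P (H_X P) = H.act P (H_N P (int i))" using fw f_n by simp
    then have eq: "H_red P (H_X P u) = H_red P (H_N P (int i) u)" for u
      by (rule H.act_eqD) (rule H_admissible)+
    from eq[of "Inr (0, 0)"] have "P dvd int i" by (auto simp: H_red_def H_X_def H_N_def)
    then obtain q where "int i = P * q" by blast
    with eq[of "Inl 0"] show False using Pmod by (simp add: H_red_def H_X_def H_N_def power2_eq_square)
  qed
  have small: "card H \<le> p"
    if "prime_power_group Q p 4" "group_hom E Q q" and onto: "q ` carrier E = carrier Q"
      and qn: "q n = \<one>\<^bsub>Q\<^esub>" and qw1: "q w \<noteq> \<one>\<^bsub>Q\<^esub>" and H: "subgroup H Q" "q w \<notin> H"
    for Q :: "'a set monoid" and q H
  proof -
    interpret Q: prime_power_group Q p 4 by fact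
    interpret q: group_hom E Q q by fact
    have qw: "q w = q x [^]\<^bsub>Q\<^esub> p" using q.hom_nat_pow[OF c(1), of p] by (simp add: w_def)
    have genQ: "generate Q (q ` {x, y, z, n}) = carrier Q"
      using q.generate_img[of "{x, y, z, n}"] c onto gen by simp
    have commutes: "q s \<otimes>\<^bsub>Q\<^esub> q x = q x \<otimes>\<^bsub>Q\<^esub> q s" if s: "s \<in> {x, y, z, n}" for s
    proof -
      have sc: "s \<in> carrier E" using s c by auto
      have "comm E x x = \<one>" using c by (simp add: comm_def E.m_assoc)
      then have "comm E x s \<in> {\<one>, n}" using s rel(2-4) by auto
      then have "comm Q (q x) (q s) = \<one>\<^bsub>Q\<^esub>"
        using q.hom_comm[OF c(1) sc] qn q.hom_one by auto
      then have "q x \<otimes>\<^bsub>Q\<^esub> q s = q s \<otimes>\<^bsub>Q\<^esub> q x \<otimes>\<^bsub>Q\<^esub> \<one>\<^bsub>Q\<^esub>"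
        by (rule iffD1[OF Q.comm_eq_iff[OF q.hom_closed[OF c(1)] q.hom_closed[OF sc] Q.one_closed]])
      then show ?thesis
        using Q.r_one[OF Q.m_closed[OF q.hom_closed[OF sc] q.hom_closed[OF c(1)]]] by simp
    qed
    have x_centre: "q x \<in> centre Q"
      by (rule Q.centre_if_commutes_generators[OF _ genQ q.hom_closed[OF c(1)]])
        (use commutes c q.hom_closed in auto)
    have ordx: "Q.ord (q x) = p\<^sup>2"
    proof -
      have "q x [^]\<^bsub>Q\<^esub> (p ^ Suc 1) = \<one>\<^bsub>Q\<^esub>"
        using q.hom_nat_pow[OF c(1), of "p ^ Suc 1"] tor(1) q.hom_one by (simp add: numeral_2_eq_2)
      moreover have "q x [^]\<^bsub>Q\<^esub> (p ^ 1) \<noteq> \<one>\<^bsub>Q\<^esub>" using qw qw1 by simp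
      ultimately have "Q.ord (q x) = p ^ Suc 1" by (rule Q.ord_prime_powerI[OF p(1) q.hom_closed[OF c(1)]])
      then show ?thesis by (simp add: numeral_2_eq_2)
    qed
    have "comm Q (q y) (q z) = q (w \<otimes> inv n)" using q.hom_comm[OF c(2,3)] rel(1) by (simp add: w_def)
    also have "\<dots> = q w \<otimes>\<^bsub>Q\<^esub> inv\<^bsub>Q\<^esub> q n"
      using q.hom_mult[OF wc E.inv_closed[OF c(4)]] q.hom_inv[OF c(4)] by simp
    also have "\<dots> = q x [^]\<^bsub>Q\<^esub> p"
      unfolding qn using Q.r_one[OF q.hom_closed[OF wc]] qw Q.inv_one by simp
    finally have yz: "comm Q (q y) (q z) = q x [^]\<^bsub>Q\<^esub> p" .
    show "card H \<le> p"
      by (rule Q.avoiding_small_if_cyclic_centre[OF refl x_centre ordx q.hom_closed[OF c(2)] q.hom_closed[OF c(3)] yz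
            H(1) H(2)[unfolded qw]])
  qed
  have card: "finite (H.points P)" "card (H.points P) = 2 * p\<^sup>2"
    using card_H_points[of p] p1 P by simp_all
  note core = E.distinguished_if_commutator_and_power[OF p(1) p3 order mon card cen(1) tor(4) n1 c(1,3) rel(2)
      w_centre wp w_notin c(1) w_def cen(1) tor(4) n1 wc w_notin small]
  have "min_degree E = 2 * p\<^sup>2" by (rule core(1))
  moreover have "distinguished_subgroup (generate E {n}) E" by (rule core(2))
  ultimately show ?thesis using order by simp
qed

section \<open>The presented groups and their quotients\<close>

context group_hom
begin

lemma E1_rels_image:
  assumes "x \<in> carrier G" "y \<in> carrier G" "z \<in> carrier G" "n \<in> carrier G"
  shows "map_prod h h ` E1_rels p G x y z n = E1_rels p H (h x) (h y) (h z) (h n)"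
  using assms by (simp add: E1_rels_def hom_nat_pow hom_comm)

lemma E2_rels_image:
  assumes "x \<in> carrier G" "y \<in> carrier G" "z \<in> carrier G" "n \<in> carrier G"
  shows "map_prod h h ` E2_rels p G x y z n = E2_rels p H (h x) (h y) (h z) (h n)"
  using assms by (simp add: E2_rels_def hom_nat_pow hom_comm)

lemma E3_rels_image:
  assumes "x \<in> carrier G" "y \<in> carrier G" "z \<in> carrier G" "n \<in> carrier G"
  shows "map_prod h h ` E3_rels p \<alpha> G x y z n = E3_rels p \<alpha> H (h x) (h y) (h z) (h n)"
  using assms by (simp add: E3_rels_def hom_nat_pow hom_int_pow hom_comm)

lemma G1_rels_image:
  assumes "x \<in> carrier G" "y \<in> carrier G" "z \<in> carrier G"
  shows "map_prod h h ` G1_rels p G x y z = G1_rels p H (h x) (h y) (h z)"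
  using assms by (simp add: G1_rels_def hom_nat_pow hom_comm)

lemma G2_rels_image:
  assumes "x \<in> carrier G" "y \<in> carrier G" "z \<in> carrier G"
  shows "map_prod h h ` G2_rels p G x y z = G2_rels p H (h x) (h y) (h z)"
  using assms by (simp add: G2_rels_def hom_nat_pow hom_comm)

lemma G3_rels_image:
  assumes "x \<in> carrier G" "y \<in> carrier G" "z \<in> carrier G"
  shows "map_prod h h ` G3_rels p \<alpha> G x y z = G3_rels p \<alpha> H (h x) (h y) (h z)"
  using assms by (simp add: G3_rels_def hom_nat_pow hom_int_pow hom_comm)

end

lemma range_gens4: "range g = {g X4, g Y4, g Z4, g N4}"
  by (auto intro: gens4.exhaust) (metis gens4.exhaust)

lemma range_gens3: "range g = {g X3, g Y3, g Z3}"
  by (auto intro: gens3.exhaust) (metis gens3.exhaust)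

lemma presented_hom4:
  assumes R: "R \<subseteq> carrier free_group \<times> carrier free_group" and H: "group H"
    and image: "\<And>\<phi>. group_hom free_group H \<phi> \<Longrightarrow> map_prod \<phi> \<phi> ` R = rels (\<phi> (free_gen X4)) (\<phi> (free_gen Y4)) (\<phi> (free_gen Z4)) (\<phi> (free_gen N4))"
    and c: "x \<in> carrier H" "y \<in> carrier H" "z \<in> carrier H" "n \<in> carrier H" and rels: "holds (rels x y z n)"
  shows "\<exists>f \<in> hom (presented_group R) H. f (presented_class R (free_gen X4)) = x \<and>
    f (presented_class R (free_gen Y4)) = y \<and>
    f (presented_class R (free_gen Z4)) = z \<and>
    f (presented_class R (free_gen N4)) = n"
proof -
  define s where "s = case_gens4 x y z n"
  have sc: "s a \<in> carrier H" for a using c by (cases a) (simp_all add: s_def)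
  have "map_prod \<phi> \<phi> ` R = rels x y z n"
    if "\<phi> \<in> hom free_group H" "\<And>a. \<phi> (free_gen a) = s a" for \<phi>
    using image[of \<phi>] that H
    by (simp add: group_hom_def group_hom_axioms_def group_free_group s_def)
  then obtain f where "f \<in> hom (presented_group R) H" "\<And>a. f (presented_class R (free_gen a)) = s a"
    using presented_hom[where s = s, OF R H sc _ rels] by blast
  then show ?thesis by (intro bexI[of _ f]) (simp_all add: s_def)
qed

lemma presented_hom3:
  assumes R: "R \<subseteq> carrier free_group \<times> carrier free_group" and H: "group H"
    and image: "\<And>\<phi>. group_hom free_group H \<phi> \<Longrightarrow> map_prod \<phi> \<phi> ` R = rels (\<phi> (free_gen X3)) (\<phi> (free_gen Y3)) (\<phi> (free_gen Z3))"
    and c: "x \<in> carrier H" "y \<in> carrier H" "z \<in> carrier H" and rels: "holds (rels x y z)"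
  shows "\<exists>f \<in> hom (presented_group R) H. f (presented_class R (free_gen X3)) = x \<and>
    f (presented_class R (free_gen Y3)) = y \<and>
    f (presented_class R (free_gen Z3)) = z"
proof -
  define s where "s = case_gens3 x y z"
  have sc: "s a \<in> carrier H" for a using c by (cases a) (simp_all add: s_def)
  have "map_prod \<phi> \<phi> ` R = rels x y z"
    if "\<phi> \<in> hom free_group H" "\<And>a. \<phi> (free_gen a) = s a" for \<phi>
    using image[of \<phi>] that H
    by (simp add: group_hom_def group_hom_axioms_def group_free_group s_def)
  then obtain f where "f \<in> hom (presented_group R) H" "\<And>a. f (presented_class R (free_gen a)) = s a"
    using presented_hom[where s = s, OF R H sc _ rels] by blast
  then show ?thesis by (intro bexI[of _ f]) (simp_all add: s_def)
qed

text \<open>The quotient satisfies the relations of \<open>G\<close>, which gives \<open>k\<close>; sending \<open>n\<close> to \<open>1\<close> gives \<open>h\<close>.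
  The two maps match on generators. The generator \<open>m\<close> of \<open>N\<close> may be \<open>n\<close> or its inverse.\<close>

lemma quotient_iso_three_generators:
  assumes E: "group E" and G: "group G"
    and c: "x \<in> carrier E" "y \<in> carrier E" "z \<in> carrier E" "n \<in> carrier E"
    and genE: "generate E {x, y, z, n} = carrier E"
    and d: "x' \<in> carrier G" "y' \<in> carrier G" "z' \<in> carrier G"
    and genG: "generate G {x', y', z'} = carrier G"
    and N: "N \<lhd> E" "N = generate E {m}" "m \<in> carrier E" "n \<in> N"
    and h: "h \<in> hom E G" "h x = x'" "h y = y'" "h z = z'" "h n = \<one>\<^bsub>G\<^esub>" "h m = \<one>\<^bsub>G\<^esub>"
    and k: "k \<in> hom G (E Mod N)" "k x' = N #>\<^bsub>E\<^esub> x" "k y' = N #>\<^bsub>E\<^esub> y" "k z' = N #>\<^bsub>E\<^esub> z"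
  shows "E Mod N \<cong> G"
proof -
  interpret h: group_hom E G h
    by (simp add: group_hom_def group_hom_axioms_def E G h)
  have sub: "subgroup N E" using N(1) by (rule normal_imp_subgroup)
  have "generate G {x', y', z'} \<subseteq> generate G (h ` {x, y, z, n})"
    using h by (intro h.H.mono_generate) auto
  moreover have "generate G (h ` {x, y, z, n}) \<subseteq> carrier G"
    using c by (intro h.H.generate_incl) auto
  ultimately have onto: "h ` carrier E = carrier G"
    using genG c by (intro h.surj_if_generated[OF _ genE]) auto
  have kills: "N \<subseteq> kernel E G h"
    unfolding N(2) using N(3) h(6)
    by (intro h.G.generate_subgroup_incl h.subgroup_kernel) (simp add: kernel_def)
  have "k \<one>\<^bsub>G\<^esub> = \<one>\<^bsub>E Mod N\<^esub>"
    by (rule hom_one[OF k(1) G normal.factorgroup_is_group[OF N(1)]])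
  then have "k (h n) = N #>\<^bsub>E\<^esub> n"
    using h(5) h.G.coset_join2[OF c(4) sub N(4)] by simp
  then have inverse: "k (h s) = N #>\<^bsub>E\<^esub> s" if "s \<in> {x, y, z, n}" for s
    using that h k by auto
  show ?thesis
    by (rule h.quotient_iso_if_inverse[OF N(1) _ genE onto k(1) inverse kills]) (use c in auto)
qed

text \<open>Each presented group comes with its generators, the relations they satisfy, and the
  homomorphisms out of it.\<close>

definition E1_relators :: "nat \<Rightarrow> (gens4 word set \<times> gens4 word set) set" where
  "E1_relators p = E1_rels p free_group (free_gen X4) (free_gen Y4) (free_gen Z4) (free_gen N4)"

definition E1_gen :: "nat \<Rightarrow> gens4 \<Rightarrow> gens4 word set set" where
  "E1_gen p a = presented_class (E1_relators p) (free_gen a)"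

lemma E1_eq: "E1 p = presented_group (E1_relators p)"
  by (simp add: E1_def E1_relators_def)

lemma E1_relators_carrier: "E1_relators p \<subseteq> carrier free_group \<times> carrier free_group"
  by (simp add: E1_relators_def E1_rels_def)

lemma E1_relators_image:
  assumes "group_hom free_group H \<phi>"
  shows "map_prod \<phi> \<phi> ` E1_relators p = E1_rels p H (\<phi> (free_gen X4)) (\<phi> (free_gen Y4)) (\<phi> (free_gen Z4)) (\<phi> (free_gen N4))"
  by (simp add: E1_relators_def group_hom.E1_rels_image[OF assms])

lemma E1_facts:
  "group (E1 p)" "E1_gen p a \<in> carrier (E1 p)"
  "generate (E1 p) {E1_gen p X4, E1_gen p Y4, E1_gen p Z4, E1_gen p N4} = carrier (E1 p)"
  "holds (E1_rels p (E1 p) (E1_gen p X4) (E1_gen p Y4) (E1_gen p Z4) (E1_gen p N4))"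
  unfolding E1_eq E1_gen_def
  using presented_group_generated[OF E1_relators_carrier] unfolding range_gens4
  by (simp_all only: E1_relators_carrier group_presented_group presented_gen_closed
      presented_holds[OF E1_relators_carrier
        E1_relators_image[OF presented_class_group_hom[OF E1_relators_carrier]]])

lemma E1_hom:
  assumes H: "group H" and c: "x \<in> carrier H" "y \<in> carrier H" "z \<in> carrier H" "n \<in> carrier H"
    and rels: "holds (E1_rels p H x y z n)"
  shows "\<exists>f \<in> hom (E1 p) H. f (E1_gen p X4) = x \<and>
    f (E1_gen p Y4) = y \<and>
    f (E1_gen p Z4) = z \<and>
    f (E1_gen p N4) = n"
  unfolding E1_eq E1_gen_def
  by (rule presented_hom4[where rels = "E1_rels p H", OF E1_relators_carrier H E1_relators_image c rels])

definition E2_relators :: "nat \<Rightarrow> (gens4 word set \<times> gens4 word set) set" where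
  "E2_relators p = E2_rels p free_group (free_gen X4) (free_gen Y4) (free_gen Z4) (free_gen N4)"

definition E2_gen :: "nat \<Rightarrow> gens4 \<Rightarrow> gens4 word set set" where
  "E2_gen p a = presented_class (E2_relators p) (free_gen a)"

lemma E2_eq: "E2 p = presented_group (E2_relators p)"
  by (simp add: E2_def E2_relators_def)

lemma E2_relators_carrier: "E2_relators p \<subseteq> carrier free_group \<times> carrier free_group"
  by (simp add: E2_relators_def E2_rels_def)

lemma E2_relators_image:
  assumes "group_hom free_group H \<phi>"
  shows "map_prod \<phi> \<phi> ` E2_relators p = E2_rels p H (\<phi> (free_gen X4)) (\<phi> (free_gen Y4)) (\<phi> (free_gen Z4)) (\<phi> (free_gen N4))"
  by (simp add: E2_relators_def group_hom.E2_rels_image[OF assms])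

lemma E2_facts:
  "group (E2 p)" "E2_gen p a \<in> carrier (E2 p)"
  "generate (E2 p) {E2_gen p X4, E2_gen p Y4, E2_gen p Z4, E2_gen p N4} = carrier (E2 p)"
  "holds (E2_rels p (E2 p) (E2_gen p X4) (E2_gen p Y4) (E2_gen p Z4) (E2_gen p N4))"
  unfolding E2_eq E2_gen_def
  using presented_group_generated[OF E2_relators_carrier] unfolding range_gens4
  by (simp_all only: E2_relators_carrier group_presented_group presented_gen_closed
      presented_holds[OF E2_relators_carrier
        E2_relators_image[OF presented_class_group_hom[OF E2_relators_carrier]]])

lemma E2_hom:
  assumes H: "group H" and c: "x \<in> carrier H" "y \<in> carrier H" "z \<in> carrier H" "n \<in> carrier H"
    and rels: "holds (E2_rels p H x y z n)"
  shows "\<exists>f \<in> hom (E2 p) H. f (E2_gen p X4) = x \<and>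
    f (E2_gen p Y4) = y \<and>
    f (E2_gen p Z4) = z \<and>
    f (E2_gen p N4) = n"
  unfolding E2_eq E2_gen_def
  by (rule presented_hom4[where rels = "E2_rels p H", OF E2_relators_carrier H E2_relators_image c rels])

definition E3_relators :: "nat \<Rightarrow> int \<Rightarrow> (gens4 word set \<times> gens4 word set) set" where
  "E3_relators p \<alpha> = E3_rels p \<alpha> free_group (free_gen X4) (free_gen Y4) (free_gen Z4) (free_gen N4)"

definition E3_gen :: "nat \<Rightarrow> int \<Rightarrow> gens4 \<Rightarrow> gens4 word set set" where
  "E3_gen p \<alpha> a = presented_class (E3_relators p \<alpha>) (free_gen a)"

lemma E3_eq: "E3 p \<alpha> = presented_group (E3_relators p \<alpha>)"
  by (simp add: E3_def E3_relators_def)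

lemma E3_relators_carrier: "E3_relators p \<alpha> \<subseteq> carrier free_group \<times> carrier free_group"
  by (simp add: E3_relators_def E3_rels_def)

lemma E3_relators_image:
  assumes "group_hom free_group H \<phi>"
  shows "map_prod \<phi> \<phi> ` E3_relators p \<alpha> = E3_rels p \<alpha> H (\<phi> (free_gen X4)) (\<phi> (free_gen Y4)) (\<phi> (free_gen Z4)) (\<phi> (free_gen N4))"
  by (simp add: E3_relators_def group_hom.E3_rels_image[OF assms])

lemma E3_facts:
  "group (E3 p \<alpha>)" "E3_gen p \<alpha> a \<in> carrier (E3 p \<alpha>)"
  "generate (E3 p \<alpha>) {E3_gen p \<alpha> X4, E3_gen p \<alpha> Y4, E3_gen p \<alpha> Z4, E3_gen p \<alpha> N4} = carrier (E3 p \<alpha>)"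
  "holds (E3_rels p \<alpha> (E3 p \<alpha>) (E3_gen p \<alpha> X4) (E3_gen p \<alpha> Y4) (E3_gen p \<alpha> Z4) (E3_gen p \<alpha> N4))"
  unfolding E3_eq E3_gen_def
  using presented_group_generated[OF E3_relators_carrier] unfolding range_gens4
  by (simp_all only: E3_relators_carrier group_presented_group presented_gen_closed
      presented_holds[OF E3_relators_carrier
        E3_relators_image[OF presented_class_group_hom[OF E3_relators_carrier]]])

lemma E3_hom:
  assumes H: "group H" and c: "x \<in> carrier H" "y \<in> carrier H" "z \<in> carrier H" "n \<in> carrier H"
    and rels: "holds (E3_rels p \<alpha> H x y z n)"
  shows "\<exists>f \<in> hom (E3 p \<alpha>) H. f (E3_gen p \<alpha> X4) = x \<and>
    f (E3_gen p \<alpha> Y4) = y \<and>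
    f (E3_gen p \<alpha> Z4) = z \<and>
    f (E3_gen p \<alpha> N4) = n"
  unfolding E3_eq E3_gen_def
  by (rule presented_hom4[where rels = "E3_rels p \<alpha> H", OF E3_relators_carrier H E3_relators_image c rels])

definition G1_relators :: "nat \<Rightarrow> (gens3 word set \<times> gens3 word set) set" where
  "G1_relators p = G1_rels p free_group (free_gen X3) (free_gen Y3) (free_gen Z3)"

definition G1_gen :: "nat \<Rightarrow> gens3 \<Rightarrow> gens3 word set set" where
  "G1_gen p a = presented_class (G1_relators p) (free_gen a)"

lemma G1_eq: "G1 p = presented_group (G1_relators p)"
  by (simp add: G1_def G1_relators_def)

lemma G1_relators_carrier: "G1_relators p \<subseteq> carrier free_group \<times> carrier free_group"
  by (simp add: G1_relators_def G1_rels_def)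

lemma G1_relators_image:
  assumes "group_hom free_group H \<phi>"
  shows "map_prod \<phi> \<phi> ` G1_relators p = G1_rels p H (\<phi> (free_gen X3)) (\<phi> (free_gen Y3)) (\<phi> (free_gen Z3))"
  by (simp add: G1_relators_def group_hom.G1_rels_image[OF assms])

lemma G1_facts:
  "group (G1 p)" "G1_gen p a \<in> carrier (G1 p)"
  "generate (G1 p) {G1_gen p X3, G1_gen p Y3, G1_gen p Z3} = carrier (G1 p)"
  "holds (G1_rels p (G1 p) (G1_gen p X3) (G1_gen p Y3) (G1_gen p Z3))"
  unfolding G1_eq G1_gen_def
  using presented_group_generated[OF G1_relators_carrier] unfolding range_gens3
  by (simp_all only: G1_relators_carrier group_presented_group presented_gen_closed
      presented_holds[OF G1_relators_carrier
        G1_relators_image[OF presented_class_group_hom[OF G1_relators_carrier]]])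

lemma G1_hom:
  assumes H: "group H" and c: "x \<in> carrier H" "y \<in> carrier H" "z \<in> carrier H"
    and rels: "holds (G1_rels p H x y z)"
  shows "\<exists>f \<in> hom (G1 p) H. f (G1_gen p X3) = x \<and>
    f (G1_gen p Y3) = y \<and>
    f (G1_gen p Z3) = z"
  unfolding G1_eq G1_gen_def
  by (rule presented_hom3[where rels = "G1_rels p H", OF G1_relators_carrier H G1_relators_image c rels])

definition G2_relators :: "nat \<Rightarrow> (gens3 word set \<times> gens3 word set) set" where
  "G2_relators p = G2_rels p free_group (free_gen X3) (free_gen Y3) (free_gen Z3)"

definition G2_gen :: "nat \<Rightarrow> gens3 \<Rightarrow> gens3 word set set" where
  "G2_gen p a = presented_class (G2_relators p) (free_gen a)"

lemma G2_eq: "G2 p = presented_group (G2_relators p)"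
  by (simp add: G2_def G2_relators_def)

lemma G2_relators_carrier: "G2_relators p \<subseteq> carrier free_group \<times> carrier free_group"
  by (simp add: G2_relators_def G2_rels_def)

lemma G2_relators_image:
  assumes "group_hom free_group H \<phi>"
  shows "map_prod \<phi> \<phi> ` G2_relators p = G2_rels p H (\<phi> (free_gen X3)) (\<phi> (free_gen Y3)) (\<phi> (free_gen Z3))"
  by (simp add: G2_relators_def group_hom.G2_rels_image[OF assms])

lemma G2_facts:
  "group (G2 p)" "G2_gen p a \<in> carrier (G2 p)"
  "generate (G2 p) {G2_gen p X3, G2_gen p Y3, G2_gen p Z3} = carrier (G2 p)"
  "holds (G2_rels p (G2 p) (G2_gen p X3) (G2_gen p Y3) (G2_gen p Z3))"
  unfolding G2_eq G2_gen_def
  using presented_group_generated[OF G2_relators_carrier] unfolding range_gens3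
  by (simp_all only: G2_relators_carrier group_presented_group presented_gen_closed
      presented_holds[OF G2_relators_carrier
        G2_relators_image[OF presented_class_group_hom[OF G2_relators_carrier]]])

lemma G2_hom:
  assumes H: "group H" and c: "x \<in> carrier H" "y \<in> carrier H" "z \<in> carrier H"
    and rels: "holds (G2_rels p H x y z)"
  shows "\<exists>f \<in> hom (G2 p) H. f (G2_gen p X3) = x \<and>
    f (G2_gen p Y3) = y \<and>
    f (G2_gen p Z3) = z"
  unfolding G2_eq G2_gen_def
  by (rule presented_hom3[where rels = "G2_rels p H", OF G2_relators_carrier H G2_relators_image c rels])

definition G3_relators :: "nat \<Rightarrow> int \<Rightarrow> (gens3 word set \<times> gens3 word set) set" where
  "G3_relators p \<alpha> = G3_rels p \<alpha> free_group (free_gen X3) (free_gen Y3) (free_gen Z3)"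

definition G3_gen :: "nat \<Rightarrow> int \<Rightarrow> gens3 \<Rightarrow> gens3 word set set" where
  "G3_gen p \<alpha> a = presented_class (G3_relators p \<alpha>) (free_gen a)"

lemma G3_eq: "G3 p \<alpha> = presented_group (G3_relators p \<alpha>)"
  by (simp add: G3_def G3_relators_def)

lemma G3_relators_carrier: "G3_relators p \<alpha> \<subseteq> carrier free_group \<times> carrier free_group"
  by (simp add: G3_relators_def G3_rels_def)

lemma G3_relators_image:
  assumes "group_hom free_group H \<phi>"
  shows "map_prod \<phi> \<phi> ` G3_relators p \<alpha> = G3_rels p \<alpha> H (\<phi> (free_gen X3)) (\<phi> (free_gen Y3)) (\<phi> (free_gen Z3))"
  by (simp add: G3_relators_def group_hom.G3_rels_image[OF assms])

lemma G3_facts: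
  "group (G3 p \<alpha>)" "G3_gen p \<alpha> a \<in> carrier (G3 p \<alpha>)"
  "generate (G3 p \<alpha>) {G3_gen p \<alpha> X3, G3_gen p \<alpha> Y3, G3_gen p \<alpha> Z3} = carrier (G3 p \<alpha>)"
  "holds (G3_rels p \<alpha> (G3 p \<alpha>) (G3_gen p \<alpha> X3) (G3_gen p \<alpha> Y3) (G3_gen p \<alpha> Z3))"
  unfolding G3_eq G3_gen_def
  using presented_group_generated[OF G3_relators_carrier] unfolding range_gens3
  by (simp_all only: G3_relators_carrier group_presented_group presented_gen_closed
      presented_holds[OF G3_relators_carrier
        G3_relators_image[OF presented_class_group_hom[OF G3_relators_carrier]]])

lemma G3_hom:
  assumes H: "group H" and c: "x \<in> carrier H" "y \<in> carrier H" "z \<in> carrier H"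
    and rels: "holds (G3_rels p \<alpha> H x y z)"
  shows "\<exists>f \<in> hom (G3 p \<alpha>) H. f (G3_gen p \<alpha> X3) = x \<and>
    f (G3_gen p \<alpha> Y3) = y \<and>
    f (G3_gen p \<alpha> Z3) = z"
  unfolding G3_eq G3_gen_def
  by (rule presented_hom3[where rels = "G3_rels p \<alpha> H", OF G3_relators_carrier H G3_relators_image c rels])

text \<open>Setting \<open>n = 1\<close> turns the relations of \<open>E\<^sub>i\<close> into those of \<open>G\<^sub>i\<close>.\<close>

lemma (in group) rels_trivial_n:
  assumes "x \<in> carrier G" "y \<in> carrier G" "z \<in> carrier G"
  shows "holds (E1_rels p G x y z \<one>) \<longleftrightarrow> holds (G1_rels p G x y z)"
    "holds (E2_rels p G x y z \<one>) \<longleftrightarrow> holds (G2_rels p G x y z)"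
    "holds (E3_rels p \<alpha> G x y z \<one>) \<longleftrightarrow> holds (G3_rels p \<alpha> G x y z)"
proof -
  have "comm G g \<one> = \<one>" if "g \<in> carrier G" for g using that by (simp add: comm_def)
  then show "holds (E1_rels p G x y z \<one>) \<longleftrightarrow> holds (G1_rels p G x y z)"
    "holds (E2_rels p G x y z \<one>) \<longleftrightarrow> holds (G2_rels p G x y z)"
    "holds (E3_rels p \<alpha> G x y z \<one>) \<longleftrightarrow> holds (G3_rels p \<alpha> G x y z)"
    using assms
    by (auto simp: holds_def E1_rels_def G1_rels_def E2_rels_def G2_rels_def E3_rels_def G3_rels_def)
qed

lemma holds_image: "holds R \<Longrightarrow> holds (map_prod h h ` R)"
  by (auto simp: holds_def)

lemma H_satisfies_E1_rels:
  assumes "P = int p"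
  shows "holds (E1_rels p (H.perms P) (H.act P (H_X 1)) (H.act P (H_Y 1))
    (H.act P (H_Z P 1)) (H.act P (H_N P 1)))"
proof -
  let ?B = "H.perms P"
  interpret B: group ?B by (rule group_BijGroup)
  have X: "H_red P (H_X (P\<^sup>2) t) = H_red P (id t)" for t
  proof (cases t)
    case (Inr b)
    obtain k l where b: "b = (k, l)" by force
    have "(l + P\<^sup>2 * k) mod P = l mod P" by (simp add: power2_eq_square mult.assoc)
    then show ?thesis by (simp add: Inr b H_red_def H_X_def)
  qed (simp add: H_red_def H_X_def)
  have Y: "H_red P (H_Y P t) = H_red P (id t)" for t
  proof (cases t)
    case (Inr b)
    obtain k l where b: "b = (k, l)" by force
    have "(l - P * k) mod P = l mod P" by (rule mod_eqI[where q = "- k"]) simp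
    then show ?thesis by (simp add: Inr b H_red_def H_Y_def)
  qed (simp add: H_red_def H_Y_def)
  have Z: "H_red P (H_Z P P t) = H_red P (id t)" for t
  proof (cases t)
    case (Inl a)
    have "a * (1 - P * P) mod P\<^sup>2 = a mod P\<^sup>2"
      by (rule mod_eqI[where q = "- a"]) (simp add: algebra_simps power2_eq_square)
    then show ?thesis by (simp add: Inl H_red_def H_Z_def)
  qed (auto simp: H_red_def H_Z_def)
  have N: "H_red P (H_N P P t) = H_red P (id t)" for t
    by (cases t) (auto simp: H_red_def H_N_def power2_eq_square)
  have pow: "H.act P (H_X 1) [^]\<^bsub>?B\<^esub> p\<^sup>2 = \<one>\<^bsub>?B\<^esub>" "H.act P (H_Y 1) [^]\<^bsub>?B\<^esub> p = \<one>\<^bsub>?B\<^esub>"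
    "H.act P (H_Z P 1) [^]\<^bsub>?B\<^esub> p = \<one>\<^bsub>?B\<^esub>" "H.act P (H_N P 1) [^]\<^bsub>?B\<^esub> p = \<one>\<^bsub>?B\<^esub>"
    using H.act_eqI[where f = "H_X (P\<^sup>2)" and g = id, OF X] H.act_eqI[where f = "H_Y P" and g = id, OF Y]
      H.act_eqI[where f = "H_Z P P" and g = id, OF Z] H.act_eqI[where f = "H_N P P" and g = id, OF N] assms
    by (simp_all add: H.flow_nat_pow[OF flow_H_X] H.flow_nat_pow[OF flow_H_Y]
        H.flow_nat_pow[OF flow_H_Z] H.flow_nat_pow[OF flow_H_N] H.act_one)
  have "comm ?B (H.act P (H_Y 1)) (H.act P (H_Z P 1)) = H.act P (\<lambda>t. H_X P (H_N P (- 1) t))"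
    by (rule H.comm_act[OF H_admissible(2,3) H.admissible_comp[OF H_admissible(1,4)] H_comm_YZ])
  also have "\<dots> = H.act P (H_X 1) [^]\<^bsub>?B\<^esub> p \<otimes>\<^bsub>?B\<^esub> inv\<^bsub>?B\<^esub> H.act P (H_N P 1)"
    using assms
    by (simp add: H.flow_nat_pow[OF flow_H_X] H.flow_inv[OF flow_H_N] H.act_mult H_admissible)
  finally have YZ: "comm ?B (H.act P (H_Y 1)) (H.act P (H_Z P 1))
    = H.act P (H_X 1) [^]\<^bsub>?B\<^esub> p \<otimes>\<^bsub>?B\<^esub> inv\<^bsub>?B\<^esub> H.act P (H_N P 1)" .
  show ?thesis
    unfolding holds_def E1_rels_def
    using pow YZ H.comm_act[OF H_admissible(1,3,4) H_comm_XZ]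
      H.comm_act_one[OF H_admissible(1,2) H_comm_XY] H.comm_act_one[OF H_admissible(1,4) H_comm_XN]
      H.comm_act_one[OF H_admissible(2,4) H_comm_YN] H.comm_act_one[OF H_admissible(3,4) H_comm_ZN]
    by simp
qed

lemma K_pow_one:
  fixes p :: nat
  assumes "P = int p"
  defines "B \<equiv> K.perms P"
  shows "K.act P (K_X 1) [^]\<^bsub>B\<^esub> p\<^sup>2 = \<one>\<^bsub>B\<^esub>" "K.act P (K_Y P c d 1) [^]\<^bsub>B\<^esub> p = \<one>\<^bsub>B\<^esub>"
    "K.act P (K_Z P h 1) [^]\<^bsub>B\<^esub> p\<^sup>2 = \<one>\<^bsub>B\<^esub>" "K.act P (K_N P c i) [^]\<^bsub>B\<^esub> p = \<one>\<^bsub>B\<^esub>"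
proof -
  have X: "K_red P (K_X (P\<^sup>2) t) = K_red P (id t)" for t
    by (cases t) (simp_all add: K_red_def K_X_def)
  have Y: "K_red P (K_Y P c d P t) = K_red P (id t)" for t
  proof (cases t)
    case (Inl a)
    have "(a * (1 - P * P) + c * P * P) mod P\<^sup>2 = a mod P\<^sup>2"
      by (rule mod_eqI[where q = "c - a"]) (simp add: algebra_simps power2_eq_square)
    then show ?thesis by (simp add: Inl K_red_def K_Y_def)
  next
    case (Inr b)
    have "(b + d * P * P) mod P\<^sup>2 = b mod P\<^sup>2"
      by (rule mod_eqI[where q = d]) (simp add: algebra_simps power2_eq_square)
    then show ?thesis by (simp add: Inr K_red_def K_Y_def)
  qed
  have Z: "K_red P (K_Z P h (P\<^sup>2) t) = K_red P (id t)" for t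
  proof (cases t)
    case (Inl a)
    have "(a + P * h * P\<^sup>2 * a * (a - 1)) mod P\<^sup>2 = a mod P\<^sup>2"
      by (rule mod_eqI[where q = "P * h * a * (a - 1)"]) (simp add: algebra_simps)
    then show ?thesis by (simp add: Inl K_red_def K_Z_def)
  qed (simp add: K_red_def K_Z_def)
  have N: "K_red P (K_N P c (i * P) t) = K_red P (id t)" for t
  proof (cases t)
    case (Inl a)
    have "(a - c * P * (i * P)) mod P\<^sup>2 = a mod P\<^sup>2"
      by (rule mod_eqI[where q = "- c * i"]) (simp add: algebra_simps power2_eq_square)
    then show ?thesis by (simp add: Inl K_red_def K_N_def)
  next
    case (Inr b)
    have "(b + P * (i * P)) mod P\<^sup>2 = b mod P\<^sup>2"
      by (rule mod_eqI[where q = i]) (simp add: algebra_simps power2_eq_square)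
    then show ?thesis by (simp add: Inr K_red_def K_N_def)
  qed
  show "K.act P (K_X 1) [^]\<^bsub>B\<^esub> p\<^sup>2 = \<one>\<^bsub>B\<^esub>" "K.act P (K_Y P c d 1) [^]\<^bsub>B\<^esub> p = \<one>\<^bsub>B\<^esub>"
    "K.act P (K_Z P h 1) [^]\<^bsub>B\<^esub> p\<^sup>2 = \<one>\<^bsub>B\<^esub>" "K.act P (K_N P c i) [^]\<^bsub>B\<^esub> p = \<one>\<^bsub>B\<^esub>"
    using K.act_eqI[where f = "K_X (P\<^sup>2)" and g = id, OF X] K.act_eqI[where f = "K_Y P c d P" and g = id, OF Y]
      K.act_eqI[where f = "K_Z P h (P\<^sup>2)" and g = id, OF Z] K.act_eqI[where f = "K_N P c (i * P)" and g = id, OF N] assms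
    by (simp_all add: K.flow_nat_pow[OF flow_K_X] K.flow_nat_pow[OF flow_K_Y]
        K.flow_nat_pow[OF flow_K_Z] K.flow_nat_pow[OF flow_K_N] K.act_one)
qed

lemma K_comm_one:
  "comm (K.perms P) (K.act P (K_Y P c d 1)) (K.act P (K_Z P h 1)) = \<one>\<^bsub>K.perms P\<^esub>"
  "comm (K.perms P) (K.act P (K_X 1)) (K.act P (K_N P c' i)) = \<one>\<^bsub>K.perms P\<^esub>"
  "comm (K.perms P) (K.act P (K_Y P c d 1)) (K.act P (K_N P c' i)) = \<one>\<^bsub>K.perms P\<^esub>"
  "comm (K.perms P) (K.act P (K_Z P h 1)) (K.act P (K_N P c' i)) = \<one>\<^bsub>K.perms P\<^esub>"
  by (intro K.comm_act_one K_admissible K_comm_YZ K_comm_XN K_comm_YN K_comm_ZN)+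

lemma K_satisfies_E2_rels:
  assumes P: "P = int p" "P = 2 * h - 1"
  shows "holds (E2_rels p (K.perms P) (K.act P (K_X 1)) (K.act P (K_Y P 0 0 1))
    (K.act P (K_Z P h 1)) (K.act P (K_N P 1 (- 1))))"
proof -
  let ?B = "K.perms P"
  have Xp: "K.act P (K_X 1) [^]\<^bsub>?B\<^esub> p = K.act P (K_X P)"
    using P(1) by (simp add: K.flow_nat_pow[OF flow_K_X])
  have "K_red P (K_X P t) = K_red P (K_Z P h P (K_N P 1 (- 1) t))" for t
  proof (cases t)
    case (Inl a)
    have "(a + P) mod P\<^sup>2 = ((a + P) + P * h * P * (a + P) * ((a + P) - 1)) mod P\<^sup>2"
      by (rule mod_eqI[where q = "- h * (a + P) * ((a + P) - 1)"]) (simp add: algebra_simps power2_eq_square)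
    then show ?thesis by (simp add: Inl K_red_def K_X_def K_Z_def K_N_def)
  qed (simp add: K_red_def K_X_def K_Z_def K_N_def)
  then have "K.act P (K_X P) = K.act P (\<lambda>t. K_Z P h P (K_N P 1 (- 1) t))" by (rule K.act_eqI)
  then have XZN: "K.act P (K_X 1) [^]\<^bsub>?B\<^esub> p
      = K.act P (K_Z P h 1) [^]\<^bsub>?B\<^esub> p \<otimes>\<^bsub>?B\<^esub> K.act P (K_N P 1 (- 1))"
    using P(1) unfolding Xp by (simp add: K.flow_nat_pow[OF flow_K_Z] K.act_mult K_admissible)
  have XY: "comm ?B (K.act P (K_X 1)) (K.act P (K_Y P 0 0 1)) = K.act P (K_X 1) [^]\<^bsub>?B\<^esub> p"
    unfolding Xp by (rule K.comm_act[OF K_admissible(1,2,1) K_comm_XY])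
  show ?thesis
    unfolding holds_def E2_rels_def
    using K_pow_one[OF P(1)] K_comm_one[of P] XY XZN[symmetric]
      K.comm_act[OF K_admissible(1,3,2) K_comm_XZ[OF P(2)]]
    by simp
qed

lemma K_YN_act: "K.act P (K_Y P c (- 1) 1) \<otimes>\<^bsub>K.perms P\<^esub> K.act P (K_N P c 1)
    = K.act P (K_Y P 0 0 1)"
proof -
  have "K.act P (\<lambda>t. K_Y P c (- 1) 1 (K_N P c 1 t)) = K.act P (K_Y P 0 0 1)"
    by (rule K.act_eqI) (rule K_YN)
  then show ?thesis by (simp add: K.act_mult K_admissible)
qed

lemma K_satisfies_E3_rels:
  assumes P: "P = int p" "P = 2 * h - 1"
  shows "holds (E3_rels p \<alpha> (K.perms P) (K.act P (K_X 1)) (K.act P (K_Y P \<alpha> (- 1) 1))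
    (K.act P (K_Z P h 1)) (K.act P (K_N P \<alpha> 1)))"
proof -
  let ?B = "K.perms P"
  have ZXN: "K.act P (K_Z P h 1) [^]\<^bsub>?B\<^esub> p
      = K.act P (K_X 1) [^]\<^bsub>?B\<^esub> (\<alpha> * int p) \<otimes>\<^bsub>?B\<^esub> K.act P (K_N P \<alpha> 1)"
    using P(1) K.act_eqI[where f = "K_Z P h P" and g = "\<lambda>t. K_X (\<alpha> * P) (K_N P \<alpha> 1 t)", OF K_Zp]
    by (simp add: K.flow_nat_pow[OF flow_K_Z] K.flow_int_pow[OF flow_K_X] K.act_mult K_admissible)
  have "K.act P (K_X 1) [^]\<^bsub>?B\<^esub> p = K.act P (K_X P)"
    using P(1) by (simp add: K.flow_nat_pow[OF flow_K_X])
  then have XY: "comm ?B (K.act P (K_X 1)) (K.act P (K_Y P \<alpha> (- 1) 1)) = K.act P (K_X 1) [^]\<^bsub>?B\<^esub> p"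
    using K.comm_act[OF K_admissible(1,2,1) K_comm_XY] by simp
  have XZ: "comm ?B (K.act P (K_X 1)) (K.act P (K_Z P h 1))
      = K.act P (K_Y P \<alpha> (- 1) 1) \<otimes>\<^bsub>?B\<^esub> K.act P (K_N P \<alpha> 1)"
    unfolding K_YN_act by (rule K.comm_act[OF K_admissible(1,3,2) K_comm_XZ[OF P(2)]])
  show ?thesis
    unfolding holds_def E3_rels_def
    using K_pow_one[OF P(1)] K_comm_one[of P] XY XZ ZXN by simp
qed

lemma (in group) generate_eq_carrierI:
  assumes "generate G S = carrier G" "S \<subseteq> generate G T" "T \<subseteq> carrier G"
  shows "generate G T = carrier G"
  using assms generate_subgroup_incl[OF assms(2) generate_is_subgroup] generate_incl by blast

lemma (in group) centre_if_commutators_trivial: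
  assumes c: "x \<in> carrier G" "y \<in> carrier G" "z \<in> carrier G" "n \<in> carrier G"
    and gen: "generate G {x, y, z, n} = carrier G"
    and comm: "comm G x n = \<one>" "comm G y n = \<one>" "comm G z n = \<one>"
  shows "n \<in> centre G"
  by (rule centre_if_commutes_generators[OF _ gen c(4)]) (use c comm comm_eq_iff in auto)

lemma E1_case:
  assumes p: "prime p" "odd p"
  shows "order (E1 p) = p ^ 5 \<and> min_degree (E1 p) = 2 * p\<^sup>2 \<and>
    (\<exists>N. distinguished_subgroup N (E1 p) \<and> E1 p Mod N \<cong> G1 p)"
proof -
  let ?P = "int p" and ?E = "E1 p" and ?G = "G1 p"
  let ?B = "H.perms ?P"
  let ?x = "E1_gen p X4" and ?y = "E1_gen p Y4" and ?z = "E1_gen p Z4" and ?n = "E1_gen p N4"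
  let ?x' = "G1_gen p X3" and ?y' = "G1_gen p Y3" and ?z' = "G1_gen p Z3"
  interpret E: group ?E by (rule E1_facts)
  interpret G: group ?G by (rule G1_facts)
  note c = E1_facts(2)[of p] and d = G1_facts(2)[of p]
  have rel: "holds (E1_rels p ?E ?x ?y ?z ?n)" by (rule E1_facts)
  obtain f where f: "f \<in> hom ?E ?B" "f ?x = H.act ?P (H_X 1)" "f ?y = H.act ?P (H_Y 1)"
    "f ?z = H.act ?P (H_Z ?P 1)" "f ?n = H.act ?P (H_N ?P 1)"
    using E1_hom[OF group_BijGroup H.flow_carrier[OF flow_H_X] H.flow_carrier[OF flow_H_Y]
          H.flow_carrier[OF flow_H_Z] H.flow_carrier[OF flow_H_N] H_satisfies_E1_rels[OF refl]] by blast
  let ?N = "generate ?E {?n}"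
  have main: "order ?E = p ^ 5 \<and> min_degree ?E = 2 * p\<^sup>2 \<and> distinguished_subgroup ?N ?E"
    using rel
    by (intro E1_distinguished[OF p refl E.is_group c c c c E1_facts(3) _ _ _ _ _ _ _ _ _ _ f])
      (simp_all add: holds_def E1_rels_def)
  then have N: "?N \<lhd> ?E" by (simp add: distinguished_subgroup_def)
  let ?c = "r_coset ?E ?N"
  interpret c: group_hom ?E "?E Mod ?N" ?c by (rule normal.coset_group_hom[OF N])
  note cc = c.hom_closed[OF c]
  have cn: "?c ?n = \<one>\<^bsub>?E Mod ?N\<^esub>"
    using E.coset_join2[OF c normal_imp_subgroup[OF N] generate.incl] by simp
  have rels_h: "holds (E1_rels p ?G ?x' ?y' ?z' \<one>\<^bsub>?G\<^esub>)"
    by (rule G.rels_trivial_n(1)[THEN iffD2]) (rule G1_facts)+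
  obtain h where h: "h \<in> hom ?E ?G" "h ?x = ?x'" "h ?y = ?y'" "h ?z = ?z'" "h ?n = \<one>\<^bsub>?G\<^esub>"
    using E1_hom[OF G.is_group d d d G.one_closed rels_h] by blast
  have "holds (E1_rels p (?E Mod ?N) (?c ?x) (?c ?y) (?c ?z) (?c ?n))"
    using holds_image[OF rel, of ?c] unfolding c.E1_rels_image[OF c c c c] .
  then have rels_k: "holds (G1_rels p (?E Mod ?N) (?c ?x) (?c ?y) (?c ?z))"
    unfolding cn c.H.rels_trivial_n(1)[OF cc cc cc] .
  obtain k where k: "k \<in> hom ?G (?E Mod ?N)" "k ?x' = ?c ?x"
    "k ?y' = ?c ?y" "k ?z' = ?c ?z"
    using G1_hom[OF c.H.is_group cc cc cc rels_k] by blast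
  have "?E Mod ?N \<cong> ?G"
    by (rule quotient_iso_three_generators[OF E.is_group G.is_group c c c c E1_facts(3)
          d d d G1_facts(3) N refl c _ h h(5) k])
      (simp add: generate.incl)
  with main show ?thesis by blast
qed

text \<open>The relation \<open>x\<^sup>p = z\<^sup>p n\<close> reads \<open>z\<^sup>p = x\<^sup>p n\<^sup>-\<^sup>1\<close>, so \<open>n\<^sup>-\<^sup>1\<close> plays the part of
  \<open>n\<close> in \<open>K_distinguished\<close>.\<close>

lemma E2_case:
  assumes p: "prime p" "odd p"
  shows "order (E2 p) = p ^ 5 \<and> min_degree (E2 p) = 2 * p\<^sup>2 \<and>
    (\<exists>N. distinguished_subgroup N (E2 p) \<and> E2 p Mod N \<cong> G2 p)"
proof -
  let ?P = "int p" and ?E = "E2 p" and ?G = "G2 p"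
  let ?B = "K.perms ?P"
  let ?x = "E2_gen p X4" and ?y = "E2_gen p Y4" and ?z = "E2_gen p Z4" and ?n = "E2_gen p N4"
  let ?x' = "G2_gen p X3" and ?y' = "G2_gen p Y3" and ?z' = "G2_gen p Z3"
  interpret E: group ?E by (rule E2_facts)
  interpret G: group ?G by (rule G2_facts)
  note c = E2_facts(2)[of p] and d = G2_facts(2)[of p]
  have rel: "holds (E2_rels p ?E ?x ?y ?z ?n)" by (rule E2_facts)
  obtain q where "p = 2 * q + 1" using p(2) by (rule oddE)
  then have half: "?P = 2 * (int q + 1) - 1" by simp
  obtain f where f: "f \<in> hom ?E ?B" "f ?x = K.act ?P (K_X 1)" "f ?y = K.act ?P (K_Y ?P 0 0 1)"
    "f ?z = K.act ?P (K_Z ?P (int q + 1) 1)" "f ?n = K.act ?P (K_N ?P 1 (- 1))"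
    using E2_hom[OF group_BijGroup K.flow_carrier[OF flow_K_X] K.flow_carrier[OF flow_K_Y]
          K.flow_carrier[OF flow_K_Z] K.flow_carrier[OF flow_K_N] K_satisfies_E2_rels[OF refl half]] by blast
  have n: "?n \<in> centre ?E"
    using rel by (intro E.centre_if_commutators_trivial[OF c c c c E2_facts(3)])
      (simp_all add: holds_def E2_rels_def)
  then have inv_n: "inv\<^bsub>?E\<^esub> ?n \<in> centre ?E" by (rule subgroup.m_inv_closed[OF E.centre_subgroup])
  have xzn: "?x [^]\<^bsub>?E\<^esub> p = ?z [^]\<^bsub>?E\<^esub> p \<otimes>\<^bsub>?E\<^esub> ?n"
    using rel by (simp add: holds_def E2_rels_def)
  then have zx: "?z [^]\<^bsub>?E\<^esub> p = ?x [^]\<^bsub>?E\<^esub> (1 * int p) \<otimes>\<^bsub>?E\<^esub> inv\<^bsub>?E\<^esub> ?n"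
    using c by (simp add: E.m_assoc int_pow_int)
  have gen: "generate ?E {?x, ?y, ?z} = carrier ?E"
  proof (rule E.generate_eq_carrierI[OF E2_facts(3)])
    have sub: "subgroup (generate ?E {?x, ?y, ?z}) ?E" using c by (intro E.generate_is_subgroup) auto
    have gens: "{?x, ?y, ?z} \<subseteq> generate ?E {?x, ?y, ?z}" by (auto intro: generate.incl)
    have "?n = inv\<^bsub>?E\<^esub> (?z [^]\<^bsub>?E\<^esub> p) \<otimes>\<^bsub>?E\<^esub> ?x [^]\<^bsub>?E\<^esub> p" using c by (simp add: xzn)
    also have "\<dots> \<in> generate ?E {?x, ?y, ?z}"
      using gens by (intro subgroup.m_closed[OF sub] subgroup.m_inv_closed[OF sub] E.pow_in_subgroup[OF sub]) auto
    finally show "{?x, ?y, ?z, ?n} \<subseteq> generate ?E {?x, ?y, ?z}" using gens by blast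
  qed (use c in auto)
  have not_dvd: "\<not> ?P dvd 1" using prime_gt_1_nat[OF p(1)] by simp
  let ?m = "inv\<^bsub>?E\<^esub> ?n"
  let ?N = "generate ?E {?m}"
  have main: "order ?E = p ^ 5 \<and> min_degree ?E = 2 * p\<^sup>2 \<and> distinguished_subgroup ?N ?E"
    using rel
    by (intro K_distinguished[OF p refl half not_dvd E.is_group c c c gen _ _ _ _ _ _ inv_n zx f(1-4)])
      (simp_all add: holds_def E2_rels_def)
  then have N: "?N \<lhd> ?E" by (simp add: distinguished_subgroup_def)
  have n_in: "?n \<in> ?N" using generate.inv[of ?m "{?m}" ?E] c by simp
  let ?c = "r_coset ?E ?N"
  interpret c: group_hom ?E "?E Mod ?N" ?c by (rule normal.coset_group_hom[OF N])
  note cc = c.hom_closed[OF c]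
  have cn: "?c ?n = \<one>\<^bsub>?E Mod ?N\<^esub>"
    using E.coset_join2[OF c normal_imp_subgroup[OF N] n_in] by simp
  have rels_h: "holds (E2_rels p ?G ?x' ?y' ?z' \<one>\<^bsub>?G\<^esub>)"
    by (rule G.rels_trivial_n(2)[THEN iffD2]) (rule G2_facts)+
  obtain h where h: "h \<in> hom ?E ?G" "h ?x = ?x'" "h ?y = ?y'" "h ?z = ?z'" "h ?n = \<one>\<^bsub>?G\<^esub>"
    using E2_hom[OF G.is_group d d d G.one_closed rels_h] by blast
  then have hm: "h ?m = \<one>\<^bsub>?G\<^esub>"
    using group_hom.hom_inv[of ?E ?G h ?n] c
    by (simp add: group_hom_def group_hom_axioms_def E.is_group G.is_group)
  have "holds (E2_rels p (?E Mod ?N) (?c ?x) (?c ?y) (?c ?z) (?c ?n))"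
    using holds_image[OF rel, of ?c] unfolding c.E2_rels_image[OF c c c c] .
  then have rels_k: "holds (G2_rels p (?E Mod ?N) (?c ?x) (?c ?y) (?c ?z))"
    unfolding cn c.H.rels_trivial_n(2)[OF cc cc cc] .
  obtain k where k: "k \<in> hom ?G (?E Mod ?N)" "k ?x' = ?c ?x"
    "k ?y' = ?c ?y" "k ?z' = ?c ?z"
    using G2_hom[OF c.H.is_group cc cc cc rels_k] by blast
  have "?E Mod ?N \<cong> ?G"
    by (rule quotient_iso_three_generators[OF E.is_group G.is_group c c c c E2_facts(3)
          d d d G2_facts(3) N refl _ n_in h hm k])
      (use c in simp)
  with main show ?thesis by blast
qed

lemma E3_case:
  assumes p: "prime p" "odd p" and \<alpha>: "\<not> int p dvd \<alpha>"
  shows "order (E3 p \<alpha>) = p ^ 5 \<and> min_degree (E3 p \<alpha>) = 2 * p\<^sup>2 \<and>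
    (\<exists>N. distinguished_subgroup N (E3 p \<alpha>) \<and> E3 p \<alpha> Mod N \<cong> G3 p \<alpha>)"
proof -
  let ?P = "int p" and ?E = "E3 p \<alpha>" and ?G = "G3 p \<alpha>"
  let ?B = "K.perms ?P"
  let ?x = "E3_gen p \<alpha> X4" and ?y = "E3_gen p \<alpha> Y4" and ?z = "E3_gen p \<alpha> Z4" and ?n = "E3_gen p \<alpha> N4"
  let ?x' = "G3_gen p \<alpha> X3" and ?y' = "G3_gen p \<alpha> Y3" and ?z' = "G3_gen p \<alpha> Z3"
  interpret E: group ?E by (rule E3_facts)
  interpret G: group ?G by (rule G3_facts)
  note c = E3_facts(2)[of p \<alpha>] and d = G3_facts(2)[of p \<alpha>]
  have rel: "holds (E3_rels p \<alpha> ?E ?x ?y ?z ?n)" by (rule E3_facts)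
  obtain q where "p = 2 * q + 1" using p(2) by (rule oddE)
  then have half: "?P = 2 * (int q + 1) - 1" by simp
  obtain f where f: "f \<in> hom ?E ?B" "f ?x = K.act ?P (K_X 1)" "f ?y = K.act ?P (K_Y ?P \<alpha> (- 1) 1)"
    "f ?z = K.act ?P (K_Z ?P (int q + 1) 1)" "f ?n = K.act ?P (K_N ?P \<alpha> 1)"
    using E3_hom[OF group_BijGroup K.flow_carrier[OF flow_K_X] K.flow_carrier[OF flow_K_Y]
          K.flow_carrier[OF flow_K_Z] K.flow_carrier[OF flow_K_N] K_satisfies_E3_rels[OF refl half]] by blast
  have n: "?n \<in> centre ?E"
    using rel by (intro E.centre_if_commutators_trivial[OF c c c c E3_facts(3)])
      (simp_all add: holds_def E3_rels_def)
  have zx: "?z [^]\<^bsub>?E\<^esub> p = ?x [^]\<^bsub>?E\<^esub> (\<alpha> * int p) \<otimes>\<^bsub>?E\<^esub> ?n"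
    using rel by (simp add: holds_def E3_rels_def)
  (* As n is central, u satisfies the relations of y, and [x, z] = u. *)
  define u where "u = ?y \<otimes>\<^bsub>?E\<^esub> ?n"
  have uc: "u \<in> carrier ?E" using c by (simp add: u_def)
  have yn: "?y \<otimes>\<^bsub>?E\<^esub> ?n = ?n \<otimes>\<^bsub>?E\<^esub> ?y" using centreD(2)[OF n c] by simp
  have up: "u [^]\<^bsub>?E\<^esub> p = \<one>\<^bsub>?E\<^esub>"
    using E.pow_mult_distrib[OF yn c c, of p] rel by (simp add: u_def holds_def E3_rels_def)
  have one: "\<one>\<^bsub>?E\<^esub> \<in> centre ?E" by (rule subgroup.one_closed[OF E.centre_subgroup])
  have comms: "comm ?E ?x u = ?x [^]\<^bsub>?E\<^esub> p" "comm ?E ?x ?z = u" "comm ?E u ?z = \<one>\<^bsub>?E\<^esub>"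
    using E.comm_mult_centre[OF c c one n, of X4 Y4] E.comm_mult_centre_left[OF c c n, of Y4 Z4] rel c
    by (simp_all add: u_def holds_def E3_rels_def)
  have fu: "f u = K.act ?P (K_Y ?P 0 0 1)"
    using hom_mult[OF f(1) c c, of Y4 N4] f K_YN_act by (simp add: u_def)
  have gen: "generate ?E {?x, u, ?z} = carrier ?E"
  proof (rule E.generate_eq_carrierI[OF E3_facts(3)])
    have sub: "subgroup (generate ?E {?x, u, ?z}) ?E" using c uc by (intro E.generate_is_subgroup) auto
    have gens: "?x \<in> generate ?E {?x, u, ?z}" "u \<in> generate ?E {?x, u, ?z}" "?z \<in> generate ?E {?x, u, ?z}"
      by (auto intro: generate.incl)
    have "?n = inv\<^bsub>?E\<^esub> (?x [^]\<^bsub>?E\<^esub> (\<alpha> * int p)) \<otimes>\<^bsub>?E\<^esub> ?z [^]\<^bsub>?E\<^esub> p" using c by (simp add: zx)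
    also have "\<dots> \<in> generate ?E {?x, u, ?z}"
      using gens by (intro subgroup.m_closed[OF sub] subgroup.m_inv_closed[OF sub] E.pow_in_subgroup[OF sub]
          E.subgroup_int_pow_closed[OF sub])
    finally have n_in: "?n \<in> generate ?E {?x, u, ?z}" .
    have "?y = u \<otimes>\<^bsub>?E\<^esub> inv\<^bsub>?E\<^esub> ?n" using c by (simp add: u_def E.m_assoc)
    also have "\<dots> \<in> generate ?E {?x, u, ?z}"
      by (intro subgroup.m_closed[OF sub] subgroup.m_inv_closed[OF sub] gens n_in)
    finally show "{?x, ?y, ?z, ?n} \<subseteq> generate ?E {?x, u, ?z}" using gens n_in by blast
  qed (use c uc in auto)
  let ?N = "generate ?E {?n}"
  have main: "order ?E = p ^ 5 \<and> min_degree ?E = 2 * p\<^sup>2 \<and> distinguished_subgroup ?N ?E"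
    using rel
    by (intro K_distinguished[OF p refl half \<alpha> E.is_group c uc c gen _ up _ comms n zx f(1,2) fu f(4)])
      (simp_all add: holds_def E3_rels_def)
  then have N: "?N \<lhd> ?E" by (simp add: distinguished_subgroup_def)
  have n_in: "?n \<in> ?N" by (simp add: generate.incl)
  let ?c = "r_coset ?E ?N"
  interpret c: group_hom ?E "?E Mod ?N" ?c by (rule normal.coset_group_hom[OF N])
  note cc = c.hom_closed[OF c]
  have cn: "?c ?n = \<one>\<^bsub>?E Mod ?N\<^esub>"
    using E.coset_join2[OF c normal_imp_subgroup[OF N] n_in] by simp
  have rels_h: "holds (E3_rels p \<alpha> ?G ?x' ?y' ?z' \<one>\<^bsub>?G\<^esub>)"
    by (rule G.rels_trivial_n(3)[THEN iffD2]) (rule G3_facts)+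
  obtain h where h: "h \<in> hom ?E ?G" "h ?x = ?x'" "h ?y = ?y'" "h ?z = ?z'" "h ?n = \<one>\<^bsub>?G\<^esub>"
    using E3_hom[OF G.is_group d d d G.one_closed rels_h] by blast
  have "holds (E3_rels p \<alpha> (?E Mod ?N) (?c ?x) (?c ?y) (?c ?z) (?c ?n))"
    using holds_image[OF rel, of ?c] unfolding c.E3_rels_image[OF c c c c] .
  then have rels_k: "holds (G3_rels p \<alpha> (?E Mod ?N) (?c ?x) (?c ?y) (?c ?z))"
    unfolding cn c.H.rels_trivial_n(3)[OF cc cc cc] .
  obtain k where k: "k \<in> hom ?G (?E Mod ?N)" "k ?x' = ?c ?x"
    "k ?y' = ?c ?y" "k ?z' = ?c ?z"
    using G3_hom[OF c.H.is_group cc cc cc rels_k] by blast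
  have "?E Mod ?N \<cong> ?G"
    by (rule quotient_iso_three_generators[OF E.is_group G.is_group c c c c E3_facts(3)
          d d d G3_facts(3) N refl c n_in h h(5) k])
  with main show ?thesis by blast
qed

theorem theorem5:
  fixes p :: nat and \<alpha> :: int
  assumes "prime p" and "odd p" and "\<not> QuadRes (int p) \<alpha>"
  shows "\<forall>(E, G) \<in> {(E1 p, G1 p), (E2 p, G2 p), (E3 p \<alpha>, G3 p \<alpha>)}.
           order E = p ^ 5 \<and> min_degree E = 2 * p\<^sup>2 \<and> exceptional E \<and>
           (\<exists>N. distinguished_subgroup N E \<and> E Mod N \<cong> G)"
proof -
  have "\<not> int p dvd \<alpha>"
  proof
    assume "int p dvd \<alpha>"
    then have "[0\<^sup>2 = \<alpha>] (mod int p)" by (auto simp: cong_def)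
    with assms(3) show False unfolding QuadRes_def by blast
  qed
  with E1_case[OF assms(1,2)] E2_case[OF assms(1,2)] E3_case[OF assms(1,2)] show ?thesis
    by (auto simp: exceptional_def)
qed

end
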